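(* The Cauchy problem $$\partial_{tt} U(t,x)=t\,\partial_{xx}U(t,x)+W(t,x)\ \ (t>0,\ x\in\mathbb{R}),\qquad U(0,x)=0,\ \ \partial_tU(0,x)=0\ \ (x\in\mathbb{R}),$$ where $W$ is a space-time Gaussian white noise, admits a unique solution, in the mild random-field sense described in the context, which is a Gaussian random field with representation $$U(t,x)=\sum_{m,n\geq 1}u_{mn}(t,x)\,\mathtt{z}_{mn},\qquad t\geq 0,\ x\in\mathbb{R},$$ where $$u_{mn}(t,x):=\frac{(-i)^{n}}{2\pi}\int_{\mathbb{R}}\int_{0}^te^{ix\xi}\,C(t,s,|\xi|)\,\psi_m(s)\,\varphi_n(\xi)\,ds\,d\xi .$$ Here, for $\rho>0$, $$C(t,s,\rho):=-\frac{\pi}{\rho^{2/3}}\left[\mathrm{Bi}(-\rho^{2/3}t)\,\mathrm{Ai}(-\rho^{2/3}s)-\mathrm{Ai}(-\rho^{2/3}t)\,\mathrm{Bi}(-\rho^{2/3}s)\right],\qquad s,t\ge 0,$$ and $C(t,s,0):=t-s$, where $\mathrm{Ai}$ and $\mathrm{Bi}$ are the Airy functions. The series representing $U(t,x)$ converges in $\mathbb{L}^2(\Omega,\mathcal{F},\mathbb{P})$ and almost surely. Furthermore, $$\mathbb{E}[|U(t,x)|^2]=\frac{1}{2\pi^2}\int_0^{+\infty}\int_0^{t}\left|C(t,s,\rho)\right|^2\,ds\,d\rho<+\infty,\qquad t\geq 0,\ x\in\mathbb{R}.$$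
   Context: Let $\{\psi_m\}_{m\ge1}$ be a fixed real, smooth orthonormal basis of $L^2([0,+\infty))$ (for instance, a Laguerre basis), let $\{\varphi_n\}_{n\ge1}$ be the orthonormal basis of $L^2(\mathbb{R})$ made of Hermite functions, and let $\{\mathtt{z}_{mn}\}_{m,n\ge1}$ be a family of independent standard Gaussian random variables defined on a common probability space $(\Omega,\mathcal{F},\mathbb{P})$. The space-time Gaussian white noise $\{W(t,x)\}_{t\ge0,x\in\mathbb{R}}$ is represented through the formal series $$W(t,x)=\sum_{m,n\ge1}\psi_m(t)\varphi_n(x)\mathtt{z}_{mn},\qquad t\ge0,\ x\in\mathbb{R}.$$ For $N\ge1$ set $W_N(t,x):=\sum_{m,n=1}^N\psi_m(t)\varphi_n(x)\mathtt{z}_{mn}$, a finite-rank smooth approximation of the noise. Let $U_N$ be the solution of $$\partial_{tt}U_N=t\,\partial_{xx}U_N+W_N\ \ (t>0,\ x\in\mathbb{R}),\qquad U_N(0,x)=0,\ \ \partial_tU_N(0,x)=0\ \ (x\in\mathbb{R}),$$ treated $\omega$-wise as a deterministic non-homogeneous Tricomi equation and represented, with $C$ as in the claim, by $$U_N(t,x)=\frac{1}{2\pi}\int_{\mathbb{R}}e^{i\xi x}\int_0^tC(t,s,|\xi|)\,\widehat{W_N}(s,\xi)\,ds\,d\xi,\qquad \widehat{W_N}(s,\xi)=\int_{\mathbb{R}}e^{-i\xi x}W_N(s,x)\,dx.$$ A solution (in the mild random-field sense) of the stochastic Cauchy problem is by definition $U(t,x):=\lim_{N\to+\infty}U_N(t,x)$,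 the limit being in $\mathbb{L}^2(\Omega,\mathcal{F},\mathbb{P})$ for all $t\ge0$ and $x\in\mathbb{R}$.
   Formalization: The printed constants contradict the definition of U_N; in the formal theorem u_mn has the factor (-i)^{n-1}/sqrt(2π) instead of (-i)^n/(2π), with φ_n of degree n-1, and E|U|^2 has the factor 1/π instead of 1/(2π^2). *)

theory Defs
  imports "HOL-Probability.Probability" "HOL-Computational_Algebra.Polynomial"
begin

text \<open>The Airy functions, as combinations of the two standard power-series solutions of
  \<open>y'' = x y\<close>; the constants are \<open>Ai(0)\<close> and \<open>-Ai'(0)\<close>.\<close>

definition airy_f :: "real \<Rightarrow> real" where
  "airy_f x = (\<Sum>k. 3 ^ k * pochhammer (1/3) k * x ^ (3 * k) / fact (3 * k))"

definition airy_g :: "real \<Rightarrow> real" where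
  "airy_g x = (\<Sum>k. 3 ^ k * pochhammer (2/3) k * x ^ (3 * k + 1) / fact (3 * k + 1))"

definition Ai :: "real \<Rightarrow> real" where
  "Ai x = airy_f x / (3 powr (2/3) * Gamma (2/3)) - airy_g x / (3 powr (1/3) * Gamma (1/3))"

definition Bi :: "real \<Rightarrow> real" where
  "Bi x = sqrt 3 * (airy_f x / (3 powr (2/3) * Gamma (2/3)) + airy_g x / (3 powr (1/3) * Gamma (1/3)))"

definition tricomi_C :: "real \<Rightarrow> real \<Rightarrow> real \<Rightarrow> real" where
  "tricomi_C t s \<rho> =
     (if \<rho> = 0 then t - s
      else - (pi / \<rho> powr (2/3)) *
        (Bi (- (\<rho> powr (2/3)) * t) * Ai (- (\<rho> powr (2/3)) * s) -
         Ai (- (\<rho> powr (2/3)) * t) * Bi (- (\<rho> powr (2/3)) * s)))"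

text \<open>Physicists' Hermite polynomials (the recursion is Rodrigues' formula, differentiated once),
  and the \<open>L\<^sup>2\<close>-normalized Hermite functions. These are enumerated from 1,
  so \<open>hermite_fun n\<close> has polynomial degree \<open>n - 1\<close>.\<close>

primrec hermite_poly :: "nat \<Rightarrow> real poly" where
  "hermite_poly 0 = 1"
| "hermite_poly (Suc n) = [:0, 2:] * hermite_poly n - pderiv (hermite_poly n)"

definition hermite_fun :: "nat \<Rightarrow> real \<Rightarrow> real" where
  "hermite_fun n x =
     exp (- (x\<^sup>2) / 2) * poly (hermite_poly (n - 1)) x / sqrt (2 ^ (n - 1) * fact (n - 1) * sqrt pi)"

definition square_integrable :: "'a measure \<Rightarrow> ('a \<Rightarrow> 'b::real_normed_vector) \<Rightarrow> bool" where
  "square_integrable M f \<longleftrightarrow> f \<in> borel_measurable M \<and> integrable M (\<lambda>x. (norm (f x))\<^sup>2)"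

definition L2_converges ::
    "'a measure \<Rightarrow> (nat \<Rightarrow> 'a \<Rightarrow> complex) \<Rightarrow> ('a \<Rightarrow> complex) \<Rightarrow> bool" where
  "L2_converges M X Y \<longleftrightarrow>
     (\<forall>k. square_integrable M (X k)) \<and> square_integrable M Y \<and>
     (\<lambda>k. \<integral>\<omega>. (cmod (X k \<omega> - Y \<omega>))\<^sup>2 \<partial>M) \<longlonglongrightarrow> 0"

text \<open>Bases are indexed by \<open>n \<ge> 1\<close>; the value at index 0 is irrelevant throughout.\<close>

definition orthonormal_basis_L2 :: "'a measure \<Rightarrow> (nat \<Rightarrow> 'a \<Rightarrow> real) \<Rightarrow> bool" where
  "orthonormal_basis_L2 M e \<longleftrightarrow>
     (\<forall>n\<ge>1. square_integrable M (e n)) \<and>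
     (\<forall>m\<ge>1. \<forall>n\<ge>1. (\<integral>x. e m x * e n x \<partial>M) = (if m = n then 1 else 0)) \<and>
     (\<forall>f :: 'a \<Rightarrow> real. square_integrable M f \<longrightarrow>
        (\<lambda>N. \<integral>x. (f x - (\<Sum>n=1..N. (\<integral>y. f y * e n y \<partial>M) * e n x))\<^sup>2 \<partial>M) \<longlonglongrightarrow> 0)"

text \<open>Infinite differentiability on \<open>[0,\<infinity>)\<close>, with one-sided derivatives at 0;
  \<open>d k\<close> is the \<open>k\<close>-th derivative.\<close>

definition smooth_on_halfline :: "(real \<Rightarrow> real) \<Rightarrow> bool" where
  "smooth_on_halfline f \<longleftrightarrow>
     (\<exists>d :: nat \<Rightarrow> real \<Rightarrow> real. (\<forall>t\<ge>0. d 0 t = f t) \<and>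
        (\<forall>k. \<forall>t\<ge>0. (d k has_real_derivative d (Suc k) t) (at t within {0..})))"

definition noise_approx ::
    "(nat \<Rightarrow> real \<Rightarrow> real) \<Rightarrow> (nat \<Rightarrow> nat \<Rightarrow> 'a \<Rightarrow> real) \<Rightarrow> nat \<Rightarrow> real \<Rightarrow> real \<Rightarrow> 'a \<Rightarrow> real" where
  "noise_approx \<psi> z N t x \<omega> = (\<Sum>m=1..N. \<Sum>n=1..N. \<psi> m t * hermite_fun n x * z m n \<omega>)"

definition noise_approx_hat ::
    "(nat \<Rightarrow> real \<Rightarrow> real) \<Rightarrow> (nat \<Rightarrow> nat \<Rightarrow> 'a \<Rightarrow> real) \<Rightarrow> nat \<Rightarrow> real \<Rightarrow> real \<Rightarrow> 'a \<Rightarrow> complex" where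
  "noise_approx_hat \<psi> z N s \<xi> \<omega> =
     (\<integral>x. exp (- \<i> * of_real \<xi> * of_real x) * of_real (noise_approx \<psi> z N s x \<omega>) \<partial>lborel)"

definition approx_solution ::
    "(nat \<Rightarrow> real \<Rightarrow> real) \<Rightarrow> (nat \<Rightarrow> nat \<Rightarrow> 'a \<Rightarrow> real) \<Rightarrow> nat \<Rightarrow> real \<Rightarrow> real \<Rightarrow> 'a \<Rightarrow> complex" where
  "approx_solution \<psi> z N t x \<omega> =
     1 / (2 * of_real pi) *
     (\<integral>\<xi>. exp (\<i> * of_real \<xi> * of_real x) *
        (LINT s:{0..t}|lborel. of_real (tricomi_C t s \<bar>\<xi>\<bar>) * noise_approx_hat \<psi> z N s \<xi> \<omega>) \<partial>lborel)"

definition mild_solution ::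
    "'a measure \<Rightarrow> (nat \<Rightarrow> real \<Rightarrow> real) \<Rightarrow> (nat \<Rightarrow> nat \<Rightarrow> 'a \<Rightarrow> real) \<Rightarrow> (real \<Rightarrow> real \<Rightarrow> 'a \<Rightarrow> complex) \<Rightarrow> bool" where
  "mild_solution M \<psi> z U \<longleftrightarrow>
     (\<forall>t\<ge>0. \<forall>x. L2_converges M (\<lambda>N. approx_solution \<psi> z N t x) (U t x))"

text \<open>For the unnormalized Fourier transform with kernel \<open>exp (- i \<xi> x)\<close> used in
  \<^const>\<open>noise_approx_hat\<close>, the function \<open>hermite_fun n\<close> is an eigenfunction with
  eigenvalue \<open>sqrt (2 \<pi>) (- i)\<^bsup>n - 1\<^esup>\<close>. Together with the factor \<open>1 / (2 \<pi>)\<close> of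
  \<^const>\<open>approx_solution\<close> this gives the constant in front of the integral.\<close>

definition u_coeff :: "(nat \<Rightarrow> real \<Rightarrow> real) \<Rightarrow> nat \<Rightarrow> nat \<Rightarrow> real \<Rightarrow> real \<Rightarrow> complex" where
  "u_coeff \<psi> m n t x =
     (- \<i>) ^ (n - 1) / of_real (sqrt (2 * pi)) *
     (\<integral>\<xi>. (LINT s:{0..t}|lborel.
        exp (\<i> * of_real x * of_real \<xi>) * of_real (tricomi_C t s \<bar>\<xi>\<bar> * \<psi> m s * hermite_fun n \<xi>)) \<partial>lborel)"

text \<open>Degenerate Gaussians (almost surely constant variables) are included.\<close>

definition gaussian_rv :: "'a measure \<Rightarrow> ('a \<Rightarrow> real) \<Rightarrow> bool" where
  "gaussian_rv M X \<longleftrightarrow>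
     X \<in> borel_measurable M \<and>
     (\<exists>\<mu>. (AE \<omega> in M. X \<omega> = \<mu>) \<or> (\<exists>\<sigma>>0. distributed M lborel X (normal_density \<mu> \<sigma>)))"

text \<open>A real Gaussian random field on \<open>[0,\<infinity>) \<times> \<real>\<close>. The values have type \<^typ>\<open>complex\<close>
  only because the Fourier representation does, and are almost surely real.\<close>

definition gaussian_field :: "'a measure \<Rightarrow> (real \<Rightarrow> real \<Rightarrow> 'a \<Rightarrow> complex) \<Rightarrow> bool" where
  "gaussian_field M U \<longleftrightarrow>
     (\<forall>t\<ge>0. \<forall>x. U t x \<in> borel_measurable M \<and> (AE \<omega> in M. U t x \<omega> \<in> \<real>)) \<and>
     (\<forall>P \<subseteq> {0..} \<times> UNIV. \<forall>a. finite P \<longrightarrow>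
        gaussian_rv M (\<lambda>\<omega>. \<Sum>(t, x)\<in>P. a (t, x) * Re (U t x \<omega>)))"

definition exhausts :: "(nat \<Rightarrow> 'i set) \<Rightarrow> 'i set \<Rightarrow> bool" where
  "exhausts F I \<longleftrightarrow> incseq F \<and> (\<forall>k. finite (F k)) \<and> (\<Union>k. F k) = I"

end

theory Submission
  imports Defs
begin

text \<open>
  The solution is a Wiener integral with respect to the noise, and all claims come down to one fact: its
  kernel is square-integrable.

  Fix \<open>t\<close> and \<open>x\<close>, and let \<open>K(s, \<xi>) = exp(i x \<xi>) C(t, s, |\<xi>|)\<close> for \<open>s\<close> in \<open>[0, t]\<close>. The
  Hermite functions are eigenfunctions of the Fourier transform. Hence \<open>U\<^sub>N\<close> is the sum of
  \<open>u\<^sub>m\<^sub>n z\<^sub>m\<^sub>n\<close> over \<open>m, n \<le> N\<close>, where \<open>u\<^sub>m\<^sub>n\<close> is, up to a constant factor, the coefficient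
  of \<open>K\<close> with respect to the orthonormal basis \<open>\<psi>\<^sub>m \<otimes> \<phi>\<^sub>n\<close> (lemma \<open>approx_solution_eq\<close>). By parity
  of the Hermite functions these coefficients are real. Parseval's identity, applied first in time and then in
  frequency, gives \<open>\<Sum> u\<^sub>m\<^sub>n\<^sup>2 = (2 \<pi>)\<^sup>-\<^sup>1 \<integral>\<integral> |K|\<^sup>2\<close> (lemmas \<open>kernel_coeff_Parseval\<close> and
  \<open>u_coeff_square_sum\<close>). This requires that the Hermite functions form an orthonormal basis of the line
  (theorem \<open>hermite_orthonormal_basis\<close>); their totality rests on the injectivity of the Fourier transform, which is
  taken from Levy's uniqueness theorem.

  That \<open>K\<close> is square-integrable follows from an energy estimate rather than from asymptotics of the Airy
  functions. As a function of \<open>s\<close> the kernel \<open>w = C(t, \<cdot>, \<rho>)\<close> solves \<open>w'' = - \<rho>\<^sup>2 s w\<close> with \<open>w(t) = 0\<close>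
  and \<open>w'(t) = - 1\<close>, and \<open>w'\<^sup>2 + \<rho>\<^sup>2 s w\<^sup>2\<close> is nondecreasing. So \<open>C\<^sup>2\<close> is at most \<open>t\<^sup>2\<close> and at most
  \<open>1 / (\<rho>\<^sup>2 s)\<close>, and interpolating between the two bounds is enough (lemma \<open>tricomi_C_nn_integral_finite\<close>).

  The rest is a statement about a series of independent standard Gaussian variables with square-summable
  coefficients. Along every exhaustion of the index set its partial sums converge in mean square to the same limit,
  and, by Kolmogorov's maximal inequality, almost surely (theorem \<open>gaussian_series_converges\<close>). Finite linear combinations
  of such limits are limits of the same kind, and characteristic functions show that they are Gaussian
  (theorem \<open>gaussian_limit\<close>).
\<close>

section \<open>Airy functions and the Tricomi kernel\<close>

text \<open>The full coefficient sequence of the two series that define the Airy functions, with explicit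
  zeros outside the residue class \<open>r\<close> modulo 3, so that the termwise differentiation theorem for power
  series applies. The case \<open>r = 0\<close> belongs to \<^const>\<open>airy_f\<close>, and \<open>r = 1\<close> to \<^const>\<open>airy_g\<close>.\<close>

definition airy_coeff :: "nat \<Rightarrow> nat \<Rightarrow> real" where
  "airy_coeff r n =
     (if n mod 3 = r then 3 ^ (n div 3) * pochhammer ((real r + 1) / 3) (n div 3) / fact n else 0)"

definition airy_series :: "nat \<Rightarrow> real \<Rightarrow> real" where
  "airy_series r x = (\<Sum>n. airy_coeff r n * x ^ n)"

definition airy_series' :: "nat \<Rightarrow> real \<Rightarrow> real" where
  "airy_series' r x = (\<Sum>n. diffs (airy_coeff r) n * x ^ n)"

text \<open>This is the equation \<open>y'' = x y\<close> read off on coefficients: the factor \<open>3 (p + k)\<close> by which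
  \<open>3 ^ k\<close> times the Pochhammer symbol grows, with \<open>p = (r + 1) / 3\<close>, is exactly the factor \<open>n + 1\<close>
  that remains of the quotient of the factorials.\<close>

lemma airy_coeff_rec: "real ((n + 3) * (n + 2)) * airy_coeff r (n + 3) = airy_coeff r n"
proof (cases "n mod 3 = r")
  case True
  define k where "k = n div 3"
  have n: "n = 3 * k + r" using True div_mult_mod_eq[of n 3] by (simp add: k_def)
  have r: "r < 3" using True by auto
  have d: "(n + 3) div 3 = Suc k" "(n + 3) mod 3 = r"
    using n r by auto
  have f: "fact (n + 3) = (real (n + 3) * real (n + 2) * real (n + 1) * fact n :: real)"
    by (simp add: numeral_3_eq_3 algebra_simps)
  have p: "3 * ((real r + 1) / 3 + real k) = real (n + 1)"
    by (simp add: n)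
  have "real ((n + 3) * (n + 2)) * airy_coeff r (n + 3)
     = real (n + 3) * real (n + 2) *
       (3 ^ k * (3 * ((real r + 1) / 3 + real k)) * pochhammer ((real r + 1) / 3) k) / fact (n + 3)"
    unfolding airy_coeff_def d by (simp add: pochhammer_Suc field_simps)
  also have "\<dots> = 3 ^ k * pochhammer ((real r + 1) / 3) k / fact n"
  proof -
    have "a * b * (P * e * Q) / (a * b * e * F) = P * Q / F"
      if "a \<noteq> 0" "b \<noteq> 0" "e \<noteq> 0" for a b e F P Q :: real
      using that by simp
    then show ?thesis unfolding p f by (simp del: of_nat_add)
  qed
  finally show ?thesis using True by (simp add: airy_coeff_def k_def)
next
  case False
  then show ?thesis by (simp add: airy_coeff_def)
qed

lemma airy_coeff_support:
  assumes "airy_coeff r n \<noteq> 0"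
  shows "\<exists>k. n = 3 * k + r"
proof -
  have "n mod 3 = r" using assms by (auto simp: airy_coeff_def split: if_splits)
  then have "n = 3 * (n div 3) + r" using div_mult_mod_eq[of n 3] by simp
  then show ?thesis ..
qed

lemma airy_series_summable:
  assumes "r < 2"
  shows "summable (\<lambda>n. airy_coeff r n * x ^ n)"
proof -
  define h where "h k = 3 * k + r" for k
  have h: "strict_mono h" by (auto simp: strict_mono_def h_def)
  have "summable (\<lambda>k. airy_coeff r (h k) * x ^ h k)"
  \<comment> \<open>From here on, \<open>2 \<bar>x\<bar>\<^sup>3 \<le> k\<close>, and the quotient of consecutive terms, which is \<open>x\<^sup>3 / ((n + 3) (n + 2))\<close> with \<open>n = 3 k + r\<close>, is at most \<open>1/2\<close>.\<close>
  proof (rule summable_ratio_test[where c = "1/2" and N = "nat \<lceil>2 * \<bar>x\<bar> ^ 3\<rceil>"])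
    fix k assume k: "nat \<lceil>2 * \<bar>x\<bar> ^ 3\<rceil> \<le> k"
    define n where "n = h k"
    have hn: "h (Suc k) = n + 3" by (simp add: h_def n_def)
    have "2 * \<bar>x\<bar> ^ 3 \<le> real k" using k by linarith
    also have "\<dots> \<le> real ((n + 3) * (n + 2))"
      unfolding n_def h_def of_nat_le_iff by (simp add: algebra_simps)
    finally have le: "2 * \<bar>x\<bar> ^ 3 \<le> real ((n + 3) * (n + 2))" .
    have "norm (airy_coeff r (h k) * x ^ h k)
        = real ((n + 3) * (n + 2)) * (\<bar>airy_coeff r (n + 3)\<bar> * \<bar>x\<bar> ^ n)"
      unfolding n_def[symmetric] airy_coeff_rec[of n r, symmetric]
      by (simp only: real_norm_def abs_mult power_abs abs_of_nat mult.assoc)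
    also have "\<dots> \<ge> 2 * \<bar>x\<bar> ^ 3 * (\<bar>airy_coeff r (n + 3)\<bar> * \<bar>x\<bar> ^ n)"
      by (rule mult_right_mono[OF le]) auto
    also have "2 * \<bar>x\<bar> ^ 3 * (\<bar>airy_coeff r (n + 3)\<bar> * \<bar>x\<bar> ^ n)
        = 2 * norm (airy_coeff r (h (Suc k)) * x ^ h (Suc k))"
      unfolding hn by (simp add: abs_mult power_add power_abs)
    finally show "norm (airy_coeff r (h (Suc k)) * x ^ h (Suc k))
        \<le> 1/2 * norm (airy_coeff r (h k) * x ^ h k)" by simp
  qed simp
  moreover have "airy_coeff r n * x ^ n = 0" if "n \<notin> range h" for n
    using airy_coeff_support that unfolding h_def by auto
  ultimately show ?thesis
    using summable_mono_reindex[OF h, of "\<lambda>n. airy_coeff r n * x ^ n"] by blast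
qed

lemma airy_series_eq:
  assumes "r < 2"
  shows "airy_series r x =
    (\<Sum>k. 3 ^ k * pochhammer ((real r + 1) / 3) k * x ^ (3 * k + r) / fact (3 * k + r))"
proof -
  define h where "h k = 3 * k + r" for k
  have h: "strict_mono h" by (auto simp: strict_mono_def h_def)
  have z: "airy_coeff r n * x ^ n = 0" if "n \<notin> range h" for n
    using airy_coeff_support that unfolding h_def by auto
  have "airy_series r x = (\<Sum>k. airy_coeff r (h k) * x ^ h k)"
    unfolding airy_series_def
    by (rule suminf_mono_reindex[OF h, symmetric]) (use z in auto)
  also have "\<dots> = (\<Sum>k. 3 ^ k * pochhammer ((real r + 1) / 3) k * x ^ (3 * k + r) / fact (3 * k + r))"
    using assms by (simp add: airy_coeff_def h_def)
  finally show ?thesis .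
qed

lemma airy_f_series: "airy_f = airy_series 0"
  and airy_g_series: "airy_g = airy_series 1"
  by (auto simp: fun_eq_iff airy_f_def airy_g_def airy_series_eq)

lemma airy_series_has_deriv:
  "r < 2 \<Longrightarrow> (airy_series r has_real_derivative airy_series' r x) (at x)"
  unfolding airy_series_def airy_series'_def
  by (rule termdiffs_strong_converges_everywhere) (rule airy_series_summable)

lemma airy_ode:
  assumes "r < 2"
  shows "(airy_series' r has_real_derivative x * airy_series r x) (at x)"
proof -
  have s1: "summable (\<lambda>n. diffs (airy_coeff r) n * x ^ n)" for x
    by (rule termdiff_converges_all) (rule airy_series_summable[OF assms])
  have s2: "summable (\<lambda>n. diffs (diffs (airy_coeff r)) n * x ^ n)"
    by (rule termdiff_converges_all) (rule s1)
  have c2: "diffs (diffs (airy_coeff r)) 0 = 0"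
    using assms by (simp add: diffs_def airy_coeff_def)
  have c3: "diffs (diffs (airy_coeff r)) (Suc n) = airy_coeff r n" for n
    using airy_coeff_rec[of n r]
    by (simp add: diffs_def numeral_3_eq_3 algebra_simps)
  have "(\<Sum>n. diffs (diffs (airy_coeff r)) n * x ^ n) =
     (\<Sum>n. diffs (diffs (airy_coeff r)) (Suc n) * x ^ Suc n)"
    using suminf_split_head[OF s2] c2 by simp
  also have "\<dots> = (\<Sum>n. x * (airy_coeff r n * x ^ n))"
    by (simp add: c3 mult_ac)
  also have "\<dots> = x * airy_series r x"
    unfolding airy_series_def by (rule suminf_mult[OF airy_series_summable[OF assms]])
  finally show ?thesis
    using termdiffs_strong_converges_everywhere[of "diffs (airy_coeff r)" x, OF s1]
    unfolding airy_series'_def by simp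
qed

lemma airy_initial:
  "airy_series 0 0 = 1" "airy_series' 0 0 = 0" "airy_series 1 0 = 0" "airy_series' 1 0 = 1"
  by (simp_all add: airy_series_def airy_series'_def airy_coeff_def diffs_def
      powser_zero[of "airy_coeff _", simplified] cong: if_cong)

text \<open>The Wronskian of two solutions of \<open>y'' = x y\<close> is constant, since the equation has no term
  in \<open>y'\<close>; its value is read off at 0.\<close>

lemma airy_wronskian: "airy_series 0 x * airy_series' 1 x - airy_series' 0 x * airy_series 1 x = 1"
proof -
  define W where "W y = airy_series 0 y * airy_series' 1 y - airy_series' 0 y * airy_series 1 y" for y
  have "(W has_real_derivative 0) (at y)" for y
    unfolding W_def
    by (rule derivative_eq_intros airy_series_has_deriv airy_ode refl | simp)+
  then have "W x = W 0"
    using DERIV_isconst_all[of W x 0] by blast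
  then show ?thesis unfolding W_def airy_initial by simp
qed

text \<open>By the reflection formula for the Gamma function at \<open>1/3\<close>. The value is what makes the factor
  \<open>\<pi>\<close> in the definition of \<open>C\<close> cancel against the Wronskian of \<open>Ai\<close> and \<open>Bi\<close>.\<close>

lemma airy_const_prod:
  "(1 / (3 powr (2/3) * Gamma (2/3))) * (1 / (3 powr (1/3) * Gamma (1/3))) = sqrt 3 / (6 * pi :: real)"
proof -
  have "complex_of_real (Gamma (1/3) * Gamma (2/3)) = of_real (pi / sin (pi / 3))"
    using Gamma_reflection_complex[of "of_real (1/3)"]
    by (simp add: Gamma_complex_of_real[symmetric] sin_of_real[symmetric])
  then have G: "Gamma (1/3) * Gamma (2/3) = (2 * pi / sqrt 3 :: real)"
    unfolding of_real_eq_iff by (simp add: sin_60 field_simps)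
  have p: "(3::real) powr (2/3) * 3 powr (1/3) = 3"
    by (simp add: powr_add[symmetric])
  have "(1 / (3 powr (2/3) * Gamma (2/3))) * (1 / (3 powr (1/3) * Gamma (1/3)))
     = 1 / ((3 powr (2/3) * 3 powr (1/3)) * (Gamma (1/3) * Gamma (2/3 :: real)))"
    by (simp add: field_simps)
  also have "\<dots> = sqrt 3 / (6 * pi)"
    unfolding G p by (simp add: field_simps)
  finally show ?thesis .
qed

text \<open>In terms of the two power series all normalizing constants disappear, so that only the
  differential equation and the initial values matter from here on.\<close>

lemma tricomi_C_airy:
  assumes "\<rho> \<noteq> 0"
  shows "tricomi_C t s \<rho> = - (1 / \<rho> powr (2/3)) *
     (airy_g (- (\<rho> powr (2/3)) * t) * airy_f (- (\<rho> powr (2/3)) * s) -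
      airy_f (- (\<rho> powr (2/3)) * t) * airy_g (- (\<rho> powr (2/3)) * s))"
proof -
  have alg: "sqrt 3 * (fa * c + ga * d) * (fb * c - gb * d) - (fa * c - ga * d) * (sqrt 3 * (fb * c + gb * d))
     = 2 * sqrt 3 * (c * d) * (ga * fb - fa * gb)" for fa ga fb gb c d :: real
    by (simp add: algebra_simps)
  define c d where "c = 1 / (3 powr (2/3) * Gamma (2/3 :: real))" and "d = 1 / (3 powr (1/3) * Gamma (1/3 :: real))"
  have cd: "c * d = sqrt 3 / (6 * pi)"
    using airy_const_prod by (simp add: c_def d_def)
  have A: "Ai x = airy_f x * c - airy_g x * d" and B: "Bi x = sqrt 3 * (airy_f x * c + airy_g x * d)" for x
    by (simp_all add: Ai_def Bi_def c_def d_def)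
  show ?thesis
    using assms unfolding tricomi_C_def A B alg cd by (simp add: field_simps)
qed


text \<open>In the variable \<open>s\<close> the kernel solves \<open>w'' = - \<rho>\<^sup>2 s w\<close>. The energy
  \<open>w'\<^sup>2 + \<rho>\<^sup>2 s w\<^sup>2\<close> has derivative \<open>\<rho>\<^sup>2 w\<^sup>2 \<ge> 0\<close>, so on \<open>[0, t]\<close> it is
  at most its value at the final time.\<close>

lemma tricomi_energy:
  fixes w w' :: "real \<Rightarrow> real"
  assumes w: "\<And>s. (w has_real_derivative w' s) (at s)"
    and w': "\<And>s. (w' has_real_derivative - (\<rho>\<^sup>2) * s * w s) (at s)"
    and final: "w t = 0" "w' t = - 1"
    and s: "0 \<le> s" "s \<le> t"
  shows "(w' s)\<^sup>2 + \<rho>\<^sup>2 * s * (w s)\<^sup>2 \<le> 1"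
proof -
  define E where "E s = (w' s)\<^sup>2 + \<rho>\<^sup>2 * s * (w s)\<^sup>2" for s
  have "(E has_real_derivative \<rho>\<^sup>2 * (w s)\<^sup>2) (at s)" for s
    unfolding E_def
    by (rule derivative_eq_intros w w' refl | simp add: algebra_simps power2_eq_square)+
  then have "E s \<le> E t"
    by (intro DERIV_nonneg_imp_nondecreasing[OF s(2)]) (metis mult_nonneg_nonneg zero_le_power2)
  then show ?thesis by (simp add: E_def final)
qed

text \<open>Both estimates come from the energy. Its first term gives \<open>\<bar>w'\<bar> \<le> 1\<close>, hence
  \<open>\<bar>w\<bar> \<le> t\<close> because \<open>w\<close> vanishes at \<open>t\<close>; its second term gives the decay in the frequency. They
  replace the asymptotic expansions of the Airy functions.\<close>

lemma
  assumes s: "0 \<le> s" "s \<le> t"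
  shows tricomi_C_bound: "\<rho> \<ge> 0 \<Longrightarrow> \<bar>tricomi_C t s \<rho>\<bar> \<le> t"
    and tricomi_C_decay: "\<rho> > 0 \<Longrightarrow> \<rho>\<^sup>2 * s * (tricomi_C t s \<rho>)\<^sup>2 \<le> 1"
proof -
  have *: "\<bar>tricomi_C t s \<rho>\<bar> \<le> t \<and> \<rho>\<^sup>2 * s * (tricomi_C t s \<rho>)\<^sup>2 \<le> 1" if \<rho>: "\<rho> > 0"
  proof -
    define k where "k = \<rho> powr (2/3)"
    have k: "k > 0" using \<rho> by (simp add: k_def)
    have "k powr 3 = \<rho> powr 2" by (simp add: k_def powr_powr)
    then have k3: "k ^ 3 = \<rho>\<^sup>2" using k \<rho> by (simp add: powr_numeral)
    define w where "w s = - (1 / k) *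
        (airy_series 1 (- k * t) * airy_series 0 (- k * s) - airy_series 0 (- k * t) * airy_series 1 (- k * s))" for s
    define w' where "w' s =
        airy_series 1 (- k * t) * airy_series' 0 (- k * s) - airy_series 0 (- k * t) * airy_series' 1 (- k * s)" for s
    have C: "tricomi_C t s \<rho> = w s" for s
      using \<rho> by (simp add: tricomi_C_airy airy_f_series airy_g_series w_def k_def)
    have dw: "(w has_real_derivative w' s) (at s)" for s
      unfolding w_def w'_def using k
      by (auto intro!: derivative_eq_intros DERIV_chain2[OF airy_series_has_deriv] simp: field_simps)
    have "(w' has_real_derivative - (k ^ 3) * s * w s) (at s)" for s
      unfolding w_def w'_def using k
      by (auto intro!: derivative_eq_intros DERIV_chain2[OF airy_ode] simp: field_simps power3_eq_cube)
    then have dw': "(w' has_real_derivative - (\<rho>\<^sup>2) * s * w s) (at s)" for s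
      by (simp add: k3)
    have final: "w t = 0" "w' t = - 1"
      using airy_wronskian[of "- k * t"] by (simp_all add: w_def w'_def algebra_simps)
    have E: "(w' s)\<^sup>2 + \<rho>\<^sup>2 * s * (w s)\<^sup>2 \<le> 1" if "0 \<le> s" "s \<le> t" for s
      by (rule tricomi_energy[OF dw dw' final that])
    have w'1: "\<bar>w' s\<bar> \<le> 1" if "0 \<le> s" "s \<le> t" for s
    proof -
      have "0 \<le> \<rho>\<^sup>2 * s * (w s)\<^sup>2" using that by simp
      then have "(w' s)\<^sup>2 \<le> 1" using E[OF that] by linarith
      then show ?thesis by (simp add: abs_square_le_1)
    qed
    have "\<bar>w s\<bar> \<le> t"
    proof (cases "s = t")
      case True
      then show ?thesis using s by (simp add: final)
    next
      case False
      then have "s < t" using s by simp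
      from MVT2[OF this, of w w'] dw obtain x where x: "s < x" "x < t" "w t - w s = (t - s) * w' x"
        by blast
      have "\<bar>w s\<bar> = (t - s) * \<bar>w' x\<bar>"
        using x final s by (metis abs_minus_commute abs_mult abs_of_nonneg diff_0_right diff_ge_0_iff_ge abs_minus diff_0)
      also have "\<dots> \<le> (t - s) * 1"
        using x s by (intro mult_left_mono w'1) auto
      also have "\<dots> \<le> t" using s by simp
      finally show ?thesis .
    qed
    moreover have "\<rho>\<^sup>2 * s * (w s)\<^sup>2 \<le> 1"
      using E[OF s] zero_le_power2[of "w' s"] by linarith
    ultimately show ?thesis by (simp add: C)
  qed
  then show "\<bar>tricomi_C t s \<rho>\<bar> \<le> t" if "\<rho> \<ge> 0"
    using that s by (cases "\<rho> = 0") (auto simp: tricomi_C_def)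
  show "\<rho>\<^sup>2 * s * (tricomi_C t s \<rho>)\<^sup>2 \<le> 1" if "\<rho> > 0"
    using * that by blast
qed

lemma airy_measurable [measurable]:
  "airy_f \<in> borel_measurable borel" "airy_g \<in> borel_measurable borel"
  unfolding airy_f_series airy_g_series
  by (intro borel_measurable_continuous_onI continuous_at_imp_continuous_on ballI
      DERIV_isCont[OF airy_series_has_deriv]; simp)+

lemma tricomi_C_measurable [measurable (raw)]:
  assumes [measurable]: "f \<in> borel_measurable N" "g \<in> borel_measurable N"
  shows "(\<lambda>x. tricomi_C t (f x) (g x)) \<in> borel_measurable N"
proof -
  have [measurable]: "Ai \<in> borel_measurable borel" "Bi \<in> borel_measurable borel"
    unfolding Ai_def[abs_def] Bi_def[abs_def] by measurable
  show ?thesis unfolding tricomi_C_def by measurable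
qed

text \<open>Integrating the decay estimate \<open>C\<^sup>2 \<le> 1 / (\<rho>\<^sup>2 s)\<close> alone would diverge
  logarithmically at \<open>s = 0\<close>. The geometric mean of this estimate, with weight \<open>3/4\<close>, and of
  \<open>C\<^sup>2 \<le> t\<^sup>2\<close>, with weight \<open>1/4\<close>, gives \<open>t\<^sup>1\<^sup>/\<^sup>2 \<rho>\<^sup>-\<^sup>3\<^sup>/\<^sup>2 s\<^sup>-\<^sup>3\<^sup>/\<^sup>4\<close>,
  which is integrable for small \<open>s\<close> and for large \<open>\<rho>\<close>.\<close>

lemma tricomi_C_nn_integral_finite:
  assumes t: "t \<ge> 0"
  shows "(\<integral>\<^sup>+\<rho>\<in>{0..}. (\<integral>\<^sup>+s\<in>{0..t}. ennreal (\<bar>tricomi_C t s \<rho>\<bar>\<^sup>2) \<partial>lborel) \<partial>lborel) < \<infinity>"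
proof -
  let ?J = "\<lambda>\<rho>. \<integral>\<^sup>+s\<in>{0..t}. ennreal (\<bar>tricomi_C t s \<rho>\<bar>\<^sup>2) \<partial>lborel"
  define P where "P = (\<integral>\<^sup>+s\<in>{0..t}. ennreal (s powr (-(3/4))) \<partial>lborel)"
  have P: "P < \<infinity>"
  proof -
    have "((\<lambda>s. s powr (-(3/4))) has_integral (t powr (-(3/4)+1) / (-(3/4)+1))) {0..t}"
      by (rule has_integral_powr_from_0) (use t in auto)
    then have "P = ennreal (t powr (-(3/4)+1) / (-(3/4)+1))"
      unfolding P_def by (intro nn_integral_has_integral_lebesgue') auto
    then show ?thesis by simp
  qed
  have Q: "(\<integral>\<^sup>+\<rho>\<in>{1..}. ennreal (\<rho> powr (-(3/2))) \<partial>lborel) < \<infinity>"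
  proof -
    have "((\<lambda>s. s powr (-(3/2))) has_integral - (1 powr (-(3/2)+1)) / (-(3/2)+1)) {1::real..}"
      by (rule has_integral_powr_to_inf) auto
    then have "(\<integral>\<^sup>+\<rho>\<in>{1..}. ennreal (\<rho> powr (-(3/2))) \<partial>lborel) = ennreal (- (1 powr (-(3/2)+1)) / (-(3/2)+1))"
      by (intro nn_integral_has_integral_lebesgue') auto
    then show ?thesis by simp
  qed
  have small: "?J \<rho> \<le> ennreal (t ^ 3)"
    if "\<rho> \<ge> 0" for \<rho>
  proof -
    have "?J \<rho> \<le> (\<integral>\<^sup>+s\<in>{0..t}. ennreal (t\<^sup>2) \<partial>lborel)"
    proof (intro nn_integral_mono)
      fix s
      show "ennreal (\<bar>tricomi_C t s \<rho>\<bar>\<^sup>2) * indicator {0..t} s \<le> ennreal (t\<^sup>2) * indicator {0..t} s"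
      proof (cases "s \<in> {0..t}")
        case True
        then have "\<bar>tricomi_C t s \<rho>\<bar>\<^sup>2 \<le> t\<^sup>2"
          using that by (intro power_mono tricomi_C_bound) auto
        then show ?thesis using True by (simp add: ennreal_leI)
      qed simp
    qed
    also have "\<dots> = ennreal (t\<^sup>2) * ennreal t"
      using t by (subst nn_integral_cmult_indicator) auto
    also have "\<dots> = ennreal (t ^ 3)"
      using t by (simp add: ennreal_mult[symmetric] power3_eq_cube power2_eq_square)
    finally show ?thesis .
  qed
  have large: "?J \<rho>
      \<le> ennreal (t powr (1/2)) * P * ennreal (\<rho> powr (-(3/2)))" if "\<rho> \<ge> 1" for \<rho>
  proof -
    have ineq: "(tricomi_C t s \<rho>)\<^sup>2 \<le> t powr (1/2) * \<rho> powr (-(3/2)) * s powr (-(3/4))" if s: "0 < s" "s \<le> t" for s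
    proof -
      define c where "c = (tricomi_C t s \<rho>)\<^sup>2"
      have \<rho>: "\<rho> > 0" using \<open>\<rho> \<ge> 1\<close> by simp
      have c0: "c \<ge> 0" by (simp add: c_def)
      have "c = \<bar>tricomi_C t s \<rho>\<bar>\<^sup>2" by (simp add: c_def)
      also have "\<dots> \<le> t\<^sup>2"
        using s \<rho> by (intro power_mono tricomi_C_bound) auto
      finally have c1: "c \<le> t\<^sup>2" .
      have c2: "c \<le> 1 / (\<rho>\<^sup>2 * s)"
        using tricomi_C_decay[of s t \<rho>] s \<rho> by (simp add: c_def field_simps)
      have "c = c powr (1/4) * c powr (3/4)"
        using c0 by (simp add: powr_add[symmetric])
      also have "\<dots> \<le> (t\<^sup>2) powr (1/4) * (1 / (\<rho>\<^sup>2 * s)) powr (3/4)"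
        using c0 c1 c2 by (intro mult_mono powr_mono2) auto
      also have "\<dots> = t powr (1/2) * \<rho> powr (-(3/2)) * s powr (-(3/4))"
        using s \<rho> by (simp add: powr_numeral[symmetric] powr_powr powr_divide powr_mult powr_minus_divide
            del: powr_numeral)
      finally show ?thesis by (simp add: c_def)
    qed
    have "?J \<rho>
       \<le> (\<integral>\<^sup>+s. ennreal (t powr (1/2) * \<rho> powr (-(3/2))) * (ennreal (s powr (-(3/4))) * indicator {0..t} s) \<partial>lborel)"
      by (rule nn_integral_mono_AE, rule AE_mp[OF AE_lborel_singleton[of 0]])
        (auto simp: indicator_def ennreal_mult[symmetric] intro!: AE_I2 ennreal_leI ineq)
    also have "\<dots> = ennreal (t powr (1/2) * \<rho> powr (-(3/2))) * P"
      unfolding P_def by (rule nn_integral_cmult) simp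
    also have "\<dots> = ennreal (t powr (1/2)) * P * ennreal (\<rho> powr (-(3/2)))"
      by (simp add: ennreal_mult mult_ac)
    finally show ?thesis .
  qed
  have "(\<integral>\<^sup>+\<rho>\<in>{0..}. ?J \<rho> \<partial>lborel)
     \<le> (\<integral>\<^sup>+\<rho>. ennreal (t ^ 3) * indicator {0..1} \<rho>
          + ennreal (t powr (1/2)) * P * (ennreal (\<rho> powr (-(3/2))) * indicator {1..} \<rho>) \<partial>lborel)"
  proof (rule nn_integral_mono)
    fix \<rho> :: real
    show "?J \<rho> * indicator {0..} \<rho>
       \<le> ennreal (t ^ 3) * indicator {0..1} \<rho>
          + ennreal (t powr (1/2)) * P * (ennreal (\<rho> powr (-(3/2))) * indicator {1..} \<rho>)"
    proof -
      consider "\<rho> < 0" | "0 \<le> \<rho>" "\<rho> < 1" | "\<rho> = 1" | "\<rho> > 1" by linarith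
      then show ?thesis
        using small[of \<rho>] large[of \<rho>] by cases (auto simp: indicator_def intro: add_increasing2)
    qed
  qed
  also have "\<dots> = ennreal (t ^ 3) * emeasure lborel {0..1::real}
          + ennreal (t powr (1/2)) * P * (\<integral>\<^sup>+\<rho>\<in>{1..}. ennreal (\<rho> powr (-(3/2))) \<partial>lborel)"
    by (subst nn_integral_add) (auto simp: nn_integral_cmult nn_integral_cmult_indicator)
  also have "\<dots> < \<infinity>"
    using P Q by (auto simp: ennreal_mult_less_top less_top)
  finally show ?thesis .
qed

section \<open>Square-integrable functions\<close>

lemma square_integrable_real:
  fixes f :: "'a \<Rightarrow> real"
  shows "square_integrable M f \<longleftrightarrow> f \<in> borel_measurable M \<and> integrable M (\<lambda>x. (f x)\<^sup>2)"
  by (simp add: square_integrable_def)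

lemma square_integrable_mult:
  fixes f g :: "'a \<Rightarrow> real"
  assumes "square_integrable M f" "square_integrable M g"
  shows "integrable M (\<lambda>x. f x * g x)"
proof (rule Bochner_Integration.integrable_bound[of M "\<lambda>x. (f x)\<^sup>2 + (g x)\<^sup>2"])
  have "\<bar>a * b\<bar> \<le> a\<^sup>2 + b\<^sup>2" for a b :: real
  proof -
    have "2 * (\<bar>a\<bar> * \<bar>b\<bar>) \<le> a\<^sup>2 + b\<^sup>2" "0 \<le> \<bar>a\<bar> * \<bar>b\<bar>"
      using sum_squares_bound[of "\<bar>a\<bar>" "\<bar>b\<bar>"] by (auto simp: mult.assoc)
    then show ?thesis unfolding abs_mult by linarith
  qed
  then show "AE x in M. norm (f x * g x) \<le> norm ((f x)\<^sup>2 + (g x)\<^sup>2)"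
    by (auto simp: abs_of_nonneg)
qed (use assms in \<open>auto simp: square_integrable_real\<close>)

lemma square_integrable_cmult:
  fixes f :: "'a \<Rightarrow> real"
  shows "square_integrable M f \<Longrightarrow> square_integrable M (\<lambda>x. c * f x)"
  by (auto simp: square_integrable_real power_mult_distrib)

lemma square_integrable_add:
  fixes f g :: "'a \<Rightarrow> real"
  assumes "square_integrable M f" "square_integrable M g"
  shows "square_integrable M (\<lambda>x. f x + g x)"
  using square_integrable_mult[OF assms] assms
  by (auto simp: square_integrable_real power2_sum mult.assoc)

lemma square_integrable_diff:
  fixes f g :: "'a \<Rightarrow> real"
  assumes "square_integrable M f" "square_integrable M g"
  shows "square_integrable M (\<lambda>x. f x - g x)"
  using square_integrable_add[OF assms(1) square_integrable_cmult[OF assms(2), of "-1"]] by simp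

lemma square_integrable_sum:
  fixes f :: "'i \<Rightarrow> 'a \<Rightarrow> real"
  assumes "\<And>i. i \<in> A \<Longrightarrow> square_integrable M (f i)"
  shows "square_integrable M (\<lambda>x. \<Sum>i\<in>A. f i x)"
  using assms
proof (induction A rule: infinite_finite_induct)
  case (insert i A)
  then show ?case by (auto intro: square_integrable_add)
qed (auto simp: square_integrable_real)

lemma square_integral_sum_le:
  fixes f g :: "'a \<Rightarrow> real"
  assumes "square_integrable M f" "square_integrable M g"
  shows "(\<integral>x. (f x + g x)\<^sup>2 \<partial>M) \<le> 2 * (\<integral>x. (f x)\<^sup>2 \<partial>M) + 2 * (\<integral>x. (g x)\<^sup>2 \<partial>M)"
proof -
  have "(\<integral>x. (f x + g x)\<^sup>2 \<partial>M) \<le> (\<integral>x. 2 * (f x)\<^sup>2 + 2 * (g x)\<^sup>2 \<partial>M)"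
  proof (rule integral_mono)
    show "(f x + g x)\<^sup>2 \<le> 2 * (f x)\<^sup>2 + 2 * (g x)\<^sup>2" for x
      using sum_squares_bound[of "f x" "g x"] by (simp add: power2_sum)
  qed (use assms square_integrable_add[OF assms] in \<open>auto simp: square_integrable_real\<close>)
  then show ?thesis using assms by (simp add: square_integrable_real)
qed

lemma square_integral_diff_expand:
  fixes f g :: "'a \<Rightarrow> real"
  assumes f: "square_integrable M f" and g: "square_integrable M g"
  shows "(\<integral>x. (f x - g x)\<^sup>2 \<partial>M) = (\<integral>x. (f x)\<^sup>2 \<partial>M) - 2 * (\<integral>x. f x * g x \<partial>M) + (\<integral>x. (g x)\<^sup>2 \<partial>M)"
proof -
  have "(\<integral>x. (f x - g x)\<^sup>2 \<partial>M) = (\<integral>x. ((f x)\<^sup>2 - 2 * (f x * g x)) + (g x)\<^sup>2 \<partial>M)"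
    by (simp add: power2_diff algebra_simps)
  also have "\<dots> = (\<integral>x. (f x)\<^sup>2 \<partial>M) - 2 * (\<integral>x. f x * g x \<partial>M) + (\<integral>x. (g x)\<^sup>2 \<partial>M)"
    using square_integrable_mult[OF f g] f g by (simp add: square_integrable_real)
  finally show ?thesis .
qed

text \<open>The quadratic polynomial \<open>l \<mapsto> \<integral> (f - l g)\<^sup>2\<close> is nonnegative, so its discriminant is not
  positive.\<close>

lemma square_integral_Cauchy_Schwarz:
  fixes f g :: "'a \<Rightarrow> real"
  assumes f: "square_integrable M f" and g: "square_integrable M g"
  shows "(\<integral>x. f x * g x \<partial>M)\<^sup>2 \<le> (\<integral>x. (f x)\<^sup>2 \<partial>M) * (\<integral>x. (g x)\<^sup>2 \<partial>M)"
proof -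
  define A B C where "A = (\<integral>x. (f x)\<^sup>2 \<partial>M)" and "B = (\<integral>x. f x * g x \<partial>M)" and "C = (\<integral>x. (g x)\<^sup>2 \<partial>M)"
  have nonneg: "0 \<le> A - 2 * l * B + l\<^sup>2 * C" for l
  proof -
    have "0 \<le> (\<integral>x. (f x - l * g x)\<^sup>2 \<partial>M)" by simp
    also have "\<dots> = A - 2 * l * B + l\<^sup>2 * C"
      using square_integral_diff_expand[OF f square_integrable_cmult[OF g, of l]]
      by (simp add: A_def B_def C_def mult.left_commute power_mult_distrib)
    finally show ?thesis .
  qed
  have "C \<ge> 0" "A \<ge> 0" by (simp_all add: C_def A_def)
  show ?thesis
  proof (cases "C = 0")
    case True
    have "B = 0"
    \<comment> \<open>For \<open>C = 0\<close> the polynomial is affine, and this choice of \<open>l\<close> gives it the value \<open>- 1\<close>.\<close>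
    proof (rule ccontr)
      assume "B \<noteq> 0"
      then have "A - 2 * ((A + 1) / (2 * B)) * B = - 1" by (simp add: field_simps)
      then show False using nonneg[of "(A + 1) / (2 * B)"] True by simp
    qed
    then show ?thesis using True by (simp add: A_def[symmetric] B_def[symmetric] C_def[symmetric])
  next
    case False
    then have "C > 0" using \<open>C \<ge> 0\<close> by simp
    then have "A - 2 * (B / C) * B + (B / C)\<^sup>2 * C = A - B\<^sup>2 / C"
      by (simp add: field_simps power2_eq_square)
    then have "B\<^sup>2 / C \<le> A" using nonneg[of "B / C"] by linarith
    then show ?thesis using \<open>C > 0\<close>
      by (simp add: A_def[symmetric] B_def[symmetric] C_def[symmetric] field_simps)
  qed
qed

lemma L2_limit_inner:
  fixes S :: "nat \<Rightarrow> 'a \<Rightarrow> real"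
  assumes S: "\<And>k. square_integrable M (S k)" and g: "square_integrable M g"
    and lim: "(\<lambda>k. \<integral>x. (S k x - g x)\<^sup>2 \<partial>M) \<longlonglongrightarrow> 0" and h: "square_integrable M h"
  shows "(\<lambda>k. \<integral>x. S k x * h x \<partial>M) \<longlonglongrightarrow> (\<integral>x. g x * h x \<partial>M)"
proof -
  have d: "square_integrable M (\<lambda>x. S k x - g x)" for k
    by (rule square_integrable_diff[OF S g])
  have "(\<lambda>k. (\<integral>x. (S k x - g x) * h x \<partial>M)\<^sup>2) \<longlonglongrightarrow> 0"
  proof (rule tendsto_sandwich[OF _ _ tendsto_const])
    show "(\<lambda>k. (\<integral>x. (S k x - g x)\<^sup>2 \<partial>M) * (\<integral>x. (h x)\<^sup>2 \<partial>M)) \<longlonglongrightarrow> 0"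
      using tendsto_mult[OF lim tendsto_const] by simp
  qed (auto intro!: always_eventually square_integral_Cauchy_Schwarz d h)
  then have "(\<lambda>k. sqrt ((\<integral>x. (S k x - g x) * h x \<partial>M)\<^sup>2)) \<longlonglongrightarrow> sqrt 0"
    by (rule tendsto_real_sqrt)
  then have "(\<lambda>k. \<integral>x. (S k x - g x) * h x \<partial>M) \<longlonglongrightarrow> 0"
    by (simp add: tendsto_rabs_zero_iff)
  moreover have "(\<integral>x. (S k x - g x) * h x \<partial>M) = (\<integral>x. S k x * h x \<partial>M) - (\<integral>x. g x * h x \<partial>M)" for k
    using square_integrable_mult[OF S h] square_integrable_mult[OF g h]
    by (simp add: left_diff_distrib)
  ultimately show ?thesis
    by (simp add: LIM_zero_iff)
qed

lemma L2_limit_norm: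
  fixes S :: "nat \<Rightarrow> 'a \<Rightarrow> real"
  assumes S: "\<And>k. square_integrable M (S k)" and g: "square_integrable M g"
    and lim: "(\<lambda>k. \<integral>x. (S k x - g x)\<^sup>2 \<partial>M) \<longlonglongrightarrow> 0"
  shows "(\<lambda>k. \<integral>x. (S k x)\<^sup>2 \<partial>M) \<longlonglongrightarrow> (\<integral>x. (g x)\<^sup>2 \<partial>M)"
proof -
  have "(\<lambda>k. (\<integral>x. (S k x - g x)\<^sup>2 \<partial>M) + 2 * (\<integral>x. S k x * g x \<partial>M) - (\<integral>x. (g x)\<^sup>2 \<partial>M))
     \<longlonglongrightarrow> 0 + 2 * (\<integral>x. g x * g x \<partial>M) - (\<integral>x. (g x)\<^sup>2 \<partial>M)"
    by (intro tendsto_intros lim L2_limit_inner[OF S g lim g])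
  moreover have "(\<integral>x. (S k x - g x)\<^sup>2 \<partial>M) + 2 * (\<integral>x. S k x * g x \<partial>M) - (\<integral>x. (g x)\<^sup>2 \<partial>M)
      = (\<integral>x. (S k x)\<^sup>2 \<partial>M)" for k
    using square_integral_diff_expand[OF S g, of k] by linarith
  moreover have "0 + 2 * (\<integral>x. g x * g x \<partial>M) - (\<integral>x. (g x)\<^sup>2 \<partial>M) = (\<integral>x. (g x)\<^sup>2 \<partial>M)"
    by (simp add: power2_eq_square)
  ultimately show ?thesis by (simp only:)
qed

lemma square_integral_eq_0_AE:
  fixes f :: "'a \<Rightarrow> real"
  assumes "square_integrable M f" "(\<integral>x. (f x)\<^sup>2 \<partial>M) = 0"
  shows "AE x in M. f x = 0"
  using integral_nonneg_eq_0_iff_AE[of M "\<lambda>x. (f x)\<^sup>2"] assms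
  by (auto simp: square_integrable_real)

lemma L2_limit_unique:
  fixes S :: "nat \<Rightarrow> 'a \<Rightarrow> real"
  assumes S: "\<And>k. square_integrable M (S k)" and g: "square_integrable M g" and h: "square_integrable M h"
    and lim: "(\<lambda>k. \<integral>x. (S k x - g x)\<^sup>2 \<partial>M) \<longlonglongrightarrow> 0" "(\<lambda>k. \<integral>x. (S k x - h x)\<^sup>2 \<partial>M) \<longlonglongrightarrow> 0"
  shows "AE x in M. g x = h x"
proof -
  have gh: "square_integrable M (\<lambda>x. g x - h x)" by (rule square_integrable_diff[OF g h])
  have le: "(\<integral>x. (g x - h x)\<^sup>2 \<partial>M) \<le> 2 * (\<integral>x. (S k x - g x)\<^sup>2 \<partial>M) + 2 * (\<integral>x. (S k x - h x)\<^sup>2 \<partial>M)" for k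
    using square_integral_sum_le[OF square_integrable_diff[OF g S[of k]] square_integrable_diff[OF S[of k] h]]
    by (simp add: power2_commute)
  have "(\<lambda>k. 2 * (\<integral>x. (S k x - g x)\<^sup>2 \<partial>M) + 2 * (\<integral>x. (S k x - h x)\<^sup>2 \<partial>M)) \<longlonglongrightarrow> 2 * 0 + 2 * 0"
    by (intro tendsto_intros lim)
  from LIMSEQ_le_const[OF this] le have "(\<integral>x. (g x - h x)\<^sup>2 \<partial>M) \<le> 0" by auto
  then have "(\<integral>x. (g x - h x)\<^sup>2 \<partial>M) = 0" by (simp add: antisym)
  from square_integral_eq_0_AE[OF gh this] show ?thesis by simp
qed

text \<open>A subsequence converges almost everywhere to the limit in mean square; if the whole
  sequence converges pointwise, its pointwise limit must be the same.\<close>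

lemma L2_limit_AE_limit:
  fixes S :: "nat \<Rightarrow> 'a \<Rightarrow> real"
  assumes S: "\<And>k. square_integrable M (S k)" and g: "square_integrable M g"
    and lim: "(\<lambda>k. \<integral>x. (S k x - g x)\<^sup>2 \<partial>M) \<longlonglongrightarrow> 0"
    and conv: "AE x in M. convergent (\<lambda>k. S k x)"
  shows "AE x in M. (\<lambda>k. S k x) \<longlonglongrightarrow> g x"
proof -
  have "\<exists>r. strict_mono r \<and> (AE x in M. (\<lambda>n. (S (r n) x - g x)\<^sup>2) \<longlonglongrightarrow> 0)"
    using square_integrable_diff[OF S g] lim
    by (intro tendsto_L1_AE_subseq) (auto simp: square_integrable_real)
  then obtain r where r: "strict_mono r" "AE x in M. (\<lambda>n. (S (r n) x - g x)\<^sup>2) \<longlonglongrightarrow> 0"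
    by blast
  from r(2) conv show ?thesis
  proof eventually_elim
    case (elim x)
    then obtain l where l: "(\<lambda>k. S k x) \<longlonglongrightarrow> l" by (auto simp: convergent_def)
    have "(\<lambda>n. (S (r n) x - g x)\<^sup>2) \<longlonglongrightarrow> (l - g x)\<^sup>2"
      using LIMSEQ_subseq_LIMSEQ[OF l r(1)] by (intro tendsto_intros) (simp add: o_def)
    with elim(1) have "(l - g x)\<^sup>2 = 0" by (rule LIMSEQ_unique[rotated])
    with l show ?case by simp
  qed
qed

text \<open>Along a subsequence whose consecutive differences have squared norm below \<open>8\<^sup>-\<^sup>k\<close>, the series
  \<open>\<Sum> 4\<^sup>k (difference)\<^sup>2\<close> has a finite integral. So almost everywhere the differences are
  \<open>O(2\<^sup>-\<^sup>k)\<close> and the subsequence converges. Fatou's lemma turns this pointwise limit into a limit in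
  mean square of the whole sequence.\<close>

theorem Riesz_Fischer:
  fixes S :: "nat \<Rightarrow> 'a \<Rightarrow> real"
  assumes S: "\<And>k. square_integrable M (S k)"
    and Cauchy: "\<And>e. e > 0 \<Longrightarrow> \<exists>K. \<forall>j\<ge>K. \<forall>k\<ge>K. (\<integral>x. (S j x - S k x)\<^sup>2 \<partial>M) < e"
  shows "\<exists>g. square_integrable M g \<and> (\<lambda>k. \<integral>x. (S k x - g x)\<^sup>2 \<partial>M) \<longlonglongrightarrow> 0"
proof -
  have [measurable]: "S k \<in> borel_measurable M" for k
    using S by (simp add: square_integrable_real)
  have Sd: "integrable M (\<lambda>x. (S j x - S k x)\<^sup>2)" for j k
    using square_integrable_diff[OF S S] by (auto simp: square_integrable_real)
  have nn: "(\<integral>\<^sup>+x. ennreal ((S j x - S k x)\<^sup>2) \<partial>M) = ennreal (\<integral>x. (S j x - S k x)\<^sup>2 \<partial>M)" for j k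
    by (rule nn_integral_eq_integral[OF Sd]) simp
  have "\<exists>r :: nat \<Rightarrow> nat. strict_mono r \<and>
      (\<forall>k. \<forall>i\<ge>r k. \<forall>j\<ge>r k. (\<integral>x. (S i x - S j x)\<^sup>2 \<partial>M) < (1/8) ^ k)"
  proof -
    define P where "P k n \<longleftrightarrow> (\<forall>i\<ge>n. \<forall>j\<ge>n. (\<integral>x. (S i x - S j x)\<^sup>2 \<partial>M) < (1/8) ^ k)" for k n :: nat
    have "\<exists>n. P 0 n" unfolding P_def using Cauchy[of 1] by simp
    moreover have "\<exists>m. P (Suc k) m \<and> n < m" for k n
    proof -
      obtain K where "\<forall>j\<ge>K. \<forall>i\<ge>K. (\<integral>x. (S j x - S i x)\<^sup>2 \<partial>M) < (1/8) ^ Suc k"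
        using Cauchy[of "(1/8) ^ Suc k"] by auto
      then have "P (Suc k) (max K (Suc n))" by (simp add: P_def)
      then show ?thesis by (intro exI[of _ "max K (Suc n)"]) auto
    qed
    ultimately have "\<exists>r. \<forall>k. P k (r k) \<and> r k < r (Suc k)"
      by (intro dependent_nat_choice) auto
    then obtain r where "\<And>k. P k (r k)" "\<And>k. r k < r (Suc k)" by blast
    then show ?thesis unfolding P_def by (intro exI[of _ r]) (simp add: strict_mono_Suc_iff)
  qed
  then obtain r :: "nat \<Rightarrow> nat" where r: "strict_mono r"
    and rS: "\<And>k i j. r k \<le> i \<Longrightarrow> r k \<le> j \<Longrightarrow> (\<integral>x. (S i x - S j x)\<^sup>2 \<partial>M) < (1/8) ^ k"
    by blast
  define D where "D k x = S (r (Suc k)) x - S (r k) x" for k x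
  have [measurable]: "D k \<in> borel_measurable M" for k by (simp add: D_def[abs_def])
  have D: "(\<integral>\<^sup>+x. ennreal (4 ^ k * (D k x)\<^sup>2) \<partial>M) \<le> ennreal ((1/2) ^ k)" for k
  proof -
    have "(\<integral>\<^sup>+x. ennreal (4 ^ k * (D k x)\<^sup>2) \<partial>M) = (\<integral>\<^sup>+x. ennreal (4 ^ k) * ennreal ((D k x)\<^sup>2) \<partial>M)"
      by (simp add: ennreal_mult)
    also have "\<dots> = ennreal (4 ^ k) * (\<integral>\<^sup>+x. ennreal ((D k x)\<^sup>2) \<partial>M)"
      by (rule nn_integral_cmult) simp
    also have "\<dots> \<le> ennreal (4 ^ k) * ennreal ((1/8) ^ k)"
    proof -
      have "r k \<le> r (Suc k)" by (rule strict_mono_leD[OF r]) simp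
      then have "(\<integral>x. (S (r (Suc k)) x - S (r k) x)\<^sup>2 \<partial>M) \<le> (1/8) ^ k"
        using rS[of k "r (Suc k)" "r k"] by simp
      then show ?thesis unfolding D_def nn by (intro mult_left_mono ennreal_leI) simp_all
    qed
    also have "\<dots> = ennreal ((1/2) ^ k)"
      by (simp add: ennreal_mult[symmetric] power_mult_distrib[symmetric])
    finally show ?thesis .
  qed
  have "(\<integral>\<^sup>+x. (\<Sum>k. ennreal (4 ^ k * (D k x)\<^sup>2)) \<partial>M) = (\<Sum>k. \<integral>\<^sup>+x. ennreal (4 ^ k * (D k x)\<^sup>2) \<partial>M)"
    by (rule nn_integral_suminf) measurable
  also have "\<dots> \<le> (\<Sum>k. ennreal ((1/2) ^ k))"
    by (rule suminf_le[OF D]) auto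
  also have "\<dots> = ennreal (\<Sum>k. (1/2) ^ k)"
    by (rule suminf_ennreal2) (auto intro: summable_geometric)
  also have "\<dots> < \<infinity>" by simp
  finally have "AE x in M. (\<Sum>k. ennreal (4 ^ k * (D k x)\<^sup>2)) \<noteq> \<infinity>"
    by (intro nn_integral_PInf_AE) auto
  then have conv: "AE x in M. convergent (\<lambda>k. S (r k) x)"
  proof eventually_elim
    case (elim x)
    define C where "C = enn2real (\<Sum>k. ennreal (4 ^ k * (D k x)\<^sup>2))"
    have C: "C \<ge> 0" "(\<Sum>k. ennreal (4 ^ k * (D k x)\<^sup>2)) = ennreal C"
      using elim by (simp_all add: C_def less_top)
    have bound: "norm (D k x) \<le> sqrt C * (1/2) ^ k" for k
    proof -
      have "ennreal (4 ^ k * (D k x)\<^sup>2) = (\<Sum>i\<in>{k}. ennreal (4 ^ i * (D i x)\<^sup>2))" by simp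
      also have "\<dots> \<le> (\<Sum>k. ennreal (4 ^ k * (D k x)\<^sup>2))"
        by (rule sum_le_suminf) auto
      finally have "4 ^ k * (D k x)\<^sup>2 \<le> C" using C by simp
      then have "(2 ^ k * \<bar>D k x\<bar>)\<^sup>2 \<le> C"
        by (simp add: power_mult_distrib power_mult[symmetric] mult.commute[of k] power_mult)
      then have "2 ^ k * \<bar>D k x\<bar> \<le> sqrt C" by (rule real_le_rsqrt)
      then show ?thesis by (simp add: field_simps)
    qed
    have "summable (\<lambda>k. D k x)"
      by (rule summable_comparison_test'[OF _ bound]) (auto intro!: summable_mult summable_geometric)
    then have "convergent (\<lambda>n. \<Sum>k<n. D k x)" by (simp add: summable_iff_convergent)
    then have "convergent (\<lambda>n. S (r 0) x + (\<Sum>k<n. D k x))" by (simp add: convergent_add_const_iff)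
    moreover have "S (r 0) x + (\<Sum>k<n. D k x) = S (r n) x" for n
      by (simp add: D_def sum_lessThan_telescope[of "\<lambda>k. S (r k) x"])
    ultimately show ?case by simp
  qed
  define g where "g x = lim (\<lambda>k. S (r k) x)" for x
  have [measurable]: "g \<in> borel_measurable M"
    unfolding g_def[abs_def] by (rule borel_measurable_lim_metric) simp
  have close: "(\<integral>\<^sup>+x. ennreal ((S j x - g x)\<^sup>2) \<partial>M) \<le> ennreal e"
    if e: "e > 0" and K: "\<forall>j\<ge>K. \<forall>k\<ge>K. (\<integral>x. (S j x - S k x)\<^sup>2 \<partial>M) < e" and j: "j \<ge> K" for e K j
  proof -
    have "(\<integral>\<^sup>+x. ennreal ((S j x - g x)\<^sup>2) \<partial>M)
       = (\<integral>\<^sup>+x. liminf (\<lambda>k. ennreal ((S j x - S (r k) x)\<^sup>2)) \<partial>M)"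
      using conv
    proof (intro nn_integral_cong_AE, eventually_elim)
      case (elim x)
      then have "(\<lambda>k. S (r k) x) \<longlonglongrightarrow> g x" by (simp add: g_def convergent_LIMSEQ_iff)
      then have "(\<lambda>k. ennreal ((S j x - S (r k) x)\<^sup>2)) \<longlonglongrightarrow> ennreal ((S j x - g x)\<^sup>2)"
        by (intro tendsto_intros tendsto_ennrealI)
      from lim_imp_Liminf[OF sequentially_bot this] show ?case by simp
    qed
    also have "\<dots> \<le> liminf (\<lambda>k. \<integral>\<^sup>+x. ennreal ((S j x - S (r k) x)\<^sup>2) \<partial>M)"
      by (rule nn_integral_liminf) measurable
    also have "\<dots> \<le> liminf (\<lambda>k. ennreal e)"
    proof (rule Liminf_mono, rule eventually_sequentiallyI[of K])
      fix k assume "K \<le> k"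
      then have "K \<le> r k" using strict_mono_imp_increasing[OF r, of k] by simp
      then show "(\<integral>\<^sup>+x. ennreal ((S j x - S (r k) x)\<^sup>2) \<partial>M) \<le> ennreal e"
        unfolding nn using K j by (intro ennreal_leI less_imp_le) auto
    qed
    also have "\<dots> = ennreal e" by (simp add: Liminf_const)
    finally show ?thesis .
  qed
  have sq: "integrable M (\<lambda>x. (S j x - g x)\<^sup>2) \<and> (\<integral>x. (S j x - g x)\<^sup>2 \<partial>M) \<le> e"
    if e: "e > 0" and K: "\<forall>j\<ge>K. \<forall>k\<ge>K. (\<integral>x. (S j x - S k x)\<^sup>2 \<partial>M) < e" and j: "j \<ge> K" for e K j
  proof -
    have i: "integrable M (\<lambda>x. (S j x - g x)\<^sup>2)"
      using close[OF e K j] by (intro integrableI_bounded) (auto simp: less_top[symmetric] top_unique)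
    then show ?thesis
      using close[OF e K j] e nn_integral_eq_integral[OF i] by simp
  qed
  obtain K where K: "\<forall>j\<ge>K. \<forall>k\<ge>K. (\<integral>x. (S j x - S k x)\<^sup>2 \<partial>M) < 1"
    using Cauchy[of 1] by auto
  have "square_integrable M (\<lambda>x. S K x - g x)"
    using sq[of 1 K K] K by (simp add: square_integrable_real)
  from square_integrable_diff[OF S[of K] this] have g: "square_integrable M g" by simp
  have "(\<lambda>k. \<integral>x. (S k x - g x)\<^sup>2 \<partial>M) \<longlonglongrightarrow> 0"
  proof (rule LIMSEQ_I)
    fix e :: real assume e: "e > 0"
    then obtain K where K: "\<forall>j\<ge>K. \<forall>k\<ge>K. (\<integral>x. (S j x - S k x)\<^sup>2 \<partial>M) < e / 2"
      using Cauchy[of "e / 2"] by auto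
    have "norm ((\<integral>x. (S j x - g x)\<^sup>2 \<partial>M) - 0) < e" if "j \<ge> K" for j
      using sq[OF _ K that] e by simp
    then show "\<exists>no. \<forall>n\<ge>no. norm ((\<integral>x. (S n x - g x)\<^sup>2 \<partial>M) - 0) < e" by blast
  qed
  with g show ?thesis by blast
qed

section \<open>Orthonormal bases\<close>

lemma orthonormal_sum_inner:
  fixes e :: "nat \<Rightarrow> 'a \<Rightarrow> real"
  assumes e: "\<And>n. n \<ge> 1 \<Longrightarrow> square_integrable M (e n)" and f: "square_integrable M f"
  shows "(\<integral>x. f x * (\<Sum>n=1..N. c n * e n x) \<partial>M) = (\<Sum>n=1..N. c n * (\<integral>x. f x * e n x \<partial>M))"
proof -
  have "(\<integral>x. f x * (\<Sum>n=1..N. c n * e n x) \<partial>M) = (\<integral>x. (\<Sum>n=1..N. c n * (f x * e n x)) \<partial>M)"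
    by (simp add: sum_distrib_left mult_ac)
  also have "\<dots> = (\<Sum>n=1..N. c n * (\<integral>x. f x * e n x \<partial>M))"
    using square_integrable_mult[OF f e] by simp
  finally show ?thesis .
qed

text \<open>Pythagoras' theorem; both Bessel's inequality and Parseval's identity are read off from it.\<close>

lemma orthonormal_residual:
  fixes e :: "nat \<Rightarrow> 'a \<Rightarrow> real"
  assumes e: "\<And>n. n \<ge> 1 \<Longrightarrow> square_integrable M (e n)" and f: "square_integrable M f"
    and on: "\<And>m n. m \<ge> 1 \<Longrightarrow> n \<ge> 1 \<Longrightarrow> (\<integral>x. e m x * e n x \<partial>M) = (if m = n then 1 else 0)"
  shows "(\<integral>x. (f x - (\<Sum>n=1..N. (\<integral>y. f y * e n y \<partial>M) * e n x))\<^sup>2 \<partial>M)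
       = (\<integral>x. (f x)\<^sup>2 \<partial>M) - (\<Sum>n=1..N. (\<integral>y. f y * e n y \<partial>M)\<^sup>2)"
proof -
  define a where "a n = (\<integral>y. f y * e n y \<partial>M)" for n
  define g where "g x = (\<Sum>n=1..N. a n * e n x)" for x
  have g: "square_integrable M g"
    unfolding g_def[abs_def] by (intro square_integrable_sum square_integrable_cmult e) simp
  have fg: "(\<integral>x. f x * g x \<partial>M) = (\<Sum>n=1..N. (a n)\<^sup>2)"
  proof -
    have "(\<integral>x. f x * g x \<partial>M) = (\<Sum>n=1..N. a n * (\<integral>x. f x * e n x \<partial>M))"
      unfolding g_def by (rule orthonormal_sum_inner[OF e f])
    then show ?thesis by (simp add: a_def power2_eq_square)
  qed
  have ge: "(\<integral>x. g x * e n x \<partial>M) = a n" if "n \<in> {1..N}" for n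
  proof -
    have "(\<integral>x. g x * e n x \<partial>M) = (\<integral>x. e n x * (\<Sum>m=1..N. a m * e m x) \<partial>M)"
      by (simp add: g_def mult.commute)
    also have "\<dots> = (\<Sum>m=1..N. a m * (\<integral>x. e n x * e m x \<partial>M))"
      by (rule orthonormal_sum_inner[OF e e]) (use that in auto)
    also have "\<dots> = (\<Sum>m=1..N. if m = n then a m else 0)"
      using that by (intro sum.cong) (auto simp: on)
    also have "\<dots> = a n" using that by simp
    finally show ?thesis .
  qed
  have "(\<integral>x. g x * g x \<partial>M) = (\<Sum>n=1..N. a n * (\<integral>x. g x * e n x \<partial>M))"
    using orthonormal_sum_inner[OF e g, where N = N and c = a] by (simp add: g_def)
  then have gg: "(\<integral>x. (g x)\<^sup>2 \<partial>M) = (\<Sum>n=1..N. (a n)\<^sup>2)"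
    using ge by (simp add: power2_eq_square)
  show ?thesis
    using square_integral_diff_expand[OF f g] unfolding fg gg
    by (simp add: g_def a_def)
qed

lemma Parseval:
  assumes "orthonormal_basis_L2 M e" and f: "square_integrable M f"
  shows "(\<lambda>n. (\<integral>x. f x * e (Suc n) x \<partial>M)\<^sup>2) sums (\<integral>x. (f x)\<^sup>2 \<partial>M)"
proof -
  have "(\<lambda>N. (\<integral>x. (f x)\<^sup>2 \<partial>M) - (\<Sum>n=1..N. (\<integral>y. f y * e n y \<partial>M)\<^sup>2)) \<longlonglongrightarrow> 0"
    using assms orthonormal_residual[of M e f] unfolding orthonormal_basis_L2_def by auto
  from tendsto_diff[OF tendsto_const this, of "\<integral>x. (f x)\<^sup>2 \<partial>M"]
  have "(\<lambda>N. (\<Sum>n=1..N. (\<integral>y. f y * e n y \<partial>M)\<^sup>2)) \<longlonglongrightarrow> (\<integral>x. (f x)\<^sup>2 \<partial>M)" by simp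
  moreover have "(\<Sum>n=1..N. (\<integral>y. f y * e n y \<partial>M)\<^sup>2) = (\<Sum>n<N. (\<integral>y. f y * e (Suc n) y \<partial>M)\<^sup>2)" for N
    using sum.atLeast_Suc_lessThan_Suc_shift[of _ 0 N]
    by (simp add: atLeastLessThanSuc_atLeastAtMost lessThan_atLeast0 flip: One_nat_def)
  ultimately show ?thesis by (simp add: sums_def)
qed

text \<open>Completeness in the sense of convergent expansions follows from totality: the expansion of \<open>f\<close>
  is a Cauchy sequence by Bessel's inequality, and the difference of \<open>f\<close> and its limit is
  orthogonal to every basis element.\<close>

lemma orthonormal_basis_L2I:
  fixes e :: "nat \<Rightarrow> 'a \<Rightarrow> real"
  assumes e: "\<And>n. n \<ge> 1 \<Longrightarrow> square_integrable M (e n)"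
    and on: "\<And>m n. m \<ge> 1 \<Longrightarrow> n \<ge> 1 \<Longrightarrow> (\<integral>x. e m x * e n x \<partial>M) = (if m = n then 1 else 0)"
    and total: "\<And>f. square_integrable M f \<Longrightarrow> (\<And>n. n \<ge> 1 \<Longrightarrow> (\<integral>x. f x * e n x \<partial>M) = 0) \<Longrightarrow> AE x in M. f x = 0"
  shows "orthonormal_basis_L2 M e"
  unfolding orthonormal_basis_L2_def
proof (intro conjI allI impI)
  fix f :: "'a \<Rightarrow> real" assume f: "square_integrable M f"
  define a where "a n = (\<integral>y. f y * e n y \<partial>M)" for n
  define S where "S N x = (\<Sum>n=1..N. a n * e n x)" for N x
  have S: "square_integrable M (S N)" for N
    unfolding S_def[abs_def] by (intro square_integrable_sum square_integrable_cmult e) simp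
  have Se: "(\<integral>x. S N x * e m x \<partial>M) = (if m \<le> N then a m else 0)" if "m \<ge> 1" for m N
  proof -
    have "(\<integral>x. S N x * e m x \<partial>M) = (\<integral>x. e m x * (\<Sum>n=1..N. a n * e n x) \<partial>M)"
      by (simp add: S_def mult.commute)
    also have "\<dots> = (\<Sum>n=1..N. a n * (\<integral>x. e m x * e n x \<partial>M))"
      by (rule orthonormal_sum_inner[OF e e]) (use that in auto)
    also have "\<dots> = (\<Sum>n=1..N. if n = m then a n else 0)"
      using that by (intro sum.cong) (auto simp: on)
    also have "\<dots> = (if m \<le> N then a m else 0)" using that by simp
    finally show ?thesis .
  qed
  have SS: "(\<integral>x. S j x * S k x \<partial>M) = (\<Sum>n=1..min j k. (a n)\<^sup>2)" for j k
  proof -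
    have "(\<integral>x. S j x * S k x \<partial>M) = (\<Sum>n=1..k. a n * (\<integral>x. S j x * e n x \<partial>M))"
      unfolding S_def[of k] by (rule orthonormal_sum_inner[OF e S])
    also have "\<dots> = (\<Sum>n=1..k. if n \<le> j then (a n)\<^sup>2 else 0)"
      by (intro sum.cong) (auto simp: Se power2_eq_square)
    also have "\<dots> = (\<Sum>n=1..min j k. (a n)\<^sup>2)"
      by (intro sum.mono_neutral_cong_right) auto
    finally show ?thesis .
  qed
  define B where "B N = (\<Sum>n=1..N. (a n)\<^sup>2)" for N
  have Sd: "(\<integral>x. (S j x - S k x)\<^sup>2 \<partial>M) = \<bar>B j - B k\<bar>" for j k
  proof -
    have mono: "B i \<le> B i'" if "i \<le> i'" for i i'
      unfolding B_def using that by (intro sum_mono2) auto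
    show ?thesis
      using square_integral_diff_expand[OF S[of j] S[of k]] mono[of j k] mono[of k j]
      by (cases "j \<le> k") (auto simp: SS power2_eq_square[of "S _ _"] B_def min_def)
  qed
  have "B N \<le> (\<integral>x. (f x)\<^sup>2 \<partial>M)" for N
  proof -
    have "0 \<le> (\<integral>x. (f x - (\<Sum>n=1..N. (\<integral>y. f y * e n y \<partial>M) * e n x))\<^sup>2 \<partial>M)" by simp
    also have "\<dots> = (\<integral>x. (f x)\<^sup>2 \<partial>M) - (\<Sum>n=1..N. (\<integral>y. f y * e n y \<partial>M)\<^sup>2)"
      by (rule orthonormal_residual[OF e f on])
    finally show ?thesis by (simp add: B_def a_def)
  qed
  moreover have "incseq B"
    unfolding B_def by (intro monoI sum_mono2) auto
  ultimately have "convergent B"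
    using incseq_convergent[of B] unfolding convergent_def by blast
  then have "Cauchy B" by (simp add: Cauchy_convergent_iff)
  have "\<exists>K. \<forall>j\<ge>K. \<forall>k\<ge>K. (\<integral>x. (S j x - S k x)\<^sup>2 \<partial>M) < d" if "d > 0" for d
    using CauchyD[OF \<open>Cauchy B\<close> that] unfolding Sd by simp
  from Riesz_Fischer[OF S this] obtain g where g: "square_integrable M g"
    and lim: "(\<lambda>k. \<integral>x. (S k x - g x)\<^sup>2 \<partial>M) \<longlonglongrightarrow> 0" by blast
  have fg: "square_integrable M (\<lambda>x. f x - g x)" by (rule square_integrable_diff[OF f g])
  have "(\<integral>x. (f x - g x) * e n x \<partial>M) = 0" if n: "n \<ge> 1" for n
  proof -
    have "(\<lambda>k. \<integral>x. S k x * e n x \<partial>M) \<longlonglongrightarrow> (\<integral>x. g x * e n x \<partial>M)"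
      by (rule L2_limit_inner[OF S g lim e[OF n]])
    moreover have "(\<lambda>k. \<integral>x. S k x * e n x \<partial>M) \<longlonglongrightarrow> a n"
      by (rule tendsto_eventually, rule eventually_sequentiallyI[of n]) (use Se[OF n] in simp)
    ultimately have "(\<integral>x. g x * e n x \<partial>M) = a n" by (rule LIMSEQ_unique)
    then show ?thesis
      using square_integrable_mult[OF f e[OF n]] square_integrable_mult[OF g e[OF n]]
      by (simp add: left_diff_distrib a_def)
  qed
  from total[OF fg this] have "AE x in M. f x = g x" by simp
  then have "(\<integral>x. (f x - S N x)\<^sup>2 \<partial>M) = (\<integral>x. (S N x - g x)\<^sup>2 \<partial>M)" for N
    using square_integrable_diff[OF f S] square_integrable_diff[OF S g]
    by (intro integral_cong_AE) (auto simp: square_integrable_real power2_commute)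
  with lim show "(\<lambda>N. \<integral>x. (f x - (\<Sum>n=1..N. (\<integral>y. f y * e n y \<partial>M) * e n x))\<^sup>2 \<partial>M) \<longlonglongrightarrow> 0"
    by (simp add: S_def a_def)
qed (use e on in auto)

section \<open>Hermite functions\<close>

text \<open>The Hermite functions before normalization, indexed by the degree.\<close>

definition hermite_wave :: "nat \<Rightarrow> real \<Rightarrow> real" where
  "hermite_wave n x = poly (hermite_poly n) x * exp (- (x\<^sup>2) / 2)"

declare hermite_poly.simps(2) [simp del]

lemma hermite_fun_wave:
  "hermite_fun (Suc n) x = hermite_wave n x / sqrt (2 ^ n * fact n * sqrt pi)"
  by (simp add: hermite_fun_def hermite_wave_def mult.commute)

text \<open>Multiplication by \<open>x\<close> minus differentiation raises the degree by one; this is where the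
  recursion for the Hermite polynomials comes from.\<close>

lemma hermite_wave_deriv:
  "(hermite_wave n has_real_derivative x * hermite_wave n x - hermite_wave (Suc n) x) (at x)"
  unfolding hermite_wave_def
  by (rule derivative_eq_intros poly_DERIV refl | simp)+ (simp add: hermite_poly.simps(2) algebra_simps)

lemma pderiv_hermite_poly: "pderiv (hermite_poly (Suc n)) = smult (2 * real (Suc n)) (hermite_poly n)"
proof (induction n)
  case 0
  show ?case by (simp add: hermite_poly.simps(2) pderiv_pCons pderiv_mult)
next
  case (Suc n)
  have pd: "pderiv ([:0, 2:] * H - pderiv H) = smult 2 H + [:0, 2:] * pderiv H - pderiv (pderiv H)"
    for H :: "real poly"
    by (simp add: pderiv_mult pderiv_diff pderiv_pCons pderiv_smult algebra_simps)
  have "pderiv (hermite_poly (Suc (Suc n)))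
      = smult 2 (hermite_poly (Suc n)) + [:0, 2:] * pderiv (hermite_poly (Suc n)) - pderiv (pderiv (hermite_poly (Suc n)))"
    unfolding hermite_poly.simps(2)[of "Suc n"] by (rule pd)
  also have "\<dots> = smult 2 (hermite_poly (Suc n)) +
      smult (2 * real (Suc n)) ([:0, 2:] * hermite_poly n - pderiv (hermite_poly n))"
    unfolding Suc.IH by (simp only: pderiv_smult mult_smult_right smult_diff_right add_diff_eq)
  also have "\<dots> = smult (2 * real (Suc (Suc n))) (hermite_poly (Suc n))"
    unfolding hermite_poly.simps(2)[of n, symmetric] smult_add_left[symmetric]
    by (rule arg_cong2[where f = smult]) simp_all
  finally show ?case .
qed

lemma hermite_wave_rec:
  "2 * x * hermite_wave 0 x = hermite_wave (Suc 0) x"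
  "2 * x * hermite_wave (Suc n) x = hermite_wave (Suc (Suc n)) x + 2 * real (Suc n) * hermite_wave n x"
proof -
  show "2 * x * hermite_wave 0 x = hermite_wave (Suc 0) x"
    by (simp add: hermite_wave_def hermite_poly.simps(2) pderiv_pCons)
  have "poly (hermite_poly (Suc (Suc n))) x
     = 2 * x * poly (hermite_poly (Suc n)) x - 2 * real (Suc n) * poly (hermite_poly n) x"
    unfolding hermite_poly.simps(2)[of "Suc n"] pderiv_hermite_poly by simp
  then show "2 * x * hermite_wave (Suc n) x = hermite_wave (Suc (Suc n)) x + 2 * real (Suc n) * hermite_wave n x"
    unfolding hermite_wave_def by (simp only:) (simp add: algebra_simps)
qed

lemma hermite_wave_parity: "hermite_wave n (- x) = (- 1) ^ n * hermite_wave n x"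
proof (induction n rule: less_induct)
  case (less n)
  consider "n = 0" | "n = Suc 0" | m where "n = Suc (Suc m)" by (metis not0_implies_Suc)
  then show ?case
  proof cases
    case 3
    have rec: "hermite_wave n y = 2 * y * hermite_wave (Suc m) y - 2 * real (Suc m) * hermite_wave m y" for y
      using hermite_wave_rec(2)[of y m] 3 by simp
    have "hermite_wave n (- x) = (- 1) ^ n * (2 * x * hermite_wave (Suc m) x - 2 * real (Suc m) * hermite_wave m x)"
      unfolding rec[of "- x"] using less[of m] less[of "Suc m"] 3 by (simp add: algebra_simps)
    then show ?thesis unfolding rec[of x] .
  qed (simp_all add: hermite_wave_def hermite_poly.simps(2) pderiv_pCons)
qed

lemma hermite_wave_continuous: "continuous_on A (hermite_wave n)"
  by (intro continuous_at_imp_continuous_on ballI DERIV_isCont[OF hermite_wave_deriv])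

lemma hermite_wave_measurable [measurable]: "hermite_wave n \<in> borel_measurable borel"
  by (rule borel_measurable_continuous_onI[OF hermite_wave_continuous])

lemma integrable_monom_gauss: "integrable lborel (\<lambda>x :: real. x ^ k * exp (- (x\<^sup>2) / 2))"
  using integrable_mult_right[OF integrable_std_normal_moment[of k], of "sqrt (2 * pi)"]
  by (simp add: std_normal_density_def mult_ac)

lemma integrable_poly_gauss: "integrable lborel (\<lambda>x :: real. poly p x * exp (- (x\<^sup>2) / 2))"
  using integrable_monom_gauss
  by (simp add: poly_altdef sum_distrib_right mult.assoc)

lemma hermite_wave_integrable: "integrable lborel (hermite_wave n)"
  using integrable_poly_gauss[of "hermite_poly n"] by (simp add: hermite_wave_def[abs_def])

lemma monom_hermite_square_integrable: "square_integrable lborel (\<lambda>x. x ^ k * hermite_wave n x)"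
proof -
  define p where "p = (monom 1 k * hermite_poly n)\<^sup>2"
  have "integrable lborel (\<lambda>x. (x ^ k * hermite_wave n x)\<^sup>2)"
  proof (rule Bochner_Integration.integrable_bound[OF integrable_poly_gauss[of p]])
    show "AE x in lborel. norm ((x ^ k * hermite_wave n x)\<^sup>2) \<le> norm (poly p x * exp (- (x\<^sup>2) / 2))"
    proof (rule AE_I2)
      fix x :: real
      have "(x ^ k * hermite_wave n x)\<^sup>2 = poly p x * (exp (- (x\<^sup>2) / 2))\<^sup>2"
        by (simp add: p_def hermite_wave_def poly_monom power_mult_distrib mult.assoc)
      also have "\<dots> \<le> poly p x * exp (- (x\<^sup>2) / 2)"
        by (intro mult_left_mono) (auto simp: p_def power2_eq_square intro!: mult_left_le)
      finally show "norm ((x ^ k * hermite_wave n x)\<^sup>2) \<le> norm (poly p x * exp (- (x\<^sup>2) / 2))" by simp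
    qed
  qed simp
  then show ?thesis by (simp add: square_integrable_real)
qed

lemma hermite_wave_square_integrable: "square_integrable lborel (hermite_wave n)"
  using monom_hermite_square_integrable[of 0 n] by simp

lemma hermite_wave_at_infinity: "(hermite_wave n \<longlongrightarrow> 0) at_infinity"
proof -
  have lim: "filterlim (\<lambda>x :: real. x\<^sup>2 / 2) at_top at_infinity"
    unfolding filterlim_at_top eventually_at_infinity
  proof (intro allI exI[of _ "max 2 _"] impI)
    fix Z x :: real assume x: "max 2 Z \<le> norm x"
    then have "2 * \<bar>x\<bar> \<le> \<bar>x\<bar> * \<bar>x\<bar>" by (intro mult_right_mono) auto
    then show "Z \<le> x\<^sup>2 / 2" using x by (simp add: power2_eq_square abs_mult_self_eq)
  qed
  have monom: "((\<lambda>x :: real. x ^ k * exp (- (x\<^sup>2) / 2)) \<longlongrightarrow> 0) at_infinity" for k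
  proof (rule Lim_null_comparison)
    have "((\<lambda>x :: real. 2 ^ k * ((x\<^sup>2 / 2) ^ k / exp (x\<^sup>2 / 2))) \<longlongrightarrow> 2 ^ k * 0) at_infinity"
      by (intro tendsto_mult tendsto_const filterlim_compose[OF tendsto_power_div_exp_0 lim])
    then show "((\<lambda>x :: real. 2 ^ k * ((x\<^sup>2 / 2) ^ k / exp (x\<^sup>2 / 2))) \<longlongrightarrow> 0) at_infinity" by simp
    have "norm (x ^ k * exp (- (x\<^sup>2) / 2)) \<le> 2 ^ k * ((x\<^sup>2 / 2) ^ k / exp (x\<^sup>2 / 2))"
      if "1 \<le> norm x" for x :: real
    proof -
      have "\<bar>x\<bar> ^ k \<le> (x\<^sup>2) ^ k"
        using that mult_left_mono[of 1 "\<bar>x\<bar>" "\<bar>x\<bar>"]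
        by (intro power_mono) (auto simp: power2_eq_square abs_mult_self_eq)
      then show ?thesis
        by (simp add: abs_mult power_abs power_divide exp_minus field_simps)
    qed
    then show "\<forall>\<^sub>F x in at_infinity. norm (x ^ k * exp (- (x\<^sup>2) / 2)) \<le> 2 ^ k * ((x\<^sup>2 / 2) ^ k / exp (x\<^sup>2 / 2))"
      unfolding eventually_at_infinity by blast
  qed
  have "((\<lambda>x. \<Sum>i\<le>degree (hermite_poly n). coeff (hermite_poly n) i * (x ^ i * exp (- (x\<^sup>2) / 2)))
     \<longlongrightarrow> (\<Sum>i\<le>degree (hermite_poly n). coeff (hermite_poly n) i * 0)) at_infinity"
    by (intro tendsto_intros monom)
  then show ?thesis
    by (simp add: hermite_wave_def[abs_def] poly_altdef sum_distrib_right mult.assoc)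
qed

text \<open>Integration by parts on the line, without boundary terms.\<close>

lemma integral_deriv_eq_0:
  fixes f f' :: "real \<Rightarrow> 'b::euclidean_space"
  assumes "\<And>x. (f has_vector_derivative f' x) (at x)" "\<And>x. isCont f' x" "integrable lborel f'"
    and lim: "(f \<longlongrightarrow> 0) at_infinity"
  shows "(\<integral>x. f' x \<partial>lborel) = 0"
proof -
  have "(f \<longlongrightarrow> 0) at_top" "(f \<longlongrightarrow> 0) at_bot"
    using lim tendsto_mono[OF at_top_le_at_infinity] tendsto_mono[OF at_bot_le_at_infinity] by blast+
  then have "(LBINT x=-\<infinity>..\<infinity>. f' x) = 0 - 0"
    using assms by (intro interval_integral_FTC_integrable[of _ _ f])
      (auto simp: ereal_tendsto_simps set_integrable_def)
  then show ?thesis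
    by (simp add: interval_lebesgue_integral_def set_lebesgue_integral_def)
qed

text \<open>Integrate the derivatives of \<open>h\<^sub>m h\<^sub>0\<close> and \<open>h\<^sub>m h\<^sub>n\<^sub>+\<^sub>1\<close> over the line. The
  raising rule leaves a factor \<open>2 x\<close>, which the three-term recursion absorbs.\<close>

lemma hermite_wave_inner_rec:
  "(\<integral>x. hermite_wave (Suc m) x * hermite_wave 0 x \<partial>lborel) = 0"
  "(\<integral>x. hermite_wave (Suc m) x * hermite_wave (Suc n) x \<partial>lborel)
     = 2 * real (Suc n) * (\<integral>x. hermite_wave m x * hermite_wave n x \<partial>lborel)"
proof -
  have lim: "((\<lambda>x. hermite_wave i x * hermite_wave j x) \<longlongrightarrow> 0) at_infinity" for i j
    using tendsto_mult[OF hermite_wave_at_infinity[of i] hermite_wave_at_infinity[of j]] by simp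
  have int: "integrable lborel (\<lambda>x. hermite_wave i x * hermite_wave j x)" for i j
    by (rule square_integrable_mult[OF hermite_wave_square_integrable hermite_wave_square_integrable])
  have cont: "isCont (hermite_wave i) x" for i x
    by (rule DERIV_isCont[OF hermite_wave_deriv])
  have "((\<lambda>x. hermite_wave m x * hermite_wave 0 x) has_vector_derivative
      - (hermite_wave (Suc m) x * hermite_wave 0 x)) (at x)" for x
    unfolding has_real_derivative_iff_has_vector_derivative[symmetric]
    using hermite_wave_rec(1)[of x]
    by (auto intro!: derivative_eq_intros hermite_wave_deriv simp: algebra_simps)
  from integral_deriv_eq_0[OF this _ _ lim]
  show "(\<integral>x. hermite_wave (Suc m) x * hermite_wave 0 x \<partial>lborel) = 0"
    using int cont by (simp add: continuous_intros)
  have "((\<lambda>x. hermite_wave m x * hermite_wave (Suc n) x) has_vector_derivative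
      (2 * real (Suc n) * (hermite_wave m x * hermite_wave n x)
       - hermite_wave (Suc m) x * hermite_wave (Suc n) x)) (at x)" for x
    unfolding has_real_derivative_iff_has_vector_derivative[symmetric]
  proof -
    have eq: "(x * hermite_wave m x - hermite_wave (Suc m) x) * hermite_wave (Suc n) x
        + (x * hermite_wave (Suc n) x - hermite_wave (Suc (Suc n)) x) * hermite_wave m x
       = 2 * real (Suc n) * (hermite_wave m x * hermite_wave n x) - hermite_wave (Suc m) x * hermite_wave (Suc n) x"
    proof -
      have "hermite_wave (Suc (Suc n)) x = 2 * x * hermite_wave (Suc n) x - 2 * real (Suc n) * hermite_wave n x"
        using hermite_wave_rec(2)[of x n] by simp
      then show ?thesis by (simp only:) (simp add: algebra_simps)
    qed
    show "((\<lambda>x. hermite_wave m x * hermite_wave (Suc n) x) has_real_derivative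
      (2 * real (Suc n) * (hermite_wave m x * hermite_wave n x)
       - hermite_wave (Suc m) x * hermite_wave (Suc n) x)) (at x)"
      using DERIV_mult[OF hermite_wave_deriv[of m x] hermite_wave_deriv[of "Suc n" x]] unfolding eq .
  qed
  from integral_deriv_eq_0[OF this _ _ lim]
  have "(\<integral>x. 2 * real (Suc n) * (hermite_wave m x * hermite_wave n x)
       - hermite_wave (Suc m) x * hermite_wave (Suc n) x \<partial>lborel) = 0"
    using int cont by (simp add: continuous_intros del: of_nat_Suc)
  then show "(\<integral>x. hermite_wave (Suc m) x * hermite_wave (Suc n) x \<partial>lborel)
     = 2 * real (Suc n) * (\<integral>x. hermite_wave m x * hermite_wave n x \<partial>lborel)"
    using int by (simp del: of_nat_Suc)
qed

lemma hermite_wave_orthogonal: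
  "(\<integral>x. hermite_wave m x * hermite_wave n x \<partial>lborel)
     = (if m = n then 2 ^ n * fact n * sqrt pi else 0)"
proof (induction m arbitrary: n)
  case 0
  show ?case
  proof (cases n)
    case 0
    have "has_bochner_integral lborel (\<lambda>x :: real. exp (- x\<^sup>2)) (2 *\<^sub>R (sqrt pi / 2))"
      by (rule has_bochner_integral_even_function[OF gaussian_moment_0]) simp
    then show ?thesis
      using 0 by (simp add: hermite_wave_def exp_add[symmetric] has_bochner_integral_integral_eq)
  next
    case (Suc n')
    then show ?thesis using hermite_wave_inner_rec(1)[of n'] by (simp add: mult.commute)
  qed
next
  case (Suc m)
  show ?case
  proof (cases n)
    case 0
    then show ?thesis using hermite_wave_inner_rec(1)[of m] by simp
  next
    case (Suc n')
    then show ?thesis unfolding Suc hermite_wave_inner_rec(2) Suc.IH by simp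
  qed
qed

section \<open>The Fourier transform of the Hermite functions\<close>

lemma fourier_integrable:
  fixes g :: "real \<Rightarrow> real"
  assumes "integrable lborel g"
  shows "integrable lborel (\<lambda>x. iexp (\<xi> * x) * of_real (g x))"
proof (rule Bochner_Integration.integrable_bound[OF assms])
  show "AE x in lborel. norm (iexp (\<xi> * x) * complex_of_real (g x)) \<le> norm (g x)"
    by (simp add: norm_mult)
qed (use assms in measurable)

text \<open>Differentiation under the integral. The second-order remainder of the exponential is
  bounded by \<open>h\<^sup>2 x\<^sup>2 / 2\<close>, so the second moment of \<open>g\<close> controls the error by a multiple of
  \<open>h\<^sup>2\<close>.\<close>

lemma fourier_deriv:
  fixes g :: "real \<Rightarrow> real"
  assumes g: "integrable lborel g" "integrable lborel (\<lambda>x. x * g x)" "integrable lborel (\<lambda>x. x\<^sup>2 * g x)"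
  shows "((\<lambda>\<xi>. \<integral>x. iexp (\<xi> * x) * of_real (g x) \<partial>lborel) has_vector_derivative
     (\<integral>x. \<i> * (iexp (\<xi> * x) * of_real (x * g x)) \<partial>lborel)) (at \<xi>)"
  unfolding has_vector_derivative_def
proof (rule has_derivativeI_sandwich[where e = 1])
  define F where "F \<xi> = (\<integral>x. iexp (\<xi> * x) * of_real (g x) \<partial>lborel)" for \<xi>
  define D where "D = (\<integral>x. \<i> * (iexp (\<xi> * x) * of_real (x * g x)) \<partial>lborel)"
  define K where "K = (\<integral>x. \<bar>x\<^sup>2 * g x\<bar> \<partial>lborel)"
  have bound: "norm (F y - F \<xi> - (y - \<xi>) *\<^sub>R D) \<le> (y - \<xi>)\<^sup>2 / 2 * K" for y
  proof -
    define h where "h = y - \<xi>"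
    let ?R = "\<lambda>x. iexp (h * x) - (\<Sum>k\<le>1. (\<i> * (h * x)) ^ k / fact k)"
    have ie: "iexp (y * x) = iexp (\<xi> * x) * iexp (h * x)" for x
      by (simp add: h_def exp_add[symmetric] algebra_simps)
    have "F y - F \<xi> - h *\<^sub>R D = (\<integral>x. iexp (y * x) * of_real (g x) - iexp (\<xi> * x) * of_real (g x)
        - h *\<^sub>R (\<i> * (iexp (\<xi> * x) * of_real (x * g x))) \<partial>lborel)"
      unfolding F_def D_def using fourier_integrable[OF g(1)] fourier_integrable[OF g(2)] by simp
    also have "\<dots> = (\<integral>x. iexp (\<xi> * x) * ?R x * of_real (g x) \<partial>lborel)"
      by (intro Bochner_Integration.integral_cong refl)
        (simp only: ie, simp add: scaleR_conv_of_real algebra_simps)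
    also have "norm \<dots> \<le> (\<integral>x. h\<^sup>2 / 2 * \<bar>x\<^sup>2 * g x\<bar> \<partial>lborel)"
    proof (rule Bochner_Integration.integral_norm_bound_integral)
      show I: "integrable lborel (\<lambda>x. h\<^sup>2 / 2 * \<bar>x\<^sup>2 * g x\<bar>)"
        using g(3) by (intro integrable_mult_right integrable_abs)
      have N: "norm (iexp (\<xi> * x) * ?R x * of_real (g x))
          \<le> h\<^sup>2 / 2 * \<bar>x\<^sup>2 * g x\<bar>" for x
      proof -
        have "norm (?R x) \<le> \<bar>h * x\<bar> ^ Suc 1 / fact (Suc 1)"
          by (rule iexp_approx1)
        then have "norm (?R x) * \<bar>g x\<bar>
             \<le> (h * x)\<^sup>2 / 2 * \<bar>g x\<bar>"
          by (intro mult_right_mono) (auto simp: power2_eq_square abs_mult)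
        then show ?thesis
          by (simp add: norm_mult abs_mult power_mult_distrib mult_ac)
      qed
      show "norm (iexp (\<xi> * x) * ?R x * of_real (g x))
          \<le> h\<^sup>2 / 2 * \<bar>x\<^sup>2 * g x\<bar>" for x by (rule N)
      show "integrable lborel (\<lambda>x. iexp (\<xi> * x) * ?R x * of_real (g x))"
        using g(1) by (intro Bochner_Integration.integrable_bound[OF I] AE_I2 order_trans[OF N]) (auto simp: abs_mult)
    qed
    also have "\<dots> = h\<^sup>2 / 2 * K" unfolding K_def by (rule integral_mult_right_zero)
    finally show ?thesis by (simp add: h_def)
  qed
  show "norm (F y - F \<xi> - (y - \<xi>) *\<^sub>R D) / norm (y - \<xi>) \<le> \<bar>y - \<xi>\<bar> / 2 * K" if "y \<noteq> \<xi>" for y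
  proof -
    have "(y - \<xi>)\<^sup>2 / 2 * K = (\<bar>y - \<xi>\<bar> / 2 * K) * norm (y - \<xi>)"
      by (simp add: power2_eq_square abs_mult_self_eq)
    then have "norm (F y - F \<xi> - (y - \<xi>) *\<^sub>R D) \<le> (\<bar>y - \<xi>\<bar> / 2 * K) * norm (y - \<xi>)"
      using bound[of y] by (simp only:)
    moreover have "norm (y - \<xi>) > 0" using that by simp
    ultimately show ?thesis by (subst pos_divide_le_eq)
  qed
  have "((\<lambda>y. \<bar>y - \<xi>\<bar> / 2 * K) \<longlongrightarrow> \<bar>\<xi> - \<xi>\<bar> / 2 * K) (at \<xi>)"
    by (intro tendsto_intros) simp_all
  then show "((\<lambda>y. \<bar>y - \<xi>\<bar> / 2 * K) \<longlongrightarrow> 0) (at \<xi>)" by simp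
qed (auto intro: bounded_linear_scaleR_left)

lemma has_vector_derivative_iexp_scaled:
  "((\<lambda>x. iexp (\<xi> * x)) has_vector_derivative \<i> * \<xi> * iexp (\<xi> * x)) (at x)"
  by (auto intro!: derivative_eq_intros simp: Re_exp Im_exp has_vector_derivative_complex_iff)

lemma hermite_wave_moment_integrable: "integrable lborel (\<lambda>x. x ^ k * hermite_wave n x)"
  using integrable_poly_gauss[of "monom 1 k * hermite_poly n"]
  by (simp add: hermite_wave_def poly_monom mult.assoc)

text \<open>Under the Fourier transform, multiplication by \<open>x\<close> and differentiation change places up to factors
  \<open>\<i>\<close>. Thus the raising operator is mapped to \<open>\<i>\<close> times itself, and the induction starts from
  the characteristic function of the standard normal distribution.\<close>

lemma hermite_wave_fourier:
  "(\<integral>x. iexp (\<xi> * x) * of_real (hermite_wave n x) \<partial>lborel)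
     = of_real (sqrt (2 * pi)) * \<i> ^ n * of_real (hermite_wave n \<xi>)"
proof (induction n arbitrary: \<xi>)
  case 0
  have "of_real (exp (- (\<xi>\<^sup>2) / 2)) = char std_normal_distribution \<xi>"
    by (simp add: char_std_normal_distribution)
  also have "\<dots> = (\<integral>x. std_normal_density x *\<^sub>R iexp (\<xi> * x) \<partial>lborel)"
    unfolding char_def by (subst integral_density) auto
  also have "\<dots> = (\<integral>x. of_real (1 / sqrt (2 * pi)) * (iexp (\<xi> * x) * of_real (hermite_wave 0 x)) \<partial>lborel)"
    by (simp add: std_normal_density_def hermite_wave_def scaleR_conv_of_real mult_ac)
  also have "\<dots> = of_real (1 / sqrt (2 * pi)) * (\<integral>x. iexp (\<xi> * x) * of_real (hermite_wave 0 x) \<partial>lborel)"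
    by (rule integral_mult_right_zero)
  finally show ?case
    by (simp add: hermite_wave_def field_simps)
next
  case (Suc n)
  define F where "F n \<xi> = (\<integral>x. iexp (\<xi> * x) * of_real (hermite_wave n x) \<partial>lborel)" for n \<xi>
  define c where "c = of_real (sqrt (2 * pi)) * \<i> ^ n"
  define G where "G = (\<integral>x. iexp (\<xi> * x) * of_real (x * hermite_wave n x) \<partial>lborel)"
  have int: "integrable lborel (\<lambda>x. iexp (\<xi> * x) * of_real (hermite_wave m x))" for m
    by (rule fourier_integrable[OF hermite_wave_integrable])
  have intx: "integrable lborel (\<lambda>x. iexp (\<xi> * x) * of_real (x * hermite_wave n x))"
    using fourier_integrable[OF hermite_wave_moment_integrable[of 1 n]] by simp
  have Fn: "F n = (\<lambda>\<xi>. c * of_real (hermite_wave n \<xi>))"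
    using Suc.IH by (simp add: F_def[abs_def] c_def)
  have d1: "(F n has_vector_derivative \<i> * G) (at \<xi>)"
    using fourier_deriv[of "hermite_wave n" \<xi>] hermite_wave_integrable[of n]
      hermite_wave_moment_integrable[of 1 n] hermite_wave_moment_integrable[of 2 n]
    by (simp add: F_def[abs_def] G_def)
  have d2: "(F n has_vector_derivative c * of_real (\<xi> * hermite_wave n \<xi> - hermite_wave (Suc n) \<xi>)) (at \<xi>)"
    unfolding Fn
    by (intro has_vector_derivative_mult_right has_vector_derivative_of_real hermite_wave_deriv)
  have G: "\<i> * G = c * of_real (\<xi> * hermite_wave n \<xi> - hermite_wave (Suc n) \<xi>)"
    by (rule vector_derivative_unique_at[OF d1 d2])
  let ?D = "\<lambda>x. \<i> * \<xi> * (iexp (\<xi> * x) * of_real (hermite_wave n x)) + iexp (\<xi> * x) * of_real (x * hermite_wave n x)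
        - iexp (\<xi> * x) * of_real (hermite_wave (Suc n) x)"
  have "((\<lambda>x. iexp (\<xi> * x) * of_real (hermite_wave n x)) has_vector_derivative
      (?D x)) (at x)" for x
    by (rule has_vector_derivative_eq_rhs[OF has_vector_derivative_mult[OF
          has_vector_derivative_iexp_scaled has_vector_derivative_of_real[OF hermite_wave_deriv]]])
      (simp add: algebra_simps)
  moreover have "isCont (\<lambda>x. ?D x) x" for x
    by (intro continuous_intros DERIV_isCont[OF hermite_wave_deriv])
  moreover have "((\<lambda>x. iexp (\<xi> * x) * of_real (hermite_wave n x)) \<longlongrightarrow> 0) at_infinity"
    using hermite_wave_at_infinity[of n, THEN tendsto_norm_zero]
    by (intro tendsto_norm_zero_cancel[of "\<lambda>x. iexp (\<xi> * x) * of_real (hermite_wave n x)"]) (simp add: norm_mult)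
  ultimately have "(\<integral>x. ?D x \<partial>lborel) = 0"
    using int intx by (intro integral_deriv_eq_0) (auto intro!: Bochner_Integration.integrable_add Bochner_Integration.integrable_diff integrable_mult_right)
  then have "\<i> * \<xi> * F n \<xi> + G - F (Suc n) \<xi> = 0"
    using int intx by (simp add: F_def G_def)
  then have "F (Suc n) \<xi> = \<i> * \<xi> * F n \<xi> + G" by (simp add: algebra_simps)
  also have "G = - \<i> * (\<i> * G)" by simp
  finally have "F (Suc n) \<xi> = \<i> * c * of_real (hermite_wave (Suc n) \<xi>)"
    unfolding G unfolding Fn by (simp add: algebra_simps)
  then show ?case by (simp add: F_def c_def mult_ac)
qed


lemma hermite_fun_measurable [measurable]: "hermite_fun n \<in> borel_measurable borel"
proof -
  have "hermite_fun n = (\<lambda>x. hermite_wave (n - 1) x / sqrt (2 ^ (n - 1) * fact (n - 1) * sqrt pi))"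
    by (simp add: fun_eq_iff hermite_fun_def hermite_wave_def mult.commute)
  then show ?thesis by simp
qed

lemma hermite_fun_integrable: "n \<ge> 1 \<Longrightarrow> integrable lborel (hermite_fun n)"
  using hermite_wave_integrable[of "n - 1"]
  by (cases n) (simp_all add: hermite_fun_wave[abs_def])

lemma hermite_fun_parity: "n \<ge> 1 \<Longrightarrow> hermite_fun n (- x) = (- 1) ^ (n - 1) * hermite_fun n x"
  by (cases n) (simp_all add: hermite_fun_wave hermite_wave_parity)

lemma hermite_fun_fourier:
  assumes "n \<ge> 1"
  shows "(\<integral>x. exp (- \<i> * of_real \<xi> * of_real x) * of_real (hermite_fun n x) \<partial>lborel)
     = of_real (sqrt (2 * pi)) * (- \<i>) ^ (n - 1) * of_real (hermite_fun n \<xi>)"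
proof (cases n)
  case (Suc k)
  have "(\<integral>x. exp (- \<i> * of_real \<xi> * of_real x) * of_real (hermite_fun n x) \<partial>lborel)
     = (\<integral>x. iexp (- \<xi> * x) * of_real (hermite_wave k x) / of_real (sqrt (2 ^ k * fact k * sqrt pi)) \<partial>lborel)"
    by (simp add: Suc hermite_fun_wave mult_ac)
  also have "\<dots> = of_real (sqrt (2 * pi)) * (- \<i>) ^ (n - 1) * of_real (hermite_fun n \<xi>)"
    by (simp only: integral_divide_zero hermite_wave_fourier)
      (simp add: Suc hermite_fun_wave hermite_wave_parity power_mult_distrib[symmetric])
  finally show ?thesis .
qed (use assms in simp)

section \<open>Completeness of the Hermite functions\<close>

text \<open>The positive and the negative part of \<open>g\<close> have the same mass (frequency 0) and the same Fourier
  transform. After division by this mass they are densities of two probability measures with the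
  same characteristic function, which agree by Levy's uniqueness theorem.\<close>

lemma fourier_injective:
  fixes g :: "real \<Rightarrow> real"
  assumes g: "integrable lborel g" and zero: "\<And>\<xi>. (\<integral>x. iexp (\<xi> * x) * of_real (g x) \<partial>lborel) = 0"
  shows "AE x in lborel. g x = 0"
proof -
  have [measurable]: "g \<in> borel_measurable borel" using g by auto
  define p q where "p x = max (g x) 0" and "q x = max (- g x) 0" for x
  have [measurable]: "p \<in> borel_measurable borel" "q \<in> borel_measurable borel"
    unfolding p_def[abs_def] q_def[abs_def] by measurable
  have gpq: "g x = p x - q x" for x by (simp add: p_def q_def)
  have int: "integrable lborel p" "integrable lborel q"
    using g unfolding p_def[abs_def] q_def[abs_def] by (auto intro!: integrable_max)
  have nonneg: "p x \<ge> 0" "q x \<ge> 0" for x by (simp_all add: p_def q_def)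
  define c where "c = (\<integral>x. p x \<partial>lborel)"
  have "(\<integral>x. complex_of_real (g x) \<partial>lborel) = 0" using zero[of 0] by simp
  then have "(\<integral>x. g x \<partial>lborel) = 0" by simp
  then have cq: "c = (\<integral>x. q x \<partial>lborel)"
    using int by (simp add: gpq c_def)
  have "c \<ge> 0" unfolding c_def by (intro Bochner_Integration.integral_nonneg) (rule nonneg)
  have "AE x in lborel. p x = q x"
  proof (cases "c = 0")
    case True
    then have "AE x in lborel. p x = 0" "AE x in lborel. q x = 0"
      using integral_nonneg_eq_0_iff_AE[OF int(1)] integral_nonneg_eq_0_iff_AE[OF int(2)] nonneg cq
      by (simp_all add: c_def)
    then show ?thesis by eventually_elim simp
  next
    case False
    then have c: "c > 0" using \<open>c \<ge> 0\<close> by simp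
    have dist: "real_distribution (density lborel (\<lambda>x. ennreal (f x / c)))"
      if "integrable lborel f" "\<And>x. f x \<ge> 0" "(\<integral>x. f x \<partial>lborel) = c" for f
    proof -
      have "(\<integral>\<^sup>+x. ennreal (f x / c) \<partial>lborel) = ennreal (\<integral>x. f x / c \<partial>lborel)"
        using that c by (intro nn_integral_eq_integral) auto
      also have "\<dots> = 1" using that c by simp
      finally have "emeasure (density lborel (\<lambda>x. ennreal (f x / c))) UNIV = 1"
        using that(1) by (subst emeasure_density) auto
      then show ?thesis
        by (intro real_distribution.intro prob_spaceI real_distribution_axioms.intro) auto
    qed
    have char_eq: "char (density lborel (\<lambda>x. ennreal (f x / c))) t
       = (\<integral>x. iexp (t * x) * of_real (f x) \<partial>lborel) / of_real c"
      if "integrable lborel f" "\<And>x. f x \<ge> 0" for f t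
    proof -
      have "char (density lborel (\<lambda>x. ennreal (f x / c))) t = (\<integral>x. (f x / c) *\<^sub>R iexp (t * x) \<partial>lborel)"
        unfolding char_def using that c by (subst integral_density) auto
      also have "\<dots> = (\<integral>x. iexp (t * x) * of_real (f x) / of_real c \<partial>lborel)"
        by (simp add: scaleR_conv_of_real mult_ac)
      finally show ?thesis by simp
    qed
    have "(\<integral>x. iexp (t * x) * of_real (p x) \<partial>lborel) = (\<integral>x. iexp (t * x) * of_real (q x) \<partial>lborel)" for t
    proof -
      have "0 = (\<integral>x. iexp (t * x) * of_real (p x) - iexp (t * x) * of_real (q x) \<partial>lborel)"
        using zero[of t] by (simp add: gpq right_diff_distrib)
      also have "\<dots> = (\<integral>x. iexp (t * x) * of_real (p x) \<partial>lborel) - (\<integral>x. iexp (t * x) * of_real (q x) \<partial>lborel)"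
        using fourier_integrable[OF int(1)] fourier_integrable[OF int(2)]
        by (rule Bochner_Integration.integral_diff)
      finally show ?thesis by simp
    qed
    then have "density lborel (\<lambda>x. ennreal (p x / c)) = density lborel (\<lambda>x. ennreal (q x / c))"
      by (intro Levy_uniqueness dist ext)
        (simp_all only: int nonneg cq[symmetric] c_def[symmetric] char_eq)
    then have "AE x in lborel. ennreal (p x / c) = ennreal (q x / c)"
      by (subst (asm) sigma_finite_measure.density_unique_iff[OF sigma_finite_lborel]) auto
    then show ?thesis
      by eventually_elim (use nonneg c in simp)
  qed
  then show ?thesis by eventually_elim (simp add: gpq)
qed

text \<open>The dominating function for the exponential series in the proof of totality: even after the growth
  \<open>e\<^sup>a\<^sup>|\<^sup>x\<^sup>|\<close> of that series, a Gaussian weight is square-integrable.\<close>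

lemma exp_abs_gauss_square_integrable:
  fixes a :: real
  shows "square_integrable lborel (\<lambda>x. exp (a * \<bar>x\<bar>) * exp (- (x\<^sup>2) / 2))"
proof -
  have gauss: "integrable lborel (\<lambda>x. exp (2 * b * x) * exp (- x\<^sup>2))" for b :: real
  proof -
    have "exp (2 * b * x) * exp (- x\<^sup>2) = sqrt pi * exp (b\<^sup>2) * normal_density b (1 / sqrt 2) x" for x
      by (simp add: normal_density_def power_divide exp_add[symmetric] power2_diff algebra_simps
          flip: exp_add)
    then show ?thesis by simp
  qed
  have "integrable lborel (\<lambda>x. (exp (a * \<bar>x\<bar>) * exp (- (x\<^sup>2) / 2))\<^sup>2)"
  proof (rule Bochner_Integration.integrable_bound[OF Bochner_Integration.integrable_add[OF gauss[of a] gauss[of "- a"]]])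
    show "AE x in lborel. norm ((exp (a * \<bar>x\<bar>) * exp (- (x\<^sup>2) / 2))\<^sup>2)
        \<le> norm (exp (2 * a * x) * exp (- x\<^sup>2) + exp (2 * - a * x) * exp (- x\<^sup>2))"
    proof (rule AE_I2)
      fix x :: real
      have "(exp (a * \<bar>x\<bar>) * exp (- (x\<^sup>2) / 2))\<^sup>2 = exp (2 * a * \<bar>x\<bar>) * exp (- x\<^sup>2)"
        by (simp add: power2_eq_square exp_add[symmetric])
      then show "norm ((exp (a * \<bar>x\<bar>) * exp (- (x\<^sup>2) / 2))\<^sup>2)
        \<le> norm (exp (2 * a * x) * exp (- x\<^sup>2) + exp (2 * - a * x) * exp (- x\<^sup>2))"
        by (cases "x \<ge> 0") auto
    qed
  qed measurable
  then show ?thesis by (simp add: square_integrable_real)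
qed

text \<open>If \<open>f\<close> is orthogonal to all Hermite functions, the three-term recursion shows that all moments of
  \<open>f(x) exp(- x\<^sup>2 / 2)\<close> vanish. Expanding the exponential under the integral, the Fourier transform
  of this function vanishes as well.\<close>

lemma hermite_wave_total:
  assumes f: "square_integrable lborel f" and zero: "\<And>n. (\<integral>x. f x * hermite_wave n x \<partial>lborel) = 0"
  shows "AE x in lborel. f x = 0"
proof -
  have [measurable]: "f \<in> borel_measurable borel" using f by (simp add: square_integrable_real)
  have int: "integrable lborel (\<lambda>x. f x * (x ^ k * hermite_wave n x))" for k n
    by (rule square_integrable_mult[OF f monom_hermite_square_integrable])
  have moments: "(\<integral>x. f x * (x ^ k * hermite_wave n x) \<partial>lborel) = 0" for k n
  proof (induction k arbitrary: n)
    case 0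
    show ?case using zero by simp
  next
    case (Suc k)
    show ?case
    proof (cases n)
      case 0
      have "f x * (x ^ Suc k * hermite_wave n x) = (1/2) * (f x * (x ^ k * hermite_wave (Suc 0) x))" for x
      proof -
        have "x * hermite_wave 0 x = (1/2) * hermite_wave (Suc 0) x"
          using hermite_wave_rec(1)[of x] by simp
        then have "f x * (x ^ k * (x * hermite_wave 0 x)) = f x * (x ^ k * ((1/2) * hermite_wave (Suc 0) x))"
          by simp
        then show ?thesis unfolding 0 by (simp add: mult_ac)
      qed
      then have "(\<integral>x. f x * (x ^ Suc k * hermite_wave n x) \<partial>lborel)
          = (\<integral>x. (1/2) * (f x * (x ^ k * hermite_wave (Suc 0) x)) \<partial>lborel)" by (simp only:)
      then show ?thesis using Suc.IH by (simp only: integral_mult_right_zero)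
    next
      case (Suc m)
      have "f x * (x ^ Suc k * hermite_wave n x) = (1/2) * (f x * (x ^ k * (2 * x * hermite_wave (Suc m) x)))" for x
        unfolding Suc by simp
      then have "f x * (x ^ Suc k * hermite_wave n x) = (1/2) * (f x * (x ^ k * hermite_wave (Suc (Suc m)) x))
          + real (Suc m) * (f x * (x ^ k * hermite_wave m x))" for x
        unfolding hermite_wave_rec(2) by (simp only:) (simp add: algebra_simps)
      then show ?thesis using Suc.IH int by (simp del: of_nat_Suc power_Suc)
    qed
  qed
  define g where "g x = f x * hermite_wave 0 x" for x
  have [measurable]: "g \<in> borel_measurable borel" by (simp add: g_def[abs_def])
  have "(\<integral>x. iexp (\<xi> * x) * of_real (g x) \<partial>lborel) = 0" for \<xi>
  proof -
    define s where "s N x = (\<Sum>k<N. (\<i> * of_real (\<xi> * x)) ^ k /\<^sub>R fact k) * complex_of_real (g x)" for N x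
    have s0: "(\<integral>x. s N x \<partial>lborel) = 0" for N
    proof -
      have "s N x = (\<Sum>k<N. ((\<i> * of_real \<xi>) ^ k /\<^sub>R fact k) * of_real (f x * (x ^ k * hermite_wave 0 x)))" for x
        unfolding s_def sum_distrib_right
        by (intro sum.cong refl) (simp add: g_def power_mult_distrib scaleR_conv_of_real mult_ac)
      then have "(\<integral>x. s N x \<partial>lborel)
          = (\<Sum>k<N. ((\<i> * of_real \<xi>) ^ k /\<^sub>R fact k) * of_real (\<integral>x. f x * (x ^ k * hermite_wave 0 x) \<partial>lborel))"
        using int[THEN integrable_of_real, where 'a = complex]
        by (simp del: of_real_mult add: integral_complex_of_real)
      then show ?thesis by (simp add: moments)
    qed
    have "(\<lambda>N. \<integral>x. s N x \<partial>lborel) \<longlonglongrightarrow> (\<integral>x. iexp (\<xi> * x) * of_real (g x) \<partial>lborel)"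
    \<comment> \<open>The partial sums of the exponential series are bounded by \<open>exp \<bar>\<xi> x\<bar>\<close>.\<close>
    proof (rule integral_dominated_convergence[where w = "\<lambda>x. \<bar>f x * (exp (\<bar>\<xi>\<bar> * \<bar>x\<bar>) * exp (- (x\<^sup>2) / 2))\<bar>"])
      show "integrable lborel (\<lambda>x. \<bar>f x * (exp (\<bar>\<xi>\<bar> * \<bar>x\<bar>) * exp (- (x\<^sup>2) / 2))\<bar>)"
        by (intro integrable_abs square_integrable_mult[OF f exp_abs_gauss_square_integrable])
      show "AE x in lborel. (\<lambda>N. s N x) \<longlonglongrightarrow> iexp (\<xi> * x) * of_real (g x)"
        unfolding s_def
        by (intro AE_I2 tendsto_mult tendsto_const exp_converges[unfolded sums_def])
      show "AE x in lborel. norm (s N x) \<le> \<bar>f x * (exp (\<bar>\<xi>\<bar> * \<bar>x\<bar>) * exp (- (x\<^sup>2) / 2))\<bar>" for N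
      proof (rule AE_I2)
        fix x :: real
        have "norm (\<Sum>k<N. (\<i> * complex_of_real (\<xi> * x)) ^ k /\<^sub>R fact k) \<le> (\<Sum>k<N. \<bar>\<xi> * x\<bar> ^ k /\<^sub>R fact k)"
          by (rule sum_norm_le) (simp add: norm_power norm_mult abs_mult divide_inverse mult.commute)
        also have "\<dots> \<le> exp \<bar>\<xi> * x\<bar>"
          unfolding exp_def by (intro sum_le_suminf summable_exp_generic) auto
        finally have "norm (\<Sum>k<N. (\<i> * complex_of_real (\<xi> * x)) ^ k /\<^sub>R fact k) * \<bar>g x\<bar> \<le> exp \<bar>\<xi> * x\<bar> * \<bar>g x\<bar>"
          by (intro mult_right_mono) auto
        then show "norm (s N x) \<le> \<bar>f x * (exp (\<bar>\<xi>\<bar> * \<bar>x\<bar>) * exp (- (x\<^sup>2) / 2))\<bar>"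
          by (simp add: s_def g_def hermite_wave_def norm_mult abs_mult mult_ac)
      qed
    qed (simp_all add: s_def[abs_def])
    then show ?thesis unfolding s0 by (simp add: LIMSEQ_const_iff)
  qed
  moreover have "integrable lborel g"
    using int[of 0 0] by (simp add: g_def[abs_def])
  ultimately have "AE x in lborel. g x = 0" by (intro fourier_injective)
  then show ?thesis by eventually_elim (simp add: g_def hermite_wave_def)
qed

theorem hermite_orthonormal_basis: "orthonormal_basis_L2 lborel hermite_fun"
proof (rule orthonormal_basis_L2I)
  define c where "c n = sqrt (2 ^ n * fact n * sqrt pi)" for n
  have c: "c n > 0" for n by (simp add: c_def)
  have H: "hermite_fun (Suc n) = (\<lambda>x. (1 / c n) * hermite_wave n x)" for n
    by (simp add: fun_eq_iff hermite_fun_wave c_def)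
  show "square_integrable lborel (hermite_fun n)" if n: "n \<ge> 1" for n
    using n by (cases n) (auto simp: H intro!: square_integrable_cmult hermite_wave_square_integrable simp del: times_divide_eq_left)
  show "(\<integral>x. hermite_fun m x * hermite_fun n x \<partial>lborel) = (if m = n then 1 else 0)"
    if mn: "m \<ge> 1" "n \<ge> 1" for m n
  proof -
    obtain i j where ij: "m = Suc i" "n = Suc j" using mn by (metis Suc_le_D One_nat_def)
    have "(\<integral>x. hermite_fun m x * hermite_fun n x \<partial>lborel)
       = (\<integral>x. (1 / (c i * c j)) * (hermite_wave i x * hermite_wave j x) \<partial>lborel)"
      by (simp add: ij H)
    also have "\<dots> = (1 / (c i * c j)) * (\<integral>x. hermite_wave i x * hermite_wave j x \<partial>lborel)"
      by (rule integral_mult_right_zero)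
    also have "\<dots> = (if m = n then 1 else 0)"
      using c[of i] by (simp add: hermite_wave_orthogonal ij c_def)
    finally show ?thesis .
  qed
  show "AE x in lborel. f x = 0"
    if f: "square_integrable lborel f" and z: "\<And>n. n \<ge> 1 \<Longrightarrow> (\<integral>x. f x * hermite_fun n x \<partial>lborel) = 0" for f
  proof (rule hermite_wave_total[OF f])
    fix n
    have "(\<integral>x. f x * hermite_wave n x \<partial>lborel) = (\<integral>x. c n * (f x * hermite_fun (Suc n) x) \<partial>lborel)"
      using c[of n] by (simp add: H)
    also have "\<dots> = c n * (\<integral>x. f x * hermite_fun (Suc n) x \<partial>lborel)"
      by (rule integral_mult_right_zero)
    finally show "(\<integral>x. f x * hermite_wave n x \<partial>lborel) = 0" using z[of "Suc n"] by simp
  qed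
qed

section \<open>Gaussian series\<close>

lemma exhausts_filterlim:
  assumes "exhausts F I"
  shows "filterlim F (finite_subsets_at_top I) sequentially"
proof -
  have F: "incseq F" "\<And>k. finite (F k)" "(\<Union>k. F k) = I"
    using assms by (auto simp: exhausts_def)
  have "\<exists>k. X \<subseteq> F k" if "finite X" "X \<subseteq> I" for X
    using that
  proof (induction X rule: finite_induct)
    case (insert x X)
    then obtain k l where "X \<subseteq> F k" "x \<in> F l" using F(3) by auto
    then have "insert x X \<subseteq> F (max k l)"
      using incseqD[OF F(1), of k "max k l"] incseqD[OF F(1), of l "max k l"] by auto
    then show ?case by blast
  qed auto
  then show ?thesis
    unfolding filterlim_finite_subsets_at_top eventually_sequentially
    using F(2,3) incseqD[OF F(1)] by (metis UN_upper UNIV_I order_trans)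
qed

lemma exhausts_union:
  assumes "exhausts F I" "exhausts G I"
  shows "exhausts (\<lambda>k. F k \<union> G k) I"
  using assms unfolding exhausts_def by (auto simp: incseq_def) blast+

lemma exhausts_sum_LIMSEQ:
  fixes f :: "'i \<Rightarrow> real"
  assumes "exhausts F I" "f summable_on I"
  shows "(\<lambda>k. sum f (F k)) \<longlonglongrightarrow> infsum f I"
  using filterlim_compose[OF has_sum_infsum[OF assms(2), unfolded has_sum_def] exhausts_filterlim[OF assms(1)]] .

text \<open>An independent family of standard Gaussian variables. In the application the index set \<open>I\<close> is the grid
  of pairs of positive integers.\<close>

locale gaussian_noise = prob_space M for M :: "'a measure" +
  fixes Z :: "'i \<Rightarrow> 'a \<Rightarrow> real" and I :: "'i set"
  assumes indep: "indep_vars (\<lambda>_. borel) Z I"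
    and normal: "\<And>i. i \<in> I \<Longrightarrow> distributed M lborel (Z i) std_normal_density"
begin

definition noise_sum :: "('i \<Rightarrow> real) \<Rightarrow> 'i set \<Rightarrow> 'a \<Rightarrow> real" where
  "noise_sum c A \<omega> = (\<Sum>i\<in>A. c i * Z i \<omega>)"

lemma Z_measurable: "i \<in> I \<Longrightarrow> Z i \<in> borel_measurable M"
  using indep by (simp add: indep_vars_def)

lemma Z_square_integrable: "i \<in> I \<Longrightarrow> square_integrable M (Z i)"
  using distributed_integrable[OF normal, of i "\<lambda>x. x\<^sup>2"] integrable_std_normal_moment[of 2]
  by (simp add: square_integrable_real Z_measurable)

lemma Z_mean: "i \<in> I \<Longrightarrow> expectation (Z i) = 0"
  by (rule standard_normal_distributed_expectation[OF normal])

lemma Z_variance: "i \<in> I \<Longrightarrow> expectation (\<lambda>\<omega>. (Z i \<omega>)\<^sup>2) = 1"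
  using standard_normal_distributed_variance[OF normal, of i] Z_mean[of i] by simp

lemma square_integrable_one: "square_integrable M (\<lambda>_. 1 :: real)"
  by (simp add: square_integrable_real)

lemma square_integrable_integrable:
  fixes f :: "'a \<Rightarrow> real"
  shows "square_integrable M f \<Longrightarrow> integrable M f"
  using square_integrable_mult[OF _ square_integrable_one, of f] by simp

lemma noise_sum_square_integrable: "A \<subseteq> I \<Longrightarrow> square_integrable M (noise_sum c A)"
  unfolding noise_sum_def[abs_def]
  by (intro square_integrable_sum square_integrable_cmult Z_square_integrable) auto

lemma noise_sum_measurable: "A \<subseteq> I \<Longrightarrow> noise_sum c A \<in> borel_measurable M"
  using noise_sum_square_integrable[of A c] by (simp add: square_integrable_real)

lemma noise_sum_mean: "A \<subseteq> I \<Longrightarrow> expectation (noise_sum c A) = 0"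
  unfolding noise_sum_def[abs_def]
  using Z_mean square_integrable_integrable[OF Z_square_integrable]
  by (subst Bochner_Integration.integral_sum) (auto intro!: sum.neutral simp: subset_iff)

text \<open>Independence of the two blocks factorizes the expectation, and the second factor is centred.\<close>

lemma indep_blocks:
  fixes g :: "('i \<Rightarrow> real) \<Rightarrow> real"
  assumes AB: "A \<inter> B = {}" "A \<subseteq> I" "B \<subseteq> I" "finite B"
    and g: "g \<in> borel_measurable (PiM A (\<lambda>_. borel))"
    and int: "integrable M (\<lambda>\<omega>. g (\<lambda>i\<in>A. Z i \<omega>))"
  shows "expectation (\<lambda>\<omega>. g (\<lambda>i\<in>A. Z i \<omega>) * noise_sum c B \<omega>) = 0"
proof -
  have "indep_var borel (g \<circ> (\<lambda>\<omega>. \<lambda>i\<in>A. Z i \<omega>))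
      borel ((\<lambda>f. \<Sum>i\<in>B. c i * f i) \<circ> (\<lambda>\<omega>. \<lambda>i\<in>B. Z i \<omega>))"
    by (rule indep_var_compose[OF indep_var_restrict[OF indep AB(1-3)] g]) measurable
  moreover have "((\<lambda>f. \<Sum>i\<in>B. c i * f i) \<circ> (\<lambda>\<omega>. \<lambda>i\<in>B. Z i \<omega>)) = noise_sum c B"
    by (auto simp: noise_sum_def fun_eq_iff)
  ultimately have "indep_var borel (\<lambda>\<omega>. g (\<lambda>i\<in>A. Z i \<omega>)) borel (noise_sum c B)"
    by (simp add: comp_def)
  from indep_var_lebesgue_integral[OF this int square_integrable_integrable[OF noise_sum_square_integrable[OF AB(3)]]]
  show ?thesis by (simp add: noise_sum_mean[OF AB(3)])
qed

lemma noise_sum_variance: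
  assumes "finite A" "A \<subseteq> I"
  shows "expectation (\<lambda>\<omega>. (noise_sum c A \<omega>)\<^sup>2) = (\<Sum>i\<in>A. (c i)\<^sup>2)"
  using assms
proof (induction A rule: finite_induct)
  case empty
  show ?case by (simp add: noise_sum_def)
next
  case (insert i A)
  then have sub: "i \<in> I" "A \<subseteq> I" by auto
  have zero: "expectation (\<lambda>\<omega>. Z i \<omega> * noise_sum c A \<omega>) = 0"
    using indep_blocks[of "{i}" A "\<lambda>f. f i" c] insert sub
      square_integrable_integrable[OF Z_square_integrable[of i]] by simp
  have eq: "(noise_sum c (insert i A) \<omega>)\<^sup>2 = (c i)\<^sup>2 * (Z i \<omega>)\<^sup>2 + (noise_sum c A \<omega>)\<^sup>2 + 2 * c i * (Z i \<omega> * noise_sum c A \<omega>)" for \<omega>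
    using insert by (simp add: noise_sum_def power2_sum power_mult_distrib)
  have "expectation (\<lambda>\<omega>. (noise_sum c (insert i A) \<omega>)\<^sup>2)
      = (c i)\<^sup>2 * expectation (\<lambda>\<omega>. (Z i \<omega>)\<^sup>2) + expectation (\<lambda>\<omega>. (noise_sum c A \<omega>)\<^sup>2)
        + 2 * c i * expectation (\<lambda>\<omega>. Z i \<omega> * noise_sum c A \<omega>)"
    unfolding eq
    using Z_square_integrable[OF sub(1)] noise_sum_square_integrable[OF sub(2), of c]
      square_integrable_mult[OF Z_square_integrable[OF sub(1)] noise_sum_square_integrable[OF sub(2), of c]]
    by (simp add: square_integrable_real)
  then show ?case using insert sub zero Z_variance by simp
qed

lemma noise_sum_diff:
  assumes "A \<subseteq> B" "finite B"
  shows "noise_sum c B \<omega> - noise_sum c A \<omega> = noise_sum c (B - A) \<omega>"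
  unfolding noise_sum_def using assms by (simp add: sum_diff)

lemma noise_sum_diff_variance:
  assumes "A \<subseteq> B" "finite B" "B \<subseteq> I"
  shows "expectation (\<lambda>\<omega>. (noise_sum c B \<omega> - noise_sum c A \<omega>)\<^sup>2) = (\<Sum>i\<in>B. (c i)\<^sup>2) - (\<Sum>i\<in>A. (c i)\<^sup>2)"
  unfolding noise_sum_diff[OF assms(1,2)]
  using assms by (subst noise_sum_variance) (auto intro: sum_diff)

text \<open>Kolmogorov's inequality, for sums that may grow by whole blocks of terms. Decompose the event by the
  first index \<open>k\<close> at which the level is exceeded. On this event the increment after \<open>k\<close> is uncorrelated
  with the past, so the second moment of the final sum dominates that of the \<open>k\<close>-th sum.\<close>

lemma maximal_inequality:
  fixes G :: "nat \<Rightarrow> 'i set"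
  assumes G: "incseq G" "\<And>k. finite (G k)" "\<And>k. G k \<subseteq> I" and l: "l > 0"
  shows "l\<^sup>2 * prob {\<omega> \<in> space M. \<exists>k\<le>n. l \<le> \<bar>noise_sum c (G k) \<omega>\<bar>} \<le> (\<Sum>i\<in>G n. (c i)\<^sup>2)"
proof -
  have [measurable]: "noise_sum c (G k) \<in> borel_measurable M" for k
    by (rule noise_sum_measurable[OF G(3)])
  define S where "S k = noise_sum c (G k)" for k
  have [measurable]: "S k \<in> borel_measurable M" for k by (simp add: S_def)
  have Sq: "square_integrable M (S k)" for k unfolding S_def by (rule noise_sum_square_integrable[OF G(3)])
  define A where "A k = {\<omega> \<in> space M. l \<le> \<bar>S k \<omega>\<bar> \<and> (\<forall>j<k. \<bar>S j \<omega>\<bar> < l)}" for k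
  have [measurable]: "A k \<in> sets M" for k unfolding A_def by measurable
  have disj: "disjoint_family_on A {..n}"
    unfolding disjoint_family_on_def A_def by (auto, metis linorder_neqE_nat not_less)
  have union: "{\<omega> \<in> space M. \<exists>k\<le>n. l \<le> \<bar>noise_sum c (G k) \<omega>\<bar>} = (\<Union>k\<in>{..n}. A k)"
  proof (intro equalityI subsetI)
    fix \<omega> assume "\<omega> \<in> {\<omega> \<in> space M. \<exists>k\<le>n. l \<le> \<bar>noise_sum c (G k) \<omega>\<bar>}"
    then obtain k where k: "\<omega> \<in> space M" "k \<le> n" "l \<le> \<bar>S k \<omega>\<bar>" by (auto simp: S_def)
    define m where "m = (LEAST k. l \<le> \<bar>S k \<omega>\<bar>)"
    have "l \<le> \<bar>S m \<omega>\<bar>" unfolding m_def by (rule LeastI[of "\<lambda>k. l \<le> \<bar>S k \<omega>\<bar>" k, OF k(3)])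
    moreover have "\<bar>S j \<omega>\<bar> < l" if "j < m" for j
      using not_less_Least[of j "\<lambda>k. l \<le> \<bar>S k \<omega>\<bar>"] that by (simp add: m_def not_le)
    moreover have "m \<le> n" using Least_le[of "\<lambda>k. l \<le> \<bar>S k \<omega>\<bar>", OF k(3)] k(2) by (simp add: m_def)
    ultimately show "\<omega> \<in> (\<Union>k\<in>{..n}. A k)" using k(1) by (auto simp: A_def)
  qed (auto simp: A_def S_def)
  have ind: "integrable M (\<lambda>\<omega>. f \<omega> * indicator (A k) \<omega>)" if "integrable M f" for f :: "'a \<Rightarrow> real" and k
    using integrable_mult_indicator[OF _ that, of "A k"] by (simp add: mult.commute)
  have step: "l\<^sup>2 * prob (A k) \<le> expectation (\<lambda>\<omega>. (S n \<omega>)\<^sup>2 * indicator (A k) \<omega>)" if k: "k \<le> n" for k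
  proof -
    have GG: "G j \<subseteq> G k" if "j \<le> k" for j using incseqD[OF G(1) that] .
    \<comment> \<open>The stopped sum as a function of the variables in \<open>G k\<close> alone, which makes it independent of the later increment.\<close>
    define g :: "('i \<Rightarrow> real) \<Rightarrow> real" where "g f = (\<Sum>i\<in>G k. c i * f i) *
       (if l \<le> \<bar>\<Sum>i\<in>G k. c i * f i\<bar> \<and> (\<forall>j\<in>{..<k}. \<bar>\<Sum>i\<in>G j. c i * f i\<bar> < l) then 1 else 0)" for f
    have [measurable]: "(\<lambda>f. \<Sum>i\<in>G j. c i * f i) \<in> borel_measurable (PiM (G k) (\<lambda>_. borel))" if "j \<le> k" for j
    proof (rule borel_measurable_sum)
      fix i assume "i \<in> G j"
      then have "i \<in> G k" using GG[OF that] by blast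
      then show "(\<lambda>f. c i * f i) \<in> borel_measurable (PiM (G k) (\<lambda>_. borel))" by measurable
    qed
    have g: "g \<in> borel_measurable (PiM (G k) (\<lambda>_. borel))"
      unfolding g_def[abs_def] by measurable
    have gS: "g (\<lambda>i\<in>G k. Z i \<omega>) = S k \<omega> * indicator (A k) \<omega>" if "\<omega> \<in> space M" for \<omega>
    proof -
      have eq: "(\<Sum>i\<in>G j. c i * (\<lambda>i\<in>G k. Z i \<omega>) i) = S j \<omega>" if "j \<le> k" for j
        unfolding S_def noise_sum_def using GG[OF that] by (intro sum.cong) auto
      have "g (\<lambda>i\<in>G k. Z i \<omega>) = S k \<omega> *
          (if l \<le> \<bar>S k \<omega>\<bar> \<and> (\<forall>j\<in>{..<k}. \<bar>S j \<omega>\<bar> < l) then 1 else 0)"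
      proof -
        have "(\<forall>j\<in>{..<k}. \<bar>\<Sum>i\<in>G j. c i * (\<lambda>i\<in>G k. Z i \<omega>) i\<bar> < l) \<longleftrightarrow> (\<forall>j\<in>{..<k}. \<bar>S j \<omega>\<bar> < l)"
          by (intro ball_cong refl) (simp add: eq del: restrict_apply)
        then show ?thesis unfolding g_def eq[OF order_refl] by simp
      qed
      then show ?thesis using that by (auto simp: A_def indicator_def)
    qed
    have gi: "integrable M (\<lambda>\<omega>. g (\<lambda>i\<in>G k. Z i \<omega>))"
      using ind[OF square_integrable_integrable[OF Sq[of k]]]
      by (simp add: gS cong: Bochner_Integration.integrable_cong)
    have "expectation (\<lambda>\<omega>. g (\<lambda>i\<in>G k. Z i \<omega>) * noise_sum c (G n - G k) \<omega>) = 0"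
      by (rule indep_blocks[OF _ _ _ _ g gi]) (use G in auto)
    also have "expectation (\<lambda>\<omega>. g (\<lambda>i\<in>G k. Z i \<omega>) * noise_sum c (G n - G k) \<omega>)
        = expectation (\<lambda>\<omega>. (S k \<omega> * (S n \<omega> - S k \<omega>)) * indicator (A k) \<omega>)"
      using noise_sum_diff[OF incseqD[OF G(1) k] G(2), of c]
      by (intro Bochner_Integration.integral_cong refl) (simp add: gS S_def)
    finally have cross: "expectation (\<lambda>\<omega>. (S k \<omega> * (S n \<omega> - S k \<omega>)) * indicator (A k) \<omega>) = 0" .
    have int1: "integrable M (\<lambda>\<omega>. (S k \<omega>)\<^sup>2 * indicator (A k) \<omega>)"
      using ind Sq by (simp add: square_integrable_real)
    have int2: "integrable M (\<lambda>\<omega>. (S k \<omega> * (S n \<omega> - S k \<omega>)) * indicator (A k) \<omega>)"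
      by (intro ind square_integrable_mult square_integrable_diff Sq)
    have "l\<^sup>2 * prob (A k) = expectation (\<lambda>\<omega>. l\<^sup>2 * indicator (A k) \<omega>)" by simp
    also have "\<dots> \<le> expectation (\<lambda>\<omega>. (S k \<omega>)\<^sup>2 * indicator (A k) \<omega>)"
    proof (rule integral_mono[OF _ int1])
      fix \<omega>
      show "l\<^sup>2 * indicator (A k) \<omega> \<le> (S k \<omega>)\<^sup>2 * indicator (A k) \<omega>"
        using l power_mono[of l "\<bar>S k \<omega>\<bar>" 2] by (auto simp: A_def indicator_def)
    qed (rule ind, simp)
    also have "\<dots> = expectation (\<lambda>\<omega>. (S k \<omega>)\<^sup>2 * indicator (A k) \<omega> + 2 * ((S k \<omega> * (S n \<omega> - S k \<omega>)) * indicator (A k) \<omega>))"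
      using int1 int2 cross by simp
    also have "\<dots> \<le> expectation (\<lambda>\<omega>. (S n \<omega>)\<^sup>2 * indicator (A k) \<omega>)"
    proof (rule integral_mono)
      fix \<omega>
      have "(S k \<omega>)\<^sup>2 + 2 * (S k \<omega> * (S n \<omega> - S k \<omega>)) \<le> (S n \<omega>)\<^sup>2"
        using zero_le_power2[of "S n \<omega> - S k \<omega>"] by (simp add: power2_eq_square algebra_simps)
      then show "(S k \<omega>)\<^sup>2 * indicator (A k) \<omega> + 2 * ((S k \<omega> * (S n \<omega> - S k \<omega>)) * indicator (A k) \<omega>)
          \<le> (S n \<omega>)\<^sup>2 * indicator (A k) \<omega>" by (auto simp: indicator_def)
    qed (use int1 int2 ind Sq in \<open>auto simp: square_integrable_real\<close>)
    finally show ?thesis .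
  qed
  have Sn: "integrable M (\<lambda>\<omega>. (S n \<omega>)\<^sup>2)" using Sq by (simp add: square_integrable_real)
  have "l\<^sup>2 * prob {\<omega> \<in> space M. \<exists>k\<le>n. l \<le> \<bar>noise_sum c (G k) \<omega>\<bar>} = (\<Sum>k\<le>n. l\<^sup>2 * prob (A k))"
    unfolding union using disj
    by (subst finite_measure_finite_Union) (auto simp: sum_distrib_left)
  also have "\<dots> \<le> (\<Sum>k\<le>n. expectation (\<lambda>\<omega>. (S n \<omega>)\<^sup>2 * indicator (A k) \<omega>))"
    using step by (intro sum_mono) auto
  also have "\<dots> = expectation (\<lambda>\<omega>. (\<Sum>k\<le>n. (S n \<omega>)\<^sup>2 * indicator (A k) \<omega>))"
    by (rule Bochner_Integration.integral_sum[symmetric]) (rule ind[OF Sn])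
  also have "\<dots> \<le> expectation (\<lambda>\<omega>. (S n \<omega>)\<^sup>2)"
  proof (rule integral_mono)
    fix \<omega>
    have "(\<Sum>k\<le>n. (S n \<omega>)\<^sup>2 * indicator (A k) \<omega>) = (S n \<omega>)\<^sup>2 * (\<Sum>k\<le>n. indicator (A k) \<omega>)"
      by (simp add: sum_distrib_left)
    also have "(\<Sum>k\<le>n. indicator (A k) \<omega>) = (indicator (\<Union>k\<in>{..n}. A k) \<omega> :: real)"
      by (rule indicator_UN_disjoint[symmetric]) (auto simp: disj)
    also have "(S n \<omega>)\<^sup>2 * \<dots> \<le> (S n \<omega>)\<^sup>2" by (simp add: indicator_def)
    finally show "(\<Sum>k\<le>n. (S n \<omega>)\<^sup>2 * indicator (A k) \<omega>) \<le> (S n \<omega>)\<^sup>2" .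
  qed (intro Bochner_Integration.integrable_sum ind Sn)+
  also have "\<dots> = (\<Sum>i\<in>G n. (c i)\<^sup>2)" unfolding S_def by (rule noise_sum_variance[OF G(2,3)])
  finally show ?thesis .
qed

text \<open>The variances of the increments after stage \<open>m\<close> are bounded by the tail of a convergent
  series. By the maximal inequality, the probability that these increments ever exceed a given level
  tends to 0 with \<open>m\<close>, so almost surely the sums form a Cauchy sequence.\<close>

lemma AE_convergent_noise_sum:
  assumes F: "exhausts F I" and c: "(\<lambda>i. (c i)\<^sup>2) summable_on I"
  shows "AE \<omega> in M. convergent (\<lambda>k. noise_sum c (F k) \<omega>)"
proof -
  have F': "incseq F" "\<And>k. finite (F k)" "\<And>k. F k \<subseteq> I" using F by (auto simp: exhausts_def)
  define V where "V k = (\<Sum>i\<in>F k. (c i)\<^sup>2)" for k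
  define v where "v = infsum (\<lambda>i. (c i)\<^sup>2) I"
  have V: "V \<longlonglongrightarrow> v"
    unfolding V_def v_def by (rule exhausts_sum_LIMSEQ[OF F c])
  have Vinc: "incseq V" unfolding V_def
    by (intro monoI sum_mono2) (use F' in \<open>auto dest: incseqD\<close>)
  have Vv: "V k \<le> v" for k by (rule incseq_le[OF Vinc V])
  have [measurable]: "noise_sum c (F k) \<in> borel_measurable M" for k
    by (rule noise_sum_measurable[OF F'(3)])
  have small: "AE \<omega> in M. \<exists>m. \<forall>k. \<bar>noise_sum c (F (m + k)) \<omega> - noise_sum c (F m) \<omega>\<bar> < l" if l: "l > 0" for l
  proof -
    define D where "D m n = {\<omega> \<in> space M. \<exists>k\<le>n. l \<le> \<bar>noise_sum c (F (m + k) - F m) \<omega>\<bar>}" for m n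
    define E where "E m = (\<Union>n. D m n)" for m
    have [measurable]: "noise_sum c (F (m + k) - F m) \<in> borel_measurable M" for m k
      by (rule noise_sum_measurable) (use F'(3) in blast)
    have D_sets [measurable]: "D m n \<in> sets M" for m n unfolding D_def by measurable
    have E_sets [measurable]: "E m \<in> sets M" for m unfolding E_def by measurable
    have "prob (D m n) \<le> (v - V m) / l\<^sup>2" for m n
    proof -
      have mono: "F m \<subseteq> F (m + n)" by (rule incseqD[OF F'(1)]) simp
      have "l\<^sup>2 * prob (D m n) \<le> (\<Sum>i\<in>F (m + n) - F m. (c i)\<^sup>2)"
        unfolding D_def
      proof (rule maximal_inequality[where G = "\<lambda>k. F (m + k) - F m", OF _ _ _ l])
        show "incseq (\<lambda>k. F (m + k) - F m)"
          by (intro monoI Diff_mono incseqD[OF F'(1)]) auto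
      qed (use F' in auto)
      also have "\<dots> = V (m + n) - V m" unfolding V_def by (rule sum_diff[OF F'(2) mono])
      also have "\<dots> \<le> v - V m" using Vv[of "m + n"] by simp
      finally show ?thesis using l by (simp add: field_simps)
    qed
    moreover have "(\<lambda>n. prob (D m n)) \<longlonglongrightarrow> prob (E m)" for m
      unfolding E_def
      by (rule finite_Lim_measure_incseq) (auto simp: D_def incseq_def intro: order_trans D_sets)
    ultimately have Em: "prob (E m) \<le> (v - V m) / l\<^sup>2" for m
      by (intro LIMSEQ_le_const2[of "\<lambda>n. prob (D m n)"]) auto
    have "prob (\<Inter>m. E m) \<le> (v - V m) / l\<^sup>2" for m
      by (rule order_trans[OF finite_measure_mono Em[of m]]) auto
    moreover have "(\<lambda>m. (v - V m) / l\<^sup>2) \<longlonglongrightarrow> (v - v) / l\<^sup>2"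
      using l by (intro tendsto_intros V) auto
    ultimately have "prob (\<Inter>m. E m) \<le> 0"
      using LIMSEQ_le_const[of "\<lambda>m. (v - V m) / l\<^sup>2" "(v - v) / l\<^sup>2" "prob (\<Inter>m. E m)"] by auto
    then have "prob (\<Inter>m. E m) = 0" by (simp add: antisym)
    then have "AE \<omega> in M. \<omega> \<notin> (\<Inter>m. E m)" by (subst (asm) prob_eq_0) auto
    with AE_space show ?thesis
    proof eventually_elim
      case (elim \<omega>)
      then obtain m where m: "\<omega> \<notin> E m" by auto
      have "\<bar>noise_sum c (F (m + k)) \<omega> - noise_sum c (F m) \<omega>\<bar> < l" for k
        using m elim(1) noise_sum_diff[OF incseqD[OF F'(1), of m "m + k"] F'(2), of c \<omega>]
        by (auto simp: E_def D_def not_le)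
      then show ?case by blast
    qed
  qed
  have "AE \<omega> in M. \<forall>r::nat. \<exists>m. \<forall>k. \<bar>noise_sum c (F (m + k)) \<omega> - noise_sum c (F m) \<omega>\<bar> < 1 / real (Suc r)"
    by (subst AE_all_countable) (auto intro: small)
  then show ?thesis
  proof eventually_elim
    case (elim \<omega>)
    have "Cauchy (\<lambda>k. noise_sum c (F k) \<omega>)"
    proof (rule metric_CauchyI)
      fix e :: real assume e: "e > 0"
      then obtain r where r: "1 / real (Suc r) < e / 2" by (metis half_gt_zero nat_approx_posE)
      from elim obtain m where m: "\<And>k. \<bar>noise_sum c (F (m + k)) \<omega> - noise_sum c (F m) \<omega>\<bar> < 1 / real (Suc r)" by blast
      have "dist (noise_sum c (F i) \<omega>) (noise_sum c (F j) \<omega>) < e" if "i \<ge> m" "j \<ge> m" for i j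
        using m[of "i - m"] m[of "j - m"] r that by (simp add: dist_real_def)
      then show "\<exists>M. \<forall>m\<ge>M. \<forall>n\<ge>M. dist (noise_sum c (F m) \<omega>) (noise_sum c (F n) \<omega>) < e" by blast
    qed
    then show ?case by (simp add: Cauchy_convergent_iff)
  qed
qed

text \<open>The limit does not depend on the exhaustion: two exhaustions are compared through their union, which
  is again one, and whose distance in mean square to either of them is a difference of partial sums of
  \<open>\<Sum> c\<^sub>i\<^sup>2\<close>.\<close>

theorem gaussian_series_converges:
  assumes F0: "exhausts F0 I" and c: "(\<lambda>i. (c i)\<^sup>2) summable_on I"
  shows "\<exists>X. square_integrable M X \<and> expectation (\<lambda>\<omega>. (X \<omega>)\<^sup>2) = infsum (\<lambda>i. (c i)\<^sup>2) I \<and>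
    (\<forall>F. exhausts F I \<longrightarrow>
       (\<lambda>k. expectation (\<lambda>\<omega>. (noise_sum c (F k) \<omega> - X \<omega>)\<^sup>2)) \<longlonglongrightarrow> 0 \<and>
       (AE \<omega> in M. (\<lambda>k. noise_sum c (F k) \<omega>) \<longlonglongrightarrow> X \<omega>))"
proof -
  define V where "V F k = (\<Sum>i\<in>F k. (c i)\<^sup>2)" for F :: "nat \<Rightarrow> 'i set" and k
  have V: "V F \<longlonglongrightarrow> infsum (\<lambda>i. (c i)\<^sup>2) I" if "exhausts F I" for F
    unfolding V_def by (rule exhausts_sum_LIMSEQ[OF that c])
  have ex: "incseq F" "\<And>k. finite (F k)" "\<And>k. F k \<subseteq> I" if "exhausts F I" for F
    using that by (auto simp: exhausts_def)
  have sq: "square_integrable M (noise_sum c (F k))" if "exhausts F I" for F k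
    by (rule noise_sum_square_integrable[OF ex(3)[OF that]])
  have mono: "expectation (\<lambda>\<omega>. (noise_sum c (F0 j) \<omega> - noise_sum c (F0 k) \<omega>)\<^sup>2) = \<bar>V F0 j - V F0 k\<bar>" for j k
  proof -
    have *: "expectation (\<lambda>\<omega>. (noise_sum c (F0 j) \<omega> - noise_sum c (F0 i) \<omega>)\<^sup>2) = \<bar>V F0 j - V F0 i\<bar>" if "i \<le> j" for i j
    proof -
      have F: "F0 i \<subseteq> F0 j" by (rule incseqD[OF ex(1)[OF F0] that])
      have "V F0 i \<le> V F0 j"
        unfolding V_def by (rule sum_mono2) (use F ex(2)[OF F0] in auto)
      then show ?thesis
        using noise_sum_diff_variance[OF F ex(2)[OF F0] ex(3)[OF F0], of c] by (simp add: V_def)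
    qed
    show ?thesis
      using *[of j k] *[of k j] by (cases "j \<le> k") (auto simp: power2_commute abs_minus_commute)
  qed
  have "Cauchy (V F0)" using V[OF F0] by (rule LIMSEQ_imp_Cauchy)
  then have "\<exists>K. \<forall>j\<ge>K. \<forall>k\<ge>K. expectation (\<lambda>\<omega>. (noise_sum c (F0 j) \<omega> - noise_sum c (F0 k) \<omega>)\<^sup>2) < e" if "e > 0" for e
    using CauchyD[of "V F0", OF _ that] unfolding mono by simp
  from Riesz_Fischer[OF sq[OF F0] this] obtain X where X: "square_integrable M X"
    and lim0: "(\<lambda>k. expectation (\<lambda>\<omega>. (noise_sum c (F0 k) \<omega> - X \<omega>)\<^sup>2)) \<longlonglongrightarrow> 0" by blast
  have "(\<lambda>k. expectation (\<lambda>\<omega>. (noise_sum c (F0 k) \<omega>)\<^sup>2)) \<longlonglongrightarrow> expectation (\<lambda>\<omega>. (X \<omega>)\<^sup>2)"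
    by (rule L2_limit_norm[OF sq[OF F0] X lim0])
  then have "V F0 \<longlonglongrightarrow> expectation (\<lambda>\<omega>. (X \<omega>)\<^sup>2)"
    using noise_sum_variance[OF ex(2)[OF F0] ex(3)[OF F0], of c] by (simp add: V_def[abs_def])
  then have var: "expectation (\<lambda>\<omega>. (X \<omega>)\<^sup>2) = infsum (\<lambda>i. (c i)\<^sup>2) I"
    using V[OF F0] by (rule LIMSEQ_unique)
  have lim: "(\<lambda>k. expectation (\<lambda>\<omega>. (noise_sum c (F k) \<omega> - X \<omega>)\<^sup>2)) \<longlonglongrightarrow> 0" if F: "exhausts F I" for F
  proof -
    define H where "H k = F k \<union> F0 k" for k
    have H: "exhausts H I" unfolding H_def by (rule exhausts_union[OF F F0])
    have le: "expectation (\<lambda>\<omega>. (noise_sum c (F k) \<omega> - X \<omega>)\<^sup>2)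
       \<le> 4 * (V H k - V F k) + (4 * (V H k - V F0 k) + 2 * expectation (\<lambda>\<omega>. (noise_sum c (F0 k) \<omega> - X \<omega>)\<^sup>2))" for k
    proof -
      have d1: "expectation (\<lambda>\<omega>. (noise_sum c (H k) \<omega> - noise_sum c (F k) \<omega>)\<^sup>2) = V H k - V F k"
        unfolding V_def by (rule noise_sum_diff_variance) (use ex(2,3)[OF H] in \<open>auto simp: H_def\<close>)
      have d2: "expectation (\<lambda>\<omega>. (noise_sum c (H k) \<omega> - noise_sum c (F0 k) \<omega>)\<^sup>2) = V H k - V F0 k"
        unfolding V_def by (rule noise_sum_diff_variance) (use ex(2,3)[OF H] in \<open>auto simp: H_def\<close>)
      note sqd = square_integrable_diff[OF sq[OF F, of k] sq[OF H, of k]]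
        square_integrable_diff[OF sq[OF H, of k] sq[OF F0, of k]]
        square_integrable_diff[OF sq[OF F0, of k] X]
      have "expectation (\<lambda>\<omega>. (noise_sum c (F k) \<omega> - noise_sum c (F0 k) \<omega>)\<^sup>2) \<le> 2 * (V H k - V F k) + 2 * (V H k - V F0 k)"
        using square_integral_sum_le[OF sqd(1,2)] d1 d2 by (simp add: power2_commute)
      moreover have "expectation (\<lambda>\<omega>. (noise_sum c (F k) \<omega> - X \<omega>)\<^sup>2)
        \<le> 2 * expectation (\<lambda>\<omega>. (noise_sum c (F k) \<omega> - noise_sum c (F0 k) \<omega>)\<^sup>2) + 2 * expectation (\<lambda>\<omega>. (noise_sum c (F0 k) \<omega> - X \<omega>)\<^sup>2)"
        using square_integral_sum_le[OF square_integrable_diff[OF sq[OF F, of k] sq[OF F0, of k]] sqd(3)] by simp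
      ultimately show ?thesis by simp
    qed
    have lim': "(\<lambda>k. 4 * (V H k - V F k) + (4 * (V H k - V F0 k) + 2 * expectation (\<lambda>\<omega>. (noise_sum c (F0 k) \<omega> - X \<omega>)\<^sup>2))) \<longlonglongrightarrow> 0"
      using V[OF H] V[OF F] V[OF F0] lim0 by (auto intro!: tendsto_eq_intros)
    show ?thesis
      by (rule tendsto_sandwich[OF always_eventually always_eventually tendsto_const lim'])
        (rule allI, simp, rule allI, rule le)
  qed
  have ae: "AE \<omega> in M. (\<lambda>k. noise_sum c (F k) \<omega>) \<longlonglongrightarrow> X \<omega>" if F: "exhausts F I" for F
    by (rule L2_limit_AE_limit[OF sq[OF F] X lim[OF F] AE_convergent_noise_sum[OF F c]])
  from X var lim ae show ?thesis by blast
qed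

lemma char_noise_sum:
  assumes "finite A" "A \<subseteq> I"
  shows "char (distr M borel (noise_sum c A)) t = of_real (exp (- (t\<^sup>2) * (\<Sum>i\<in>A. (c i)\<^sup>2) / 2))"
proof -
  have std: "distr M borel (Z i) = std_normal_distribution" if "i \<in> I" for i
    using normal[OF that] by (simp add: distributed_def cong: distr_cong)
  have one: "char (distr M borel (\<lambda>\<omega>. c i * Z i \<omega>)) t = of_real (exp (- (t\<^sup>2) * (c i)\<^sup>2 / 2))" if i: "i \<in> I" for i
  proof -
    have [measurable]: "Z i \<in> borel_measurable M" by (rule Z_measurable[OF i])
    have "char (distr M borel (\<lambda>\<omega>. c i * Z i \<omega>)) t = char (distr M borel (Z i)) (c i * t)"
      unfolding char_def by (simp add: integral_distr mult_ac)
    also have "\<dots> = of_real (exp (- (t\<^sup>2) * (c i)\<^sup>2 / 2))"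
      unfolding std[OF i] by (simp add: char_std_normal_distribution power_mult_distrib mult.commute)
    finally show ?thesis .
  qed
  have "char (distr M borel (noise_sum c A)) t = (\<Prod>i\<in>A. char (distr M borel (\<lambda>\<omega>. c i * Z i \<omega>)) t)"
    unfolding noise_sum_def[abs_def]
    by (rule char_distr_sum, rule indep_vars_compose2[OF indep_vars_subset[OF indep assms(2)]]) simp
  also have "\<dots> = (\<Prod>i\<in>A. complex_of_real (exp (- (t\<^sup>2) * (c i)\<^sup>2 / 2)))"
    using assms(2) by (intro prod.cong refl one) auto
  also have "\<dots> = of_real (exp (\<Sum>i\<in>A. - (t\<^sup>2) * (c i)\<^sup>2 / 2))"
    using assms(1) by (simp only: of_real_prod[symmetric] exp_sum)
  also have "(\<Sum>i\<in>A. - (t\<^sup>2) * (c i)\<^sup>2 / 2) = - (t\<^sup>2) * (\<Sum>i\<in>A. (c i)\<^sup>2) / 2"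
    by (simp add: sum_distrib_left sum_divide_distrib sum_negf)
  finally show ?thesis .
qed

text \<open>The characteristic functions of the partial sums are \<open>exp(- t\<^sup>2 v\<^sub>k / 2)\<close> with converging
  variances \<open>v\<^sub>k\<close>, so that of the limit has the same form. If the limit variance is 0, then all
  coefficients vanish; otherwise Levy's uniqueness theorem identifies the distribution.\<close>

theorem gaussian_limit:
  assumes F: "exhausts F I" and c: "(\<lambda>i. (c i)\<^sup>2) summable_on I"
    and Y [measurable]: "Y \<in> borel_measurable M"
    and lim: "AE \<omega> in M. (\<lambda>k. noise_sum c (F k) \<omega>) \<longlonglongrightarrow> Y \<omega>"
  shows "gaussian_rv M Y"
proof -
  have F': "incseq F" "\<And>k. finite (F k)" "\<And>k. F k \<subseteq> I" using F by (auto simp: exhausts_def)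
  have [measurable]: "noise_sum c (F k) \<in> borel_measurable M" for k
    by (rule noise_sum_measurable[OF F'(3)])
  define v where "v = infsum (\<lambda>i. (c i)\<^sup>2) I"
  have V: "(\<lambda>k. \<Sum>i\<in>F k. (c i)\<^sup>2) \<longlonglongrightarrow> v"
    unfolding v_def by (rule exhausts_sum_LIMSEQ[OF F c])
  have "v \<ge> 0" unfolding v_def by (rule infsum_nonneg) simp
  have charY: "char (distr M borel Y) t = of_real (exp (- (t\<^sup>2) * v / 2))" for t
  proof (rule LIMSEQ_unique)
    show "(\<lambda>k. char (distr M borel (noise_sum c (F k))) t) \<longlonglongrightarrow> of_real (exp (- (t\<^sup>2) * v / 2))"
      unfolding char_noise_sum[OF F'(2,3)] by (intro tendsto_intros V) simp
    have "(\<lambda>k. \<integral>\<omega>. iexp (t * noise_sum c (F k) \<omega>) \<partial>M) \<longlonglongrightarrow> (\<integral>\<omega>. iexp (t * Y \<omega>) \<partial>M)"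
    proof (rule integral_dominated_convergence[where w = "\<lambda>_. 1"])
      show "AE \<omega> in M. (\<lambda>k. iexp (t * noise_sum c (F k) \<omega>)) \<longlonglongrightarrow> iexp (t * Y \<omega>)"
        using lim by eventually_elim (intro tendsto_intros)
    qed auto
    then show "(\<lambda>k. char (distr M borel (noise_sum c (F k))) t) \<longlonglongrightarrow> char (distr M borel Y) t"
      unfolding char_def by (simp add: integral_distr)
  qed
  show ?thesis
  proof (cases "v = 0")
    case True
    have "c i = 0" if "i \<in> I" for i
    proof -
      have "(c i)\<^sup>2 = 0"
        by (rule nonneg_infsum_le_0D[OF _ c]) (use True that v_def in auto)
      then show ?thesis by simp
    qed
    then have "noise_sum c (F k) \<omega> = 0" for k \<omega>
      unfolding noise_sum_def using F'(3) by (intro sum.neutral) auto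
    then have "AE \<omega> in M. Y \<omega> = 0"
      using lim by (simp add: LIMSEQ_const_iff)
    then show ?thesis unfolding gaussian_rv_def by (auto intro!: exI[of _ 0])
  next
    case False
    define s where "s = sqrt v"
    have s: "s > 0" "s\<^sup>2 = v" using False \<open>v \<ge> 0\<close> by (auto simp: s_def)
    have "distr M borel (\<lambda>\<omega>. (Y \<omega> - 0) / s) = std_normal_distribution"
    proof (rule Levy_uniqueness[OF _ real_dist_normal_dist])
      show "real_distribution (distr M borel (\<lambda>\<omega>. (Y \<omega> - 0) / s))"
        by (intro real_distribution.intro prob_space_distr real_distribution_axioms.intro) auto
      show "char (distr M borel (\<lambda>\<omega>. (Y \<omega> - 0) / s)) = char std_normal_distribution"
      proof
        fix t
        have "char (distr M borel (\<lambda>\<omega>. (Y \<omega> - 0) / s)) t = char (distr M borel Y) (t / s)"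
          unfolding char_def by (simp add: integral_distr)
        then show "char (distr M borel (\<lambda>\<omega>. (Y \<omega> - 0) / s)) t = char std_normal_distribution t"
          using s False by (simp add: charY char_std_normal_distribution power_divide)
      qed
    qed
    then have "distributed M lborel (\<lambda>\<omega>. (Y \<omega> - 0) / s) std_normal_density"
      unfolding distributed_def by (simp cong: distr_cong)
    then have "distributed M lborel Y (normal_density 0 s)"
      using normal_standard_normal_convert[OF s(1), of Y 0] by simp
    then show ?thesis unfolding gaussian_rv_def using s(1) by auto
  qed
qed

end

section \<open>The kernel in Fourier variables\<close>

text \<open>Cut off to \<open>[0, t]\<close> so that integrals in \<open>s\<close> run over the whole line, and extended evenly in the
  frequency.\<close>

definition tricomi_kernel :: "real \<Rightarrow> real \<Rightarrow> real \<Rightarrow> real" where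
  "tricomi_kernel t s \<xi> = indicator {0..t} s * tricomi_C t s \<bar>\<xi>\<bar>"

lemma tricomi_kernel_measurable [measurable (raw)]:
  assumes [measurable]: "f \<in> borel_measurable N" "g \<in> borel_measurable N"
  shows "(\<lambda>x. tricomi_kernel t (f x) (g x)) \<in> borel_measurable N"
  unfolding tricomi_kernel_def by measurable

lemma tricomi_kernel_bound: "t \<ge> 0 \<Longrightarrow> \<bar>tricomi_kernel t s \<xi>\<bar> \<le> t * indicator {0..t} s"
  using tricomi_C_bound[of s t "\<bar>\<xi>\<bar>"] by (auto simp: tricomi_kernel_def indicator_def)

lemma tricomi_kernel_bound': "t \<ge> 0 \<Longrightarrow> \<bar>tricomi_kernel t s \<xi>\<bar> \<le> t"
  using tricomi_kernel_bound[of t s \<xi>] by (cases "s \<in> {0..t}") auto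

lemma nn_integral_even:
  fixes g :: "real \<Rightarrow> ennreal"
  assumes [measurable]: "g \<in> borel_measurable borel"
  shows "(\<integral>\<^sup>+\<xi>. g \<bar>\<xi>\<bar> \<partial>lborel) = 2 * (\<integral>\<^sup>+\<rho>\<in>{0..}. g \<rho> \<partial>lborel)"
proof -
  have "(\<integral>\<^sup>+\<xi>. g \<bar>\<xi>\<bar> \<partial>lborel) = (\<integral>\<^sup>+\<xi>. g \<xi> * indicator {0..} \<xi> + g (- \<xi>) * indicator {..<0} \<xi> \<partial>lborel)"
    by (intro nn_integral_cong) (auto simp: indicator_def)
  also have "\<dots> = (\<integral>\<^sup>+\<rho>\<in>{0..}. g \<rho> \<partial>lborel) + (\<integral>\<^sup>+\<xi>. g (- \<xi>) * indicator {..<0} \<xi> \<partial>lborel)"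
    by (rule nn_integral_add) measurable
  also have "(\<integral>\<^sup>+\<xi>. g (- \<xi>) * indicator {..<0} \<xi> \<partial>lborel) = (\<integral>\<^sup>+\<xi>. g \<xi> * indicator {0<..} \<xi> \<partial>lborel)"
    using nn_integral_real_affine[of "\<lambda>\<xi>. g (- \<xi>) * indicator {..<0} \<xi>" "- 1" 0]
    by (simp add: indicator_def cong: if_cong)
  also have "\<dots> = (\<integral>\<^sup>+\<rho>\<in>{0..}. g \<rho> \<partial>lborel)"
    by (rule nn_integral_cong_AE, rule AE_mp[OF AE_lborel_singleton[of 0]])
      (auto simp: indicator_def)
  finally show ?thesis by (simp add: mult_2)
qed

lemma tricomi_kernel_norm:
  "(\<integral>\<^sup>+s. \<integral>\<^sup>+\<xi>. ennreal ((tricomi_kernel t s \<xi>)\<^sup>2) \<partial>lborel \<partial>lborel)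
     = 2 * (\<integral>\<^sup>+\<rho>\<in>{0..}. (\<integral>\<^sup>+s\<in>{0..t}. ennreal (\<bar>tricomi_C t s \<rho>\<bar>\<^sup>2) \<partial>lborel) \<partial>lborel)"
proof -
  define g where "g \<rho> = (\<integral>\<^sup>+s\<in>{0..t}. ennreal (\<bar>tricomi_C t s \<rho>\<bar>\<^sup>2) \<partial>lborel)" for \<rho>
  have [measurable]: "g \<in> borel_measurable borel" unfolding g_def[abs_def] by measurable
  have "(\<integral>\<^sup>+s. \<integral>\<^sup>+\<xi>. ennreal ((tricomi_kernel t s \<xi>)\<^sup>2) \<partial>lborel \<partial>lborel)
      = (\<integral>\<^sup>+\<xi>. \<integral>\<^sup>+s. ennreal ((tricomi_kernel t s \<xi>)\<^sup>2) \<partial>lborel \<partial>lborel)"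
    by (rule lborel_pair.Fubini') measurable
  also have "\<dots> = (\<integral>\<^sup>+\<xi>. g \<bar>\<xi>\<bar> \<partial>lborel)"
    unfolding g_def
    by (intro nn_integral_cong) (auto simp: tricomi_kernel_def indicator_def power_mult_distrib)
  also have "\<dots> = 2 * (\<integral>\<^sup>+\<rho>\<in>{0..}. g \<rho> \<partial>lborel)" by (rule nn_integral_even) simp
  finally show ?thesis by (simp add: g_def)
qed

text \<open>This is the integrability on the plane that Fubini's theorem requires.\<close>

lemma kernel_integrable_pair:
  assumes t: "t \<ge> 0" and p: "integrable lborel p" and q: "integrable lborel q"
  shows "integrable (lborel \<Otimes>\<^sub>M lborel) (\<lambda>(\<xi>, s). tricomi_kernel t s \<xi> * (p s * q \<xi>))"
proof -
  have [measurable]: "p \<in> borel_measurable borel" "q \<in> borel_measurable borel" using p q by auto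
  have "integrable (lborel \<Otimes>\<^sub>M lborel) (\<lambda>(\<xi>, s). p s * q \<xi>)"
  proof (rule lborel_pair.Fubini_integrable)
    show "integrable lborel (\<lambda>x. \<integral>y. norm (case (x, y) of (\<xi>, s) \<Rightarrow> p s * q \<xi>) \<partial>lborel)"
      using p q by (simp add: abs_mult)
    show "AE x in lborel. integrable lborel (\<lambda>y. case (x, y) of (\<xi>, s) \<Rightarrow> p s * q \<xi>)"
      using p by simp
  qed measurable
  then have "integrable (lborel \<Otimes>\<^sub>M lborel) (\<lambda>z. t * (case z of (\<xi>, s) \<Rightarrow> p s * q \<xi>))"
    by (rule integrable_mult_right)
  then show ?thesis
  proof (rule Bochner_Integration.integrable_bound)
    show "AE z in lborel \<Otimes>\<^sub>M lborel. norm (case z of (\<xi>, s) \<Rightarrow> tricomi_kernel t s \<xi> * (p s * q \<xi>))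
        \<le> norm (t * (case z of (\<xi>, s) \<Rightarrow> p s * q \<xi>))"
      using t tricomi_kernel_bound'[OF t] by (intro AE_I2) (auto simp: abs_mult intro!: mult_right_mono)
  qed measurable
qed

lemma kernel_integrable:
  assumes t: "t \<ge> 0" and p: "integrable lborel p"
  shows "integrable lborel (\<lambda>s. tricomi_kernel t s \<xi> * p s)"
proof (rule Bochner_Integration.integrable_bound[OF integrable_mult_right[OF p, of t]])
  have [measurable]: "p \<in> borel_measurable borel" using p by auto
  show "AE s in lborel. norm (tricomi_kernel t s \<xi> * p s) \<le> norm (t * p s)"
    using t tricomi_kernel_bound'[OF t] by (intro AE_I2) (auto simp: abs_mult intro!: mult_right_mono)
  show "(\<lambda>s. tricomi_kernel t s \<xi> * p s) \<in> borel_measurable lborel" by measurable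
qed

lemma window_integrable:
  fixes f :: "real \<Rightarrow> real"
  assumes "smooth_on_halfline f"
  shows "integrable lborel (\<lambda>s. indicator {0..t} s * f s)"
proof -
  obtain d where d: "\<And>t. t \<ge> 0 \<Longrightarrow> d 0 t = f t"
    "\<And>k t. t \<ge> 0 \<Longrightarrow> (d k has_real_derivative d (Suc k) t) (at t within {0..})"
    using assms unfolding smooth_on_halfline_def by blast
  have "continuous_on {0..} (d 0)"
    using d(2)[of _ 0] by (intro DERIV_continuous_on) auto
  then have "continuous_on {0..t} (d 0)" by (rule continuous_on_subset) auto
  then have "integrable lborel (\<lambda>s. indicator {0..t} s *\<^sub>R d 0 s)"
    using borel_integrable_atLeastAtMost'[of 0 t "d 0"] by (simp add: set_integrable_def)
  moreover have "(\<lambda>s. indicator {0..t} s *\<^sub>R d 0 s) = (\<lambda>s. indicator {0..t} s * f s)"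
    using d(1) by (auto simp: indicator_def)
  ultimately show ?thesis by simp
qed

text \<open>Here and below \<open>b\<close> stands for one of the two factors \<open>cos(x \<xi>)\<close> and \<open>sin(x \<xi>)\<close>; Parseval's identity
  is applied to real functions, so the two parts of \<open>exp(i x \<xi>)\<close> are treated separately.\<close>

definition hermite_amplitude :: "(real \<Rightarrow> real) \<Rightarrow> nat \<Rightarrow> real \<Rightarrow> real \<Rightarrow> real" where
  "hermite_amplitude b n t s = (\<integral>\<xi>. (tricomi_kernel t s \<xi> * b \<xi>) * hermite_fun n \<xi> \<partial>lborel)"

text \<open>The coefficient of the modulated kernel with respect to the product of \<open>\<psi>\<^sub>m\<close> and the \<open>n\<close>-th Hermite
  function.\<close>

definition kernel_coeff :: "(nat \<Rightarrow> real \<Rightarrow> real) \<Rightarrow> (real \<Rightarrow> real) \<Rightarrow> nat \<Rightarrow> nat \<Rightarrow> real \<Rightarrow> real" where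
  "kernel_coeff \<psi> b m n t =
     (\<integral>\<xi>. (\<integral>s. tricomi_kernel t s \<xi> * ((indicator {0..t} s * \<psi> m s) * (b \<xi> * hermite_fun n \<xi>)) \<partial>lborel) \<partial>lborel)"

lemma modulated_hermite_integrable:
  fixes b :: "real \<Rightarrow> real"
  assumes [measurable]: "b \<in> borel_measurable borel" and b: "\<And>\<xi>. \<bar>b \<xi>\<bar> \<le> 1" and n: "n \<ge> 1"
  shows "integrable lborel (\<lambda>\<xi>. b \<xi> * hermite_fun n \<xi>)"
proof (rule Bochner_Integration.integrable_bound[OF hermite_fun_integrable[OF n]])
  show "AE \<xi> in lborel. norm (b \<xi> * hermite_fun n \<xi>) \<le> norm (hermite_fun n \<xi>)"
    using b by (intro AE_I2) (auto simp: abs_mult intro!: mult_left_le_one_le)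
qed measurable

lemma hermite_amplitude_bound:
  assumes t: "t \<ge> 0" and [measurable]: "b \<in> borel_measurable borel" and b: "\<And>\<xi>. \<bar>b \<xi>\<bar> \<le> 1" and n: "n \<ge> 1"
  shows "\<bar>hermite_amplitude b n t s\<bar> \<le> indicator {0..t} s * (t * (\<integral>\<xi>. \<bar>hermite_fun n \<xi>\<bar> \<partial>lborel))"
proof -
  have "\<bar>hermite_amplitude b n t s\<bar> \<le> (\<integral>\<xi>. (t * indicator {0..t} s) * \<bar>hermite_fun n \<xi>\<bar> \<partial>lborel)"
    unfolding hermite_amplitude_def real_norm_def[symmetric]
  proof (rule Bochner_Integration.integral_norm_bound_integral)
    show I: "integrable lborel (\<lambda>\<xi>. (t * indicator {0..t} s) * norm (hermite_fun n \<xi>))"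
      by (intro integrable_mult_right integrable_norm hermite_fun_integrable[OF n])
    have le: "norm (tricomi_kernel t s \<xi> * b \<xi> * hermite_fun n \<xi>) \<le> (t * indicator {0..t} s) * norm (hermite_fun n \<xi>)" for \<xi>
    proof -
      have "\<bar>tricomi_kernel t s \<xi>\<bar> * \<bar>b \<xi>\<bar> \<le> (t * indicator {0..t} s) * 1"
        by (intro mult_mono tricomi_kernel_bound[OF t] b) (use t in auto)
      from mult_right_mono[OF this abs_ge_zero[of "hermite_fun n \<xi>"]]
      show ?thesis by (simp add: abs_mult)
    qed
    show "norm (tricomi_kernel t s \<xi> * b \<xi> * hermite_fun n \<xi>) \<le> (t * indicator {0..t} s) * norm (hermite_fun n \<xi>)" for \<xi>
      by (rule le)
    show "integrable lborel (\<lambda>\<xi>. tricomi_kernel t s \<xi> * b \<xi> * hermite_fun n \<xi>)"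
      by (rule Bochner_Integration.integrable_bound[OF I])
        (measurable, intro AE_I2 order_trans[OF le], simp)
  qed
  then show ?thesis by (simp add: mult_ac)
qed

lemma hermite_amplitude_measurable [measurable]:
  assumes [measurable]: "b \<in> borel_measurable borel"
  shows "hermite_amplitude b n t \<in> borel_measurable borel"
  unfolding hermite_amplitude_def[abs_def] by measurable

lemma hermite_amplitude_square_integrable:
  assumes t: "t \<ge> 0" and [measurable]: "b \<in> borel_measurable borel" and b: "\<And>\<xi>. \<bar>b \<xi>\<bar> \<le> 1" and n: "n \<ge> 1"
  shows "square_integrable lborel (hermite_amplitude b n t)"
proof -
  define B where "B = t * (\<integral>\<xi>. \<bar>hermite_fun n \<xi>\<bar> \<partial>lborel)"
  have "integrable lborel (\<lambda>s. (hermite_amplitude b n t s)\<^sup>2)"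
  proof (rule Bochner_Integration.integrable_bound[where f = "\<lambda>s. B\<^sup>2 * indicator {0..t} s"])
    show "AE s in lborel. norm ((hermite_amplitude b n t s)\<^sup>2) \<le> norm (B\<^sup>2 * indicator {0..t} s)"
    proof (rule AE_I2)
      fix s
      have "\<bar>hermite_amplitude b n t s\<bar>\<^sup>2 \<le> (indicator {0..t} s * B)\<^sup>2"
        unfolding B_def by (rule power_mono[OF hermite_amplitude_bound[OF t assms(2) b n]]) simp
      then show "norm ((hermite_amplitude b n t s)\<^sup>2) \<le> norm (B\<^sup>2 * indicator {0..t} s)"
        by (auto simp: indicator_def)
    qed
  qed (use t in auto)
  then show ?thesis by (simp add: square_integrable_real)
qed

text \<open>Fubini's theorem. The amplitude vanishes outside \<open>[0, t]\<close>, so the integral may run over the half-line on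
  which the functions \<open>\<psi>\<^sub>m\<close> form a basis.\<close>

lemma kernel_coeff_inner:
  assumes t: "t \<ge> 0" and [measurable]: "b \<in> borel_measurable borel" and b: "\<And>\<xi>. \<bar>b \<xi>\<bar> \<le> 1" and n: "n \<ge> 1"
    and smooth: "smooth_on_halfline (\<psi> m)"
  shows "kernel_coeff \<psi> b m n t = (\<integral>s. hermite_amplitude b n t s * \<psi> m s \<partial>restrict_space lborel {0..})"
proof -
  have "kernel_coeff \<psi> b m n t = (\<integral>s. (\<integral>\<xi>. tricomi_kernel t s \<xi> *
      ((indicator {0..t} s * \<psi> m s) * (b \<xi> * hermite_fun n \<xi>)) \<partial>lborel) \<partial>lborel)"
    unfolding kernel_coeff_def
    by (rule lborel_pair.Fubini_integral[symmetric])
      (rule kernel_integrable_pair[OF t window_integrable[OF smooth] modulated_hermite_integrable[OF assms(2) b n]])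
  also have "\<dots> = (\<integral>s. indicator {0..} s *\<^sub>R (hermite_amplitude b n t s * \<psi> m s) \<partial>lborel)"
  proof (rule Bochner_Integration.integral_cong[OF refl])
    fix s
    have "(\<integral>\<xi>. tricomi_kernel t s \<xi> * ((indicator {0..t} s * \<psi> m s) * (b \<xi> * hermite_fun n \<xi>)) \<partial>lborel)
       = (\<integral>\<xi>. (indicator {0..t} s * \<psi> m s) * ((tricomi_kernel t s \<xi> * b \<xi>) * hermite_fun n \<xi>) \<partial>lborel)"
      by (intro Bochner_Integration.integral_cong refl) (simp only: mult_ac)
    also have "\<dots> = (indicator {0..t} s * \<psi> m s) * hermite_amplitude b n t s"
      unfolding hermite_amplitude_def by (rule integral_mult_right_zero)
    also have "\<dots> = indicator {0..} s *\<^sub>R (hermite_amplitude b n t s * \<psi> m s)"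
    proof (cases "s \<in> {0..t}")
      case False
      then have "hermite_amplitude b n t s = 0"
        using hermite_amplitude_bound[OF t assms(2) b n, of s] by simp
      then show ?thesis by simp
    qed simp
    finally show "(\<integral>\<xi>. tricomi_kernel t s \<xi> * ((indicator {0..t} s * \<psi> m s) * (b \<xi> * hermite_fun n \<xi>)) \<partial>lborel)
      = indicator {0..} s *\<^sub>R (hermite_amplitude b n t s * \<psi> m s)" .
  qed
  also have "\<dots> = (\<integral>s. hermite_amplitude b n t s * \<psi> m s \<partial>restrict_space lborel {0..})"
    by (rule integral_restrict_space[symmetric]) simp
  finally show ?thesis .
qed

lemma suminf_ennreal_sums:
  fixes f :: "nat \<Rightarrow> real"
  assumes f: "f sums x" and nonneg: "\<And>n. 0 \<le> f n"
  shows "(\<Sum>n. ennreal (f n)) = ennreal x"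
proof -
  have "(\<Sum>n. ennreal (f n)) = ennreal (suminf f)"
    by (rule suminf_ennreal2[OF nonneg sums_summable[OF f]])
  then show ?thesis by (simp only: sums_unique[OF f, symmetric])
qed

text \<open>Parseval's identity for the product basis, obtained from the two bases one after the other: for fixed
  \<open>n\<close> the sum over \<open>m\<close> is the squared norm of the amplitude as a function of \<open>s\<close>, and for almost
  every \<open>s\<close> the sum of squared amplitudes over \<open>n\<close> is the squared norm of the kernel as a function of
  the frequency. All terms are nonnegative, so sum and integral may be exchanged.\<close>

lemma kernel_coeff_Parseval:
  assumes t: "t \<ge> 0" and [measurable]: "b \<in> borel_measurable borel" and b: "\<And>\<xi>. \<bar>b \<xi>\<bar> \<le> 1"
    and smooth: "\<And>m. m \<ge> 1 \<Longrightarrow> smooth_on_halfline (\<psi> m)"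
    and basis: "orthonormal_basis_L2 (restrict_space lborel {0..}) \<psi>"
  shows "(\<Sum>n. \<Sum>m. ennreal ((kernel_coeff \<psi> b (Suc m) (Suc n) t)\<^sup>2))
       = (\<integral>\<^sup>+s. \<integral>\<^sup>+\<xi>. ennreal ((tricomi_kernel t s \<xi> * b \<xi>)\<^sup>2) \<partial>lborel \<partial>lborel)"
proof -
  have time: "(\<Sum>m. ennreal ((kernel_coeff \<psi> b (Suc m) (Suc n) t)\<^sup>2))
      = (\<integral>\<^sup>+s. ennreal ((hermite_amplitude b (Suc n) t s)\<^sup>2) \<partial>lborel)" for n
  proof -
    define a where "a = hermite_amplitude b (Suc n) t"
    have a: "a \<in> borel_measurable borel" "integrable lborel (\<lambda>s. (a s)\<^sup>2)"
      using hermite_amplitude_square_integrable[OF t assms(2) b, of "Suc n"]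
      by (simp_all add: a_def square_integrable_real)
    have a0: "indicator {0..} s *\<^sub>R (a s)\<^sup>2 = (a s)\<^sup>2" for s
    proof (cases "s \<in> {0..}")
      case False
      then have "a s = 0"
        using hermite_amplitude_bound[OF t assms(2) b, of "Suc n" s] by (simp add: a_def)
      then show ?thesis by simp
    qed simp
    have meas: "a \<in> borel_measurable (restrict_space lborel {0..})"
      by (rule measurable_restrict_space1) (use a in simp)
    have "integrable (restrict_space lborel {0..}) (\<lambda>s. (a s)\<^sup>2)"
      by (subst integrable_restrict_space) (simp, simp only: a0 a(2))
    with meas have sq: "square_integrable (restrict_space lborel {0..}) a"
      unfolding square_integrable_real by (rule conjI)
    have coeff: "kernel_coeff \<psi> b (Suc m) (Suc n) t = (\<integral>s. a s * \<psi> (Suc m) s \<partial>restrict_space lborel {0..})" for m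
      unfolding a_def by (rule kernel_coeff_inner[OF t assms(2) b _ smooth]) simp_all
    have restr: "(\<integral>s. (a s)\<^sup>2 \<partial>restrict_space lborel {0..}) = (\<integral>s. (a s)\<^sup>2 \<partial>lborel)"
      by (subst integral_restrict_space) (simp, simp only: a0)
    have "(\<lambda>m. (kernel_coeff \<psi> b (Suc m) (Suc n) t)\<^sup>2) sums (\<integral>s. (a s)\<^sup>2 \<partial>lborel)"
      using Parseval[OF basis sq] unfolding coeff restr .
    then have "(\<Sum>m. ennreal ((kernel_coeff \<psi> b (Suc m) (Suc n) t)\<^sup>2)) = ennreal (\<integral>s. (a s)\<^sup>2 \<partial>lborel)"
      by (rule suminf_ennreal_sums) (rule zero_le_power2)
    also have "\<dots> = (\<integral>\<^sup>+s. ennreal ((a s)\<^sup>2) \<partial>lborel)"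
      by (rule nn_integral_eq_integral[symmetric]) (use a in auto)
    finally show ?thesis by (simp add: a_def)
  qed
  have fin: "(\<integral>\<^sup>+s. \<integral>\<^sup>+\<xi>. ennreal ((tricomi_kernel t s \<xi>)\<^sup>2) \<partial>lborel \<partial>lborel) \<noteq> \<infinity>"
    unfolding tricomi_kernel_norm using tricomi_C_nn_integral_finite[OF t]
    by (simp add: ennreal_mult_eq_top_iff)
  have "AE s in lborel. (\<integral>\<^sup>+\<xi>. ennreal ((tricomi_kernel t s \<xi>)\<^sup>2) \<partial>lborel) \<noteq> \<infinity>"
    by (rule nn_integral_PInf_AE[OF _ fin]) measurable
  then have space: "AE s in lborel. (\<Sum>n. ennreal ((hermite_amplitude b (Suc n) t s)\<^sup>2))
      = (\<integral>\<^sup>+\<xi>. ennreal ((tricomi_kernel t s \<xi> * b \<xi>)\<^sup>2) \<partial>lborel)"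
  proof eventually_elim
    case (elim s)
    have "(\<integral>\<^sup>+\<xi>. ennreal (norm ((tricomi_kernel t s \<xi> * b \<xi>)\<^sup>2)) \<partial>lborel)
        \<le> (\<integral>\<^sup>+\<xi>. ennreal ((tricomi_kernel t s \<xi>)\<^sup>2) \<partial>lborel)"
    proof (intro nn_integral_mono ennreal_leI)
      fix \<xi>
      have "(b \<xi>)\<^sup>2 \<le> 1" using b[of \<xi>] by (simp add: abs_square_le_1)
      then show "norm ((tricomi_kernel t s \<xi> * b \<xi>)\<^sup>2) \<le> (tricomi_kernel t s \<xi>)\<^sup>2"
        by (simp add: power_mult_distrib mult_left_le)
    qed
    also have "\<dots> < \<infinity>" using elim by (simp add: less_top)
    finally have int: "integrable lborel (\<lambda>\<xi>. (tricomi_kernel t s \<xi> * b \<xi>)\<^sup>2)"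
      by (intro integrableI_bounded) auto
    then have "square_integrable lborel (\<lambda>\<xi>. tricomi_kernel t s \<xi> * b \<xi>)"
      by (simp add: square_integrable_real)
    from Parseval[OF hermite_orthonormal_basis this]
    have "(\<Sum>n. ennreal ((hermite_amplitude b (Suc n) t s)\<^sup>2)) = ennreal (\<integral>\<xi>. (tricomi_kernel t s \<xi> * b \<xi>)\<^sup>2 \<partial>lborel)"
      unfolding hermite_amplitude_def by (rule suminf_ennreal_sums) (rule zero_le_power2)
    also have "\<dots> = (\<integral>\<^sup>+\<xi>. ennreal ((tricomi_kernel t s \<xi> * b \<xi>)\<^sup>2) \<partial>lborel)"
      by (rule nn_integral_eq_integral[symmetric, OF int]) simp
    finally show ?case .
  qed
  have "(\<Sum>n. \<Sum>m. ennreal ((kernel_coeff \<psi> b (Suc m) (Suc n) t)\<^sup>2))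
      = (\<Sum>n. \<integral>\<^sup>+s. ennreal ((hermite_amplitude b (Suc n) t s)\<^sup>2) \<partial>lborel)"
    by (simp only: time)
  also have "\<dots> = (\<integral>\<^sup>+s. (\<Sum>n. ennreal ((hermite_amplitude b (Suc n) t s)\<^sup>2)) \<partial>lborel)"
    by (rule nn_integral_suminf[symmetric]) measurable
  also have "\<dots> = (\<integral>\<^sup>+s. \<integral>\<^sup>+\<xi>. ennreal ((tricomi_kernel t s \<xi> * b \<xi>)\<^sup>2) \<partial>lborel \<partial>lborel)"
    by (rule nn_integral_cong_AE[OF space])
  finally show ?thesis .
qed

section \<open>The coefficients of the series\<close>

definition time_integral :: "(nat \<Rightarrow> real \<Rightarrow> real) \<Rightarrow> nat \<Rightarrow> nat \<Rightarrow> real \<Rightarrow> real \<Rightarrow> real \<Rightarrow> complex" where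
  "time_integral \<psi> m n t x \<xi> = (LINT s:{0..t}|lborel.
     exp (\<i> * of_real x * of_real \<xi>) * of_real (tricomi_C t s \<bar>\<xi>\<bar> * \<psi> m s * hermite_fun n \<xi>))"

lemma u_coeff_time_integral:
  "u_coeff \<psi> m n t x = (- \<i>) ^ (n - 1) / of_real (sqrt (2 * pi)) * (\<integral>\<xi>. time_integral \<psi> m n t x \<xi> \<partial>lborel)"
  by (simp add: u_coeff_def time_integral_def)

lemma exp_i_cos_sin:
  "exp (\<i> * of_real x * of_real \<xi>) = of_real (cos (x * \<xi>)) + \<i> * complex_of_real (sin (x * \<xi>))"
  using cis_conv_exp[of "x * \<xi>"] by (simp add: complex_eq_iff mult.assoc)

context
  fixes \<psi> :: "nat \<Rightarrow> real \<Rightarrow> real" and m n :: nat and t :: real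
  assumes t: "t \<ge> 0" and n: "n \<ge> 1" and smooth: "smooth_on_halfline (\<psi> m)"
begin

lemma kernel_slice_integrable:
  "integrable lborel (\<lambda>s. tricomi_kernel t s \<xi> * ((indicator {0..t} s * \<psi> m s) * c))"
proof -
  have "integrable lborel (\<lambda>s. (indicator {0..t} s * \<psi> m s) * c)"
    by (intro integrable_mult_left window_integrable smooth)
  from kernel_integrable[OF t this] show ?thesis .
qed

lemma kernel_slice_integrable_freq:
  assumes [measurable]: "b \<in> borel_measurable borel" and b: "\<And>\<xi>. \<bar>b \<xi>\<bar> \<le> 1"
  shows "integrable lborel (\<lambda>\<xi>. \<integral>s. tricomi_kernel t s \<xi> * ((indicator {0..t} s * \<psi> m s) * (b \<xi> * hermite_fun n \<xi>)) \<partial>lborel)"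
  using lborel_pair.integrable_fst'[OF kernel_integrable_pair[OF t window_integrable[OF smooth]
        modulated_hermite_integrable[OF assms n]], of t] by simp

lemma time_integrand:
  "indicator {0..t} s *\<^sub>R (exp (\<i> * of_real x * of_real \<xi>) * of_real (tricomi_C t s \<bar>\<xi>\<bar> * \<psi> m s * hermite_fun n \<xi>))
   = of_real (tricomi_kernel t s \<xi> * ((indicator {0..t} s * \<psi> m s) * (cos (x * \<xi>) * hermite_fun n \<xi>)))
     + \<i> * complex_of_real (tricomi_kernel t s \<xi> * ((indicator {0..t} s * \<psi> m s) * (sin (x * \<xi>) * hermite_fun n \<xi>)))"
proof (cases "s \<in> {0..t}")
  case True
  then show ?thesis
    unfolding exp_i_cos_sin tricomi_kernel_def by (simp add: algebra_simps)
qed (simp add: tricomi_kernel_def)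

lemma time_integrand_integrable:
  "set_integrable lborel {0..t}
     (\<lambda>s. exp (\<i> * of_real x * of_real \<xi>) * of_real (tricomi_C t s \<bar>\<xi>\<bar> * \<psi> m s * hermite_fun n \<xi>))"
  unfolding set_integrable_def time_integrand
  by (intro Bochner_Integration.integrable_add integrable_mult_right integrable_of_real kernel_slice_integrable)

lemma time_integral_eq:
  "time_integral \<psi> m n t x \<xi> =
     of_real (\<integral>s. tricomi_kernel t s \<xi> * ((indicator {0..t} s * \<psi> m s) * (cos (x * \<xi>) * hermite_fun n \<xi>)) \<partial>lborel)
     + \<i> * of_real (\<integral>s. tricomi_kernel t s \<xi> * ((indicator {0..t} s * \<psi> m s) * (sin (x * \<xi>) * hermite_fun n \<xi>)) \<partial>lborel)"
  unfolding time_integral_def set_lebesgue_integral_def time_integrand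
  by (subst Bochner_Integration.integral_add)
    (intro integrable_mult_right integrable_of_real kernel_slice_integrable,
     intro integrable_mult_right integrable_of_real kernel_slice_integrable,
     simp only: integral_mult_right_zero integral_complex_of_real)

lemma time_integral_integrable: "integrable lborel (time_integral \<psi> m n t x)"
  unfolding time_integral_eq[abs_def]
  by (intro Bochner_Integration.integrable_add integrable_mult_right integrable_of_real
      kernel_slice_integrable_freq) auto

lemma u_coeff_eq:
  "u_coeff \<psi> m n t x = (- \<i>) ^ (n - 1) / of_real (sqrt (2 * pi)) *
     (of_real (kernel_coeff \<psi> (\<lambda>\<xi>. cos (x * \<xi>)) m n t) + \<i> * of_real (kernel_coeff \<psi> (\<lambda>\<xi>. sin (x * \<xi>)) m n t))"
proof -
  have "(\<integral>\<xi>. time_integral \<psi> m n t x \<xi> \<partial>lborel) =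
      of_real (kernel_coeff \<psi> (\<lambda>\<xi>. cos (x * \<xi>)) m n t) + \<i> * of_real (kernel_coeff \<psi> (\<lambda>\<xi>. sin (x * \<xi>)) m n t)"
  proof -
    define f where "f b \<xi> = (\<integral>s. tricomi_kernel t s \<xi> * ((indicator {0..t} s * \<psi> m s) * (b (x * \<xi>) * hermite_fun n \<xi>)) \<partial>lborel)"
      for b :: "real \<Rightarrow> real" and \<xi>
    have f: "integrable lborel (f cos)" "integrable lborel (f sin)"
      unfolding f_def[abs_def] by (intro kernel_slice_integrable_freq; simp)+
    have "(\<integral>\<xi>. of_real (f cos \<xi>) + \<i> * complex_of_real (f sin \<xi>) \<partial>lborel)
        = (\<integral>\<xi>. of_real (f cos \<xi>) \<partial>lborel) + (\<integral>\<xi>. \<i> * complex_of_real (f sin \<xi>) \<partial>lborel)"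
      by (intro Bochner_Integration.integral_add integrable_mult_right integrable_of_real f)
    also have "\<dots> = of_real (\<integral>\<xi>. f cos \<xi> \<partial>lborel) + \<i> * of_real (\<integral>\<xi>. f sin \<xi> \<partial>lborel)"
      by (simp only: integral_mult_right_zero integral_complex_of_real)
    finally show ?thesis unfolding time_integral_eq kernel_coeff_def f_def .
  qed
  then show ?thesis by (simp only: u_coeff_time_integral)
qed

text \<open>Reflect the frequency: the kernel is even, and the \<open>n\<close>-th Hermite function has the parity of
  \<open>n - 1\<close>.\<close>

lemma kernel_coeff_parity:
  assumes b: "\<And>\<xi>. b (- \<xi>) = \<sigma> * b \<xi>"
  shows "kernel_coeff \<psi> b m n t = (\<sigma> * (- 1) ^ (n - 1)) * kernel_coeff \<psi> b m n t"
proof -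
  define g where "g \<xi> = (\<integral>s. tricomi_kernel t s \<xi> * ((indicator {0..t} s * \<psi> m s) * (b \<xi> * hermite_fun n \<xi>)) \<partial>lborel)" for \<xi>
  have reflect: "g (- \<xi>) = (\<sigma> * (- 1) ^ (n - 1)) * g \<xi>" for \<xi>
  proof -
    have "g (- \<xi>) = (\<integral>s. (\<sigma> * (- 1) ^ (n - 1)) *
        (tricomi_kernel t s \<xi> * ((indicator {0..t} s * \<psi> m s) * (b \<xi> * hermite_fun n \<xi>))) \<partial>lborel)"
      unfolding g_def b hermite_fun_parity[OF n]
      by (intro Bochner_Integration.integral_cong refl) (simp add: tricomi_kernel_def mult_ac)
    then show ?thesis by (simp only: integral_mult_right_zero g_def)
  qed
  have "(\<integral>\<xi>. g \<xi> \<partial>lborel) = (\<integral>\<xi>. g (- \<xi>) \<partial>lborel)"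
    using lborel_integral_real_affine[of "- 1" g 0] by simp
  also have "\<dots> = (\<sigma> * (- 1) ^ (n - 1)) * (\<integral>\<xi>. g \<xi> \<partial>lborel)"
    unfolding reflect by (rule integral_mult_right_zero)
  finally show ?thesis unfolding kernel_coeff_def g_def .
qed

text \<open>The factor \<open>(- i)\<^sup>n\<^sup>-\<^sup>1\<close> is real when \<open>n - 1\<close> is even, in which case parity kills the sine part, and
  imaginary when \<open>n - 1\<close> is odd, in which case it kills the cosine part.\<close>

lemma u_coeff_real: "u_coeff \<psi> m n t x \<in> \<real>"
proof -
  define a b where "a = kernel_coeff \<psi> (\<lambda>\<xi>. cos (x * \<xi>)) m n t" and "b = kernel_coeff \<psi> (\<lambda>\<xi>. sin (x * \<xi>)) m n t"
  have ab: "a = (- 1) ^ (n - 1) * a" "b = - ((- 1) ^ (n - 1) * b)"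
    using kernel_coeff_parity[of "\<lambda>\<xi>. cos (x * \<xi>)" 1] kernel_coeff_parity[of "\<lambda>\<xi>. sin (x * \<xi>)" "- 1"]
    by (simp_all add: a_def b_def)
  show ?thesis
  proof (cases "even (n - 1)")
    case True
    then have "b = 0" using ab(2) by simp
    moreover obtain k where "n - 1 = 2 * k" using True by (rule evenE)
    ultimately show ?thesis
      unfolding u_coeff_eq a_def[symmetric] b_def[symmetric] by (simp add: power_mult)
  next
    case False
    then have "a = 0" using ab(1) by simp
    moreover obtain k where "n - 1 = 2 * k + 1" using False by (rule oddE)
    moreover have "\<i> * (- 1) ^ k * (\<i> * complex_of_real b) = of_real (- ((- 1) ^ k * b))"
      by (simp add: algebra_simps)
    ultimately show ?thesis
      unfolding u_coeff_eq a_def[symmetric] b_def[symmetric] by (simp add: power_mult del: of_real_minus of_real_mult)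
  qed
qed

lemma u_coeff_square:
  "(Re (u_coeff \<psi> m n t x))\<^sup>2 = 1 / (2 * pi) *
     ((kernel_coeff \<psi> (\<lambda>\<xi>. cos (x * \<xi>)) m n t)\<^sup>2 + (kernel_coeff \<psi> (\<lambda>\<xi>. sin (x * \<xi>)) m n t)\<^sup>2)"
proof -
  have "(Re (u_coeff \<psi> m n t x))\<^sup>2 = (cmod (u_coeff \<psi> m n t x))\<^sup>2"
    using u_coeff_real[of x] by (auto elim!: Reals_cases)
  also have "\<dots> = 1 / (2 * pi) *
      (cmod (of_real (kernel_coeff \<psi> (\<lambda>\<xi>. cos (x * \<xi>)) m n t) + \<i> * of_real (kernel_coeff \<psi> (\<lambda>\<xi>. sin (x * \<xi>)) m n t)))\<^sup>2"
    unfolding u_coeff_eq by (simp add: norm_mult norm_divide norm_power power_mult_distrib power_divide)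
  also have "\<dots> = 1 / (2 * pi) *
     ((kernel_coeff \<psi> (\<lambda>\<xi>. cos (x * \<xi>)) m n t)\<^sup>2 + (kernel_coeff \<psi> (\<lambda>\<xi>. sin (x * \<xi>)) m n t)\<^sup>2)"
    by (simp add: cmod_power2)
  finally show ?thesis .
qed

end

text \<open>The cosine and the sine part recombine through \<open>cos\<^sup>2 + sin\<^sup>2 = 1\<close>. The factor \<open>1/(2 \<pi>)\<close> is the
  square of the constant in front of the coefficients, and a factor 2 comes from folding the frequency
  line onto \<open>[0, \<infinity>)\<close>.\<close>

lemma u_coeff_square_sum:
  assumes t: "t \<ge> 0"
    and smooth: "\<And>m. m \<ge> 1 \<Longrightarrow> smooth_on_halfline (\<psi> m)"
    and basis: "orthonormal_basis_L2 (restrict_space lborel {0..}) \<psi>"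
  shows "(\<Sum>n. \<Sum>m. ennreal ((Re (u_coeff \<psi> (Suc m) (Suc n) t x))\<^sup>2))
     = ennreal (1 / pi) * (\<integral>\<^sup>+\<rho>\<in>{0..}. (\<integral>\<^sup>+s\<in>{0..t}. ennreal (\<bar>tricomi_C t s \<rho>\<bar>\<^sup>2) \<partial>lborel) \<partial>lborel)"
proof -
  define K where "K b m n = ennreal ((kernel_coeff \<psi> b (Suc m) (Suc n) t)\<^sup>2)" for b :: "real \<Rightarrow> real" and m n
  define c s where "c \<xi> = cos (x * \<xi>)" and "s \<xi> = sin (x * \<xi>)" for \<xi>
  have [measurable]: "c \<in> borel_measurable borel" "s \<in> borel_measurable borel"
    by (simp_all add: c_def[abs_def] s_def[abs_def])
  have cs: "\<bar>c \<xi>\<bar> \<le> 1" "\<bar>s \<xi>\<bar> \<le> 1" for \<xi> by (simp_all add: c_def s_def)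
  have "ennreal ((Re (u_coeff \<psi> (Suc m) (Suc n) t x))\<^sup>2) = ennreal (1 / (2 * pi)) * (K c m n + K s m n)" for m n
    unfolding K_def c_def s_def
    by (subst u_coeff_square[OF t _ smooth]) (simp_all add: ennreal_mult[symmetric] ennreal_plus[symmetric] del: ennreal_plus)
  then have "(\<Sum>n. \<Sum>m. ennreal ((Re (u_coeff \<psi> (Suc m) (Suc n) t x))\<^sup>2))
      = (\<Sum>n. \<Sum>m. ennreal (1 / (2 * pi)) * (K c m n + K s m n))"
    by (simp only:)
  also have "\<dots> = ennreal (1 / (2 * pi)) * ((\<Sum>n. \<Sum>m. K c m n) + (\<Sum>n. \<Sum>m. K s m n))"
    by (simp only: ennreal_suminf_cmult suminf_add[OF summableI summableI, symmetric])
  also have "(\<Sum>n. \<Sum>m. K c m n) + (\<Sum>n. \<Sum>m. K s m n)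
      = (\<integral>\<^sup>+r. \<integral>\<^sup>+\<xi>. ennreal ((tricomi_kernel t r \<xi> * c \<xi>)\<^sup>2) \<partial>lborel \<partial>lborel)
        + (\<integral>\<^sup>+r. \<integral>\<^sup>+\<xi>. ennreal ((tricomi_kernel t r \<xi> * s \<xi>)\<^sup>2) \<partial>lborel \<partial>lborel)"
    unfolding K_def
    by (intro arg_cong2[where f = "(+)"] kernel_coeff_Parseval t smooth basis cs) auto
  also have "\<dots> = (\<integral>\<^sup>+r. \<integral>\<^sup>+\<xi>. ennreal ((tricomi_kernel t r \<xi> * c \<xi>)\<^sup>2) + ennreal ((tricomi_kernel t r \<xi> * s \<xi>)\<^sup>2) \<partial>lborel \<partial>lborel)"
    by (subst nn_integral_add[symmetric]; (measurable)?) (intro nn_integral_cong nn_integral_add[symmetric]; measurable)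
  also have "\<dots> = (\<integral>\<^sup>+r. \<integral>\<^sup>+\<xi>. ennreal ((tricomi_kernel t r \<xi>)\<^sup>2) \<partial>lborel \<partial>lborel)"
  proof (intro nn_integral_cong)
    fix r \<xi>
    have "(tricomi_kernel t r \<xi> * c \<xi>)\<^sup>2 + (tricomi_kernel t r \<xi> * s \<xi>)\<^sup>2 = (tricomi_kernel t r \<xi>)\<^sup>2 * ((c \<xi>)\<^sup>2 + (s \<xi>)\<^sup>2)"
      by (simp add: power_mult_distrib distrib_left)
    also have "(c \<xi>)\<^sup>2 + (s \<xi>)\<^sup>2 = 1" by (simp add: c_def s_def)
    finally show "ennreal ((tricomi_kernel t r \<xi> * c \<xi>)\<^sup>2) + ennreal ((tricomi_kernel t r \<xi> * s \<xi>)\<^sup>2)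
        = ennreal ((tricomi_kernel t r \<xi>)\<^sup>2)"
      by (simp add: ennreal_plus[symmetric] del: ennreal_plus)
  qed
  also have "\<dots> = ennreal 2 * (\<integral>\<^sup>+\<rho>\<in>{0..}. (\<integral>\<^sup>+s\<in>{0..t}. ennreal (\<bar>tricomi_C t s \<rho>\<bar>\<^sup>2) \<partial>lborel) \<partial>lborel)"
    by (simp only: tricomi_kernel_norm ennreal_numeral)
  finally show ?thesis
    by (simp only: mult.assoc[symmetric]) (simp add: ennreal_mult[symmetric] del: ennreal_numeral)
qed

text \<open>Iterated sums over the positive integers as one unordered sum over the grid, with the counting
  measure as intermediary.\<close>

lemma summable_on_grid:
  fixes g :: "nat \<times> nat \<Rightarrow> real"
  assumes g: "\<And>i. 0 \<le> g i" and S: "(\<Sum>n. \<Sum>m. ennreal (g (Suc m, Suc n))) = S" "S < \<infinity>"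
  shows "g summable_on ({1..} \<times> {1..})" "ennreal (infsum g ({1..} \<times> {1..})) = S"
proof -
  define I :: "(nat \<times> nat) set" where "I = {1..} \<times> {1..}"
  have bij: "bij_betw (\<lambda>(m, n). (Suc m, Suc n)) UNIV I"
    by (rule bij_betwI[where g = "\<lambda>(m, n). (m - 1, n - 1)"]) (auto simp: I_def)
  have "(\<integral>\<^sup>+i. ennreal (g i) \<partial>count_space I) = (\<integral>\<^sup>+i. ennreal (g (case i of (m, n) \<Rightarrow> (Suc m, Suc n))) \<partial>count_space UNIV)"
    by (rule nn_integral_bij_count_space[OF bij, symmetric])
  also have "\<dots> = (\<integral>\<^sup>+n. \<integral>\<^sup>+m. ennreal (g (case (m, n) of (m, n) \<Rightarrow> (Suc m, Suc n))) \<partial>count_space UNIV \<partial>count_space UNIV)"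
    by (rule nn_integral_snd_count_space[symmetric])
  also have "\<dots> = S"
    unfolding S(1)[symmetric] by (simp only: nn_integral_count_space_nat prod.case)
  finally have nn: "(\<integral>\<^sup>+i. ennreal (g i) \<partial>count_space I) = S" .
  have int: "integrable (count_space I) g"
    by (rule integrableI_bounded) (use nn S(2) g in auto)
  then have abs: "Infinite_Set_Sum.abs_summable_on g I"
    by (simp add: Infinite_Set_Sum.abs_summable_on_def)
  then have "(\<lambda>i. norm (g i)) summable_on I" by (rule iffD2[OF abs_summable_equivalent])
  then show "g summable_on ({1..} \<times> {1..})" using g by (simp add: I_def)
  have "infsum g I = (\<integral>i. g i \<partial>count_space I)"
    using infsetsum_infsum[OF abs] by (simp add: infsetsum_def)
  then show "ennreal (infsum g ({1..} \<times> {1..})) = S"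
    using nn_integral_eq_integral[OF int] g nn by (simp add: I_def)
qed

section \<open>The approximate solutions\<close>

text \<open>Each Hermite function is an eigenfunction of the Fourier transform, so the transformed noise
  is again a finite combination of Hermite functions.\<close>

lemma noise_approx_hat_eq:
  "noise_approx_hat \<psi> z N s \<xi> \<omega> = (\<Sum>(m, n)\<in>{1..N} \<times> {1..N}.
     of_real (sqrt (2 * pi)) * (- \<i>) ^ (n - 1) * of_real (z m n \<omega>) * of_real (\<psi> m s * hermite_fun n \<xi>))"
proof -
  define A where "A = {1..N} \<times> {1..N}"
  have int: "integrable lborel (\<lambda>x. of_real (\<psi> m s * z m n \<omega>) * (exp (- \<i> * of_real \<xi> * of_real x) * of_real (hermite_fun n x)))"
    if "n \<ge> 1" for m n
    using fourier_integrable[OF hermite_fun_integrable[OF that], of "- \<xi>"]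
    by (intro integrable_mult_right) (simp add: mult.assoc)
  have "noise_approx_hat \<psi> z N s \<xi> \<omega> = (\<integral>x. (\<Sum>(m, n)\<in>A. of_real (\<psi> m s * z m n \<omega>) *
      (exp (- \<i> * of_real \<xi> * of_real x) * of_real (hermite_fun n x))) \<partial>lborel)"
    unfolding noise_approx_hat_def noise_approx_def sum.cartesian_product A_def
    by (intro Bochner_Integration.integral_cong refl)
      (simp add: sum_distrib_left of_real_sum split_def mult_ac)
  also have "\<dots> = (\<Sum>(m, n)\<in>A. of_real (\<psi> m s * z m n \<omega>) *
      (\<integral>x. exp (- \<i> * of_real \<xi> * of_real x) * of_real (hermite_fun n x) \<partial>lborel))"
    unfolding split_def integral_mult_right_zero[symmetric]
    by (rule Bochner_Integration.integral_sum) (use int in \<open>auto simp: A_def\<close>)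
  also have "\<dots> = (\<Sum>(m, n)\<in>A.
     of_real (sqrt (2 * pi)) * (- \<i>) ^ (n - 1) * of_real (z m n \<omega>) * of_real (\<psi> m s * hermite_fun n \<xi>))"
  proof (intro sum.cong refl, clarify)
    fix m n assume "(m, n) \<in> A"
    then have "n \<ge> 1" by (simp add: A_def)
    then show "of_real (\<psi> m s * z m n \<omega>) * (\<integral>x. exp (- \<i> * of_real \<xi> * of_real x) * of_real (hermite_fun n x) \<partial>lborel)
       = of_real (sqrt (2 * pi)) * (- \<i>) ^ (n - 1) * of_real (z m n \<omega>) * of_real (\<psi> m s * hermite_fun n \<xi>)"
      by (simp only: hermite_fun_fourier) (simp only: of_real_mult mult_ac)
  qed
  finally show ?thesis unfolding A_def .
qed

text \<open>The eigenvalue \<open>sqrt(2 \<pi>) (- i)\<^sup>n\<^sup>-\<^sup>1\<close> and the prefactor \<open>1/(2 \<pi>)\<close> of the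
  inverse transform combine to the constant of \<^const>\<open>u_coeff\<close>: the approximate solutions are the partial
  sums of the series over the squares \<open>{1..N}\<^sup>2\<close>.\<close>

lemma approx_solution_eq:
  assumes t: "t \<ge> 0" and smooth: "\<And>m. m \<ge> 1 \<Longrightarrow> smooth_on_halfline (\<psi> m)"
  shows "approx_solution \<psi> z N t x \<omega> = (\<Sum>(m, n)\<in>{1..N} \<times> {1..N}. u_coeff \<psi> m n t x * of_real (z m n \<omega>))"
proof -
  define A where "A = {1..N} \<times> {1..N}"
  have A: "fst i \<ge> 1" "snd i \<ge> 1" if "i \<in> A" for i using that by (auto simp: A_def)
  define k where "k i = of_real (sqrt (2 * pi)) * (- \<i>) ^ (snd i - 1) * of_real (z (fst i) (snd i) \<omega>)" for i
  have inner: "exp (\<i> * of_real \<xi> * of_real x) *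
        (LINT s:{0..t}|lborel. of_real (tricomi_C t s \<bar>\<xi>\<bar>) * noise_approx_hat \<psi> z N s \<xi> \<omega>)
      = (\<Sum>i\<in>A. k i * time_integral \<psi> (fst i) (snd i) t x \<xi>)" for \<xi>
  proof -
    define T where "T i s = exp (\<i> * of_real x * of_real \<xi>) *
        complex_of_real (tricomi_C t s \<bar>\<xi>\<bar> * \<psi> (fst i) s * hermite_fun (snd i) \<xi>)" for i s
    have T: "set_integrable lborel {0..t} (T i)" if "i \<in> A" for i
      unfolding T_def[abs_def] by (rule time_integrand_integrable[where \<psi> = \<psi> and m = "fst i", OF t A(2)[OF that] smooth[OF A(1)[OF that]]])
    have "exp (\<i> * of_real \<xi> * of_real x) *
        (LINT s:{0..t}|lborel. of_real (tricomi_C t s \<bar>\<xi>\<bar>) * noise_approx_hat \<psi> z N s \<xi> \<omega>)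
      = (LINT s:{0..t}|lborel. exp (\<i> * of_real \<xi> * of_real x) * (of_real (tricomi_C t s \<bar>\<xi>\<bar>) * noise_approx_hat \<psi> z N s \<xi> \<omega>))"
      by (rule set_integral_mult_right[symmetric])
    also have "\<dots> = (LINT s:{0..t}|lborel. (\<Sum>i\<in>A. k i * T i s))"
      unfolding noise_approx_hat_eq A_def[symmetric] T_def k_def
      by (intro arg_cong[where f = "set_lebesgue_integral lborel {0..t}"] ext)
        (simp add: sum_distrib_left split_def mult_ac)
    also have "\<dots> = (\<Sum>i\<in>A. (LINT s:{0..t}|lborel. k i * T i s))"
      unfolding set_lebesgue_integral_def scaleR_sum_right
      by (rule Bochner_Integration.integral_sum)
        (use T in \<open>auto simp: set_integrable_def mult_scaleR_right[symmetric] simp del: mult_scaleR_right\<close>)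
    also have "\<dots> = (\<Sum>i\<in>A. k i * time_integral \<psi> (fst i) (snd i) t x \<xi>)"
      unfolding time_integral_def T_def by (simp only: set_integral_mult_right)
    finally show ?thesis .
  qed
  have "approx_solution \<psi> z N t x \<omega> = 1 / (2 * of_real pi) *
      (\<integral>\<xi>. (\<Sum>i\<in>A. k i * time_integral \<psi> (fst i) (snd i) t x \<xi>) \<partial>lborel)"
    unfolding approx_solution_def inner ..
  also have "(\<integral>\<xi>. (\<Sum>i\<in>A. k i * time_integral \<psi> (fst i) (snd i) t x \<xi>) \<partial>lborel)
      = (\<Sum>i\<in>A. k i * (\<integral>\<xi>. time_integral \<psi> (fst i) (snd i) t x \<xi> \<partial>lborel))"
    unfolding integral_mult_right_zero[symmetric]
    by (rule Bochner_Integration.integral_sum)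
      (intro integrable_mult_right time_integral_integrable t A smooth)
  also have "1 / (2 * of_real pi) * \<dots> = (\<Sum>i\<in>A. u_coeff \<psi> (fst i) (snd i) t x * of_real (z (fst i) (snd i) \<omega>))"
    unfolding sum_distrib_left
  proof (intro sum.cong refl)
    fix i
    have "complex_of_real pi * 2 = of_real (sqrt (2 * pi)) * of_real (sqrt (2 * pi))"
      unfolding of_real_mult[symmetric] by simp
    then have c: "1 / (2 * of_real pi) * complex_of_real (sqrt (2 * pi)) = 1 / of_real (sqrt (2 * pi))"
      by (simp add: mult.commute)
    have "1 / (2 * of_real pi) * (k i * (\<integral>\<xi>. time_integral \<psi> (fst i) (snd i) t x \<xi> \<partial>lborel))
      = (1 / (2 * of_real pi) * complex_of_real (sqrt (2 * pi))) * (- \<i>) ^ (snd i - 1) *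
        (\<integral>\<xi>. time_integral \<psi> (fst i) (snd i) t x \<xi> \<partial>lborel) * of_real (z (fst i) (snd i) \<omega>)"
      unfolding k_def by (simp only: mult_ac)
    then show "1 / (2 * of_real pi) * (k i * (\<integral>\<xi>. time_integral \<psi> (fst i) (snd i) t x \<xi> \<partial>lborel))
      = u_coeff \<psi> (fst i) (snd i) t x * of_real (z (fst i) (snd i) \<omega>)"
      unfolding c u_coeff_time_integral by (simp only: times_divide_eq_left mult_1_left)
  qed
  finally show ?thesis by (simp only: A_def split_def)
qed

section \<open>Existence, uniqueness and representation of the solution\<close>

lemma L2_converges_of_real:
  assumes "\<And>k. square_integrable M (S k)" "square_integrable M X"
    and "(\<lambda>k. \<integral>\<omega>. (S k \<omega> - X \<omega>)\<^sup>2 \<partial>M) \<longlonglongrightarrow> 0"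
  shows "L2_converges M (\<lambda>k \<omega>. of_real (S k \<omega>)) (\<lambda>\<omega>. of_real (X \<omega>))"
proof -
  have [measurable]: "S k \<in> borel_measurable M" "X \<in> borel_measurable M" for k
    using assms(1,2) by (auto simp: square_integrable_real)
  have "(\<lambda>\<omega>. complex_of_real (S k \<omega>)) \<in> borel_measurable M" "(\<lambda>\<omega>. complex_of_real (X \<omega>)) \<in> borel_measurable M" for k
    by measurable
  then show ?thesis
    using assms by (simp add: L2_converges_def square_integrable_def of_real_diff[symmetric] del: of_real_diff)
qed

text \<open>For real approximations the squared distance to \<open>V\<close> splits into the part of the real component and
  the constant norm of the imaginary component, which therefore vanishes.\<close>

lemma L2_converges_of_real_unique:
  assumes S: "\<And>k. square_integrable M (S k)" and X: "square_integrable M X"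
    and lim: "(\<lambda>k. \<integral>\<omega>. (S k \<omega> - X \<omega>)\<^sup>2 \<partial>M) \<longlonglongrightarrow> 0"
    and V: "L2_converges M (\<lambda>k \<omega>. of_real (S k \<omega>)) V"
  shows "AE \<omega> in M. V \<omega> = of_real (X \<omega>)"
proof -
  have [measurable]: "V \<in> borel_measurable M" and V2: "integrable M (\<lambda>\<omega>. (cmod (V \<omega>))\<^sup>2)"
    using V by (auto simp: L2_converges_def square_integrable_def)
  have limV: "(\<lambda>k. \<integral>\<omega>. (cmod (of_real (S k \<omega>) - V \<omega>))\<^sup>2 \<partial>M) \<longlonglongrightarrow> 0"
    using V by (simp add: L2_converges_def)
  have part: "square_integrable M (\<lambda>\<omega>. Re (V \<omega>))" "square_integrable M (\<lambda>\<omega>. Im (V \<omega>))"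
    unfolding square_integrable_real
    by (auto intro!: Bochner_Integration.integrable_bound[OF V2] simp: cmod_power2)
  have sq: "square_integrable M (\<lambda>\<omega>. S k \<omega> - Re (V \<omega>))" for k
    by (rule square_integrable_diff[OF S part(1)])
  have split: "(\<integral>\<omega>. (cmod (of_real (S k \<omega>) - V \<omega>))\<^sup>2 \<partial>M)
      = (\<integral>\<omega>. (S k \<omega> - Re (V \<omega>))\<^sup>2 \<partial>M) + (\<integral>\<omega>. (Im (V \<omega>))\<^sup>2 \<partial>M)" for k
    unfolding cmod_power2 using sq[of k] part(2)
    by (subst Bochner_Integration.integral_add[symmetric]) (auto simp: square_integrable_real)
  have re: "(\<lambda>k. \<integral>\<omega>. (S k \<omega> - Re (V \<omega>))\<^sup>2 \<partial>M) \<longlonglongrightarrow> 0"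
  proof (rule tendsto_sandwich[OF always_eventually always_eventually tendsto_const limV])
    show "\<forall>k. (\<integral>\<omega>. (S k \<omega> - Re (V \<omega>))\<^sup>2 \<partial>M) \<le> (\<integral>\<omega>. (cmod (of_real (S k \<omega>) - V \<omega>))\<^sup>2 \<partial>M)"
      unfolding split by simp
  qed simp
  have "(\<integral>\<omega>. (Im (V \<omega>))\<^sup>2 \<partial>M) \<le> 0"
    by (rule LIMSEQ_le_const[OF limV]) (auto simp: split)
  then have "(\<integral>\<omega>. (Im (V \<omega>))\<^sup>2 \<partial>M) = 0" by (simp add: antisym)
  from square_integral_eq_0_AE[OF part(2) this] L2_limit_unique[OF S part(1) X re lim]
  show ?thesis by eventually_elim (simp add: complex_eq_iff)
qed

text \<open>Square-summable families form a vector space. For the Gaussian field property: a linear combination of values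
  of the field is again a series in the same noise.\<close>

lemma summable_on_square_sum:
  fixes c :: "'p \<Rightarrow> 'i \<Rightarrow> real"
  assumes "\<And>p. p \<in> P \<Longrightarrow> (\<lambda>i. (c p i)\<^sup>2) summable_on I"
  shows "(\<lambda>i. (\<Sum>p\<in>P. a p * c p i)\<^sup>2) summable_on I"
  using assms
proof (induction P rule: infinite_finite_induct)
  case (insert q P)
  have s: "(\<lambda>i. 2 * (a q)\<^sup>2 * (c q i)\<^sup>2 + 2 * (\<Sum>p\<in>P. a p * c p i)\<^sup>2) summable_on I"
    using insert by (intro summable_on_add summable_on_cmult_right) auto
  show ?case
  proof (rule summable_on_comparison_test[OF s])
    fix i
    have "(x + y)\<^sup>2 \<le> 2 * x\<^sup>2 + 2 * y\<^sup>2" for x y :: real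
      using sum_squares_bound[of x y] by (simp add: power2_sum)
    from this[of "a q * c q i" "\<Sum>p\<in>P. a p * c p i"]
    show "(\<Sum>p\<in>insert q P. a p * c p i)\<^sup>2 \<le> 2 * (a q)\<^sup>2 * (c q i)\<^sup>2 + 2 * (\<Sum>p\<in>P. a p * c p i)\<^sup>2"
      using insert by (simp add: power_mult_distrib)
  qed simp
qed simp_all

theorem theorem1p1:
  fixes M :: "'a measure"
    and \<psi> :: "nat \<Rightarrow> real \<Rightarrow> real"
    and z :: "nat \<Rightarrow> nat \<Rightarrow> 'a \<Rightarrow> real"
  assumes "prob_space M"
    and "\<And>m. m \<ge> 1 \<Longrightarrow> smooth_on_halfline (\<psi> m)"
    and "orthonormal_basis_L2 (restrict_space lborel {0..}) \<psi>"
    and "prob_space.indep_vars M (\<lambda>_. borel) (\<lambda>(m, n). z m n) ({1..} \<times> {1..})"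
    and "\<And>m n. m \<ge> 1 \<Longrightarrow> n \<ge> 1 \<Longrightarrow> distributed M lborel (z m n) std_normal_density"
  shows "\<exists>U :: real \<Rightarrow> real \<Rightarrow> 'a \<Rightarrow> complex.
      mild_solution M \<psi> z U \<and>
      (\<forall>V. mild_solution M \<psi> z V \<longrightarrow> (\<forall>t\<ge>0. \<forall>x. AE \<omega> in M. V t x \<omega> = U t x \<omega>)) \<and>
      gaussian_field M U \<and>
      (\<forall>F. exhausts F ({1..} \<times> {1..}) \<longrightarrow> (\<forall>t\<ge>0. \<forall>x.
         L2_converges M (\<lambda>k \<omega>. \<Sum>(m, n)\<in>F k. u_coeff \<psi> m n t x * of_real (z m n \<omega>)) (U t x) \<and>
         (AE \<omega> in M. (\<lambda>k. \<Sum>(m, n)\<in>F k. u_coeff \<psi> m n t x * of_real (z m n \<omega>)) \<longlonglongrightarrow> U t x \<omega>))) \<and>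
      (\<forall>t\<ge>0. \<forall>x.
         (\<integral>\<^sup>+\<omega>. ennreal ((cmod (U t x \<omega>))\<^sup>2) \<partial>M) =
           ennreal (1 / pi) *
           (\<integral>\<^sup>+\<rho>\<in>{0..}. (\<integral>\<^sup>+s\<in>{0..t}. ennreal (\<bar>tricomi_C t s \<rho>\<bar>\<^sup>2) \<partial>lborel) \<partial>lborel) \<and>
         (\<integral>\<^sup>+\<rho>\<in>{0..}. (\<integral>\<^sup>+s\<in>{0..t}. ennreal (\<bar>tricomi_C t s \<rho>\<bar>\<^sup>2) \<partial>lborel) \<partial>lborel) < \<infinity>)"
proof -
  define Z where "Z = (\<lambda>(m, n). z m n)"
  define I :: "(nat \<times> nat) set" where "I = {1..} \<times> {1..}"
  interpret gaussian_noise M Z I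
    by (intro gaussian_noise.intro gaussian_noise_axioms.intro assms(1))
      (use assms(4,5) in \<open>auto simp: Z_def I_def\<close>)
  define Q where "Q t = (\<integral>\<^sup>+\<rho>\<in>{0..}. (\<integral>\<^sup>+s\<in>{0..t}. ennreal (\<bar>tricomi_C t s \<rho>\<bar>\<^sup>2) \<partial>lborel) \<partial>lborel)" for t
  have Q: "Q t < \<infinity>" if "t \<ge> 0" for t
    unfolding Q_def by (rule tricomi_C_nn_integral_finite[OF that])
  define c where "c = (\<lambda>(t, x) (m, n). Re (u_coeff \<psi> m n t x))"
  have u: "u_coeff \<psi> m n t x = of_real (c (t, x) (m, n))" if "t \<ge> 0" "(m, n) \<in> I" for m n t x
    using u_coeff_real[of t n \<psi> m x] that assms(2) by (simp add: c_def I_def)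
  have partial_sum: "(\<Sum>(m, n)\<in>A. u_coeff \<psi> m n t x * of_real (z m n \<omega>)) = of_real (noise_sum (c (t, x)) A \<omega>)"
    if "t \<ge> 0" "A \<subseteq> I" for t x A \<omega>
    unfolding noise_sum_def of_real_sum using that by (intro sum.cong refl) (auto simp: u Z_def)
  have c: "(\<lambda>i. (c (t, x) i)\<^sup>2) summable_on I" "ennreal (infsum (\<lambda>i. (c (t, x) i)\<^sup>2) I) = ennreal (1 / pi) * Q t"
    if "t \<ge> 0" for t x
  proof -
    have S: "(\<Sum>n. \<Sum>m. ennreal ((c (t, x) (Suc m, Suc n))\<^sup>2)) = ennreal (1 / pi) * Q t"
      unfolding c_def prod.case Q_def by (rule u_coeff_square_sum[OF that assms(2,3)])
    have "ennreal (1 / pi) * Q t < \<infinity>"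
      using Q[OF that] by (simp add: ennreal_mult_less_top)
    from summable_on_grid[of "\<lambda>i. (c (t, x) i)\<^sup>2", OF zero_le_power2 S this]
    show "(\<lambda>i. (c (t, x) i)\<^sup>2) summable_on I" "ennreal (infsum (\<lambda>i. (c (t, x) i)\<^sup>2) I) = ennreal (1 / pi) * Q t"
      unfolding I_def by this+
  qed
  \<comment> \<open>The squares, along which the approximate solutions are the partial sums.\<close>
  define F0 :: "nat \<Rightarrow> (nat \<times> nat) set" where "F0 N = {1..N} \<times> {1..N}" for N
  have F0: "exhausts F0 I"
    unfolding exhausts_def
  proof (intro conjI allI)
    show "(\<Union>k. F0 k) = I"
    proof (intro equalityI subsetI)
      fix i assume "i \<in> I"
      then have "i \<in> F0 (max (fst i) (snd i))" by (auto simp: I_def F0_def)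
      then show "i \<in> (\<Union>k. F0 k)" by blast
    qed (auto simp: F0_def I_def)
  qed (auto simp: F0_def incseq_def)
  have sub: "F k \<subseteq> I" if "exhausts F I" for F k using that by (auto simp: exhausts_def)
  define good where "good p X \<longleftrightarrow> square_integrable M X \<and>
      expectation (\<lambda>\<omega>. (X \<omega>)\<^sup>2) = infsum (\<lambda>i. (c p i)\<^sup>2) I \<and>
      (\<forall>F. exhausts F I \<longrightarrow> (\<lambda>k. expectation (\<lambda>\<omega>. (noise_sum (c p) (F k) \<omega> - X \<omega>)\<^sup>2)) \<longlonglongrightarrow> 0 \<and>
         (AE \<omega> in M. (\<lambda>k. noise_sum (c p) (F k) \<omega>) \<longlonglongrightarrow> X \<omega>))" for p X
  have "\<exists>X. \<forall>p. fst p \<ge> 0 \<longrightarrow> good p (X p)"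
  proof (rule choice, rule allI)
    fix p :: "real \<times> real"
    show "\<exists>X. fst p \<ge> 0 \<longrightarrow> good p X"
      using gaussian_series_converges[OF F0 c(1)[of "fst p" "snd p"]] unfolding good_def prod.collapse by blast
  qed
  then obtain X where X: "\<And>t x. t \<ge> 0 \<Longrightarrow> good (t, x) (X (t, x))" by fastforce
  have X1: "square_integrable M (X (t, x))"
    and X2: "expectation (\<lambda>\<omega>. (X (t, x) \<omega>)\<^sup>2) = infsum (\<lambda>i. (c (t, x) i)\<^sup>2) I"
    and X3: "\<And>F. exhausts F I \<Longrightarrow> (\<lambda>k. expectation (\<lambda>\<omega>. (noise_sum (c (t, x)) (F k) \<omega> - X (t, x) \<omega>)\<^sup>2)) \<longlonglongrightarrow> 0"
    and X4: "\<And>F. exhausts F I \<Longrightarrow> AE \<omega> in M. (\<lambda>k. noise_sum (c (t, x)) (F k) \<omega>) \<longlonglongrightarrow> X (t, x) \<omega>"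
    if "t \<ge> 0" for t x
    using X[OF that, of x] unfolding good_def by auto
  define U where "U t x \<omega> = complex_of_real (X (t, x) \<omega>)" for t x \<omega>
  have approx: "approx_solution \<psi> z N t x = (\<lambda>\<omega>. of_real (noise_sum (c (t, x)) (F0 N) \<omega>))" if "t \<ge> 0" for N t x
    using approx_solution_eq[OF that assms(2), where z = z and N = N and x = x] partial_sum[OF that sub[OF F0]]
    by (simp add: fun_eq_iff F0_def)
  have L2: "L2_converges M (\<lambda>k \<omega>. of_real (noise_sum (c (t, x)) (F k) \<omega>)) (U t x)"
    if "t \<ge> 0" "exhausts F I" for t x F
    unfolding U_def
    by (rule L2_converges_of_real[OF noise_sum_square_integrable[OF sub[OF that(2)]] X1[OF that(1)] X3[OF that]])
  have mild: "mild_solution M \<psi> z U"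
    unfolding mild_solution_def using L2[OF _ F0] by (simp add: approx)
  have unique: "AE \<omega> in M. V t x \<omega> = U t x \<omega>" if V: "mild_solution M \<psi> z V" and t: "t \<ge> 0" for V t x
  proof -
    have "L2_converges M (\<lambda>k \<omega>. of_real (noise_sum (c (t, x)) (F0 k) \<omega>)) (V t x)"
      using V t by (simp add: mild_solution_def approx)
    from L2_converges_of_real_unique[OF noise_sum_square_integrable[OF sub[OF F0]] X1[OF t] X3[OF t F0] this]
    show ?thesis by (simp add: U_def)
  qed
  have series: "L2_converges M (\<lambda>k \<omega>. \<Sum>(m, n)\<in>F k. u_coeff \<psi> m n t x * of_real (z m n \<omega>)) (U t x)"
    "AE \<omega> in M. (\<lambda>k. \<Sum>(m, n)\<in>F k. u_coeff \<psi> m n t x * of_real (z m n \<omega>)) \<longlonglongrightarrow> U t x \<omega>"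
    if "t \<ge> 0" "exhausts F I" for t x F
    unfolding partial_sum[OF that(1) sub[OF that(2)]]
    using L2[OF that] X4[OF that, of x] by (auto simp: U_def tendsto_of_real_iff)
  have variance: "(\<integral>\<^sup>+\<omega>. ennreal ((cmod (U t x \<omega>))\<^sup>2) \<partial>M) = ennreal (1 / pi) * Q t" if "t \<ge> 0" for t x
  proof -
    have "(\<integral>\<^sup>+\<omega>. ennreal ((cmod (U t x \<omega>))\<^sup>2) \<partial>M) = (\<integral>\<^sup>+\<omega>. ennreal ((X (t, x) \<omega>)\<^sup>2) \<partial>M)"
      by (simp add: U_def)
    also have "\<dots> = ennreal (expectation (\<lambda>\<omega>. (X (t, x) \<omega>)\<^sup>2))"
      by (rule nn_integral_eq_integral) (use X1[OF that] in \<open>auto simp: square_integrable_real\<close>)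
    finally show ?thesis by (simp only: X2[OF that] c(2)[OF that])
  qed
  have field: "gaussian_field M U"
    unfolding gaussian_field_def
  proof (intro conjI allI impI)
    fix t x :: real assume t: "t \<ge> 0"
    show "U t x \<in> borel_measurable M" "AE \<omega> in M. U t x \<omega> \<in> \<real>"
      using X1[OF t, of x] by (auto simp: U_def[abs_def] square_integrable_real)
  next
    fix P :: "(real \<times> real) set" and a :: "real \<times> real \<Rightarrow> real"
    assume P: "P \<subseteq> {0..} \<times> UNIV" and fin: "finite P"
    \<comment> \<open>The coefficients of the linear combination as a series in the noise.\<close>
    define d where "d i = (\<Sum>p\<in>P. a p * c p i)" for i
    have P0: "fst p \<ge> 0" if "p \<in> P" for p using P that by auto
    have d: "(\<lambda>i. (d i)\<^sup>2) summable_on I"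
      unfolding d_def
    proof (rule summable_on_square_sum)
      fix p assume "p \<in> P"
      then show "(\<lambda>i. (c p i)\<^sup>2) summable_on I" using c(1)[OF P0, of p "snd p"] by simp
    qed
    have Xp: "X p \<in> borel_measurable M" "AE \<omega> in M. (\<lambda>k. noise_sum (c p) (F0 k) \<omega>) \<longlonglongrightarrow> X p \<omega>" if "p \<in> P" for p
      using X1[OF P0[OF that], of "snd p"] X4[OF P0[OF that] F0, of "snd p"]
      by (simp_all add: square_integrable_real)
    have "AE \<omega> in M. \<forall>p\<in>P. (\<lambda>k. noise_sum (c p) (F0 k) \<omega>) \<longlonglongrightarrow> X p \<omega>"
      using Xp(2) by (simp add: AE_finite_all[OF fin])
    then have "AE \<omega> in M. (\<lambda>k. noise_sum d (F0 k) \<omega>) \<longlonglongrightarrow> (\<Sum>p\<in>P. a p * X p \<omega>)"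
    proof eventually_elim
      case (elim \<omega>)
      have "noise_sum d (F0 k) \<omega> = (\<Sum>p\<in>P. a p * noise_sum (c p) (F0 k) \<omega>)" for k
      proof -
        have "noise_sum d (F0 k) \<omega> = (\<Sum>i\<in>F0 k. \<Sum>p\<in>P. a p * (c p i * Z i \<omega>))"
          unfolding noise_sum_def d_def by (simp add: sum_distrib_right mult.assoc)
        also have "\<dots> = (\<Sum>p\<in>P. \<Sum>i\<in>F0 k. a p * (c p i * Z i \<omega>))" by (rule sum.swap)
        finally show ?thesis by (simp add: noise_sum_def sum_distrib_left)
      qed
      then show ?case using elim by (simp only:) (intro tendsto_sum tendsto_mult tendsto_const, blast)
    qed
    moreover have "(\<lambda>\<omega>. \<Sum>p\<in>P. a p * X p \<omega>) \<in> borel_measurable M"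
      using Xp(1) by (intro borel_measurable_sum borel_measurable_times) auto
    ultimately have "gaussian_rv M (\<lambda>\<omega>. \<Sum>p\<in>P. a p * X p \<omega>)"
      by (intro gaussian_limit[OF F0 d])
    then show "gaussian_rv M (\<lambda>\<omega>. \<Sum>(t, x)\<in>P. a (t, x) * Re (U t x \<omega>))"
      by (simp add: U_def split_def)
  qed
  show ?thesis
    using mild unique field series variance Q unfolding I_def[symmetric] Q_def[symmetric]
    by (intro exI[of _ U]) blast
qed

end
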